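(* Suppose that there exists a real number $r\ge 1$ for which Property $(\mathcal P_r)$ is satisfied. Let $f:\Omega\to\mathbf R^d$ be a $\nu$-centered (i.e. $\int_\Omega f\,d\nu=0$), bounded, $\eta$-Hölder continuous function. If the matrix $D(f)$ is nondegenerate (invertible), then the sequence of random variables $\left(\frac{S_n(f)}{\sqrt n}\right)_{n\ge 1}$ on $(\Omega,\mathcal F,\nu)$ converges in distribution to a $d$-dimensional random variable with normal distribution $\mathcal N(0,D(f))$, and $$\forall \alpha>0,\qquad \Pi\left(\nu_*\left(\frac{1}{\sqrt n}S_n(f)\right),\mathcal N(0,D(f))\right)=O\left(n^{-1/2+\alpha}\right)\quad (n\to+\infty).$$
   Context: $(\Omega,\mathcal F,\nu,T)$ is a probability dynamical system: $(\Omega,\mathcal F,\nu)$ is a probability space and $T:\Omega\to\Omega$ is a measurable $\nu$-preserving transformation. $\Omega$ is endowed with a metric $\rho$ and $\mathcal F$ is the associated Borel $\sigma$-algebra. $\mathbf E_\nu[f]=\int_\Omega f\,d\nu$ and $\mathrm{Cov}_\nu(f,g)=\mathbf E_\nu[fg]-\mathbf E_\nu[f]\mathbf E_\nu[g]$. A real number $\eta\in(0,1]$ is fixed. For a bounded $\eta$-Hölder continuous $f:\Omega\to\mathbf C$, $\|f\|_\infty=\sup|f|$ and $C_f^{(\eta)}=\sup_{x\ne y}\frac{|f(x)-f(y)|}{\rho(x,y)^\eta}$. Property $(\mathcal P_r)$ (for a real $r\ge1$): there exist a polynomial function $P_r$ with real nonnegative coefficients and a real number $\delta_r\in(0,1)$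 such that, for all positive integers $m,m'$, all bounded $\eta$-Hölder continuous functions $f_1,\dots,f_{m+m'}:\Omega\to\mathbf C$, all increasing finite sequences of nonnegative integers $(k_1,\dots,k_m)$ and $(l_1,\dots,l_{m'})$ and every nonnegative integer $n$, $$\left|\mathrm{Cov}_\nu\left(\prod_{i=1}^m f_i\circ T^{k_i},\prod_{j=1}^{m'}f_{m+j}\circ T^{n+l_j}\right)\right|\le\left(\prod_{i=1}^{m+m'}\|f_i\|_\infty+\sum_{i=1}^{m+m'}C^{(\eta)}_{f_i}\prod_{j\ne i}\|f_j\|_\infty\right)P_r(l_{m'})\,\delta_r^{\,n-rk_m}.$$ $d\ge1$ is an integer; $\mathbf R^d$ has the norm $|\cdot|_\infty$ (maximum of absolute values of coordinates). For $A,B\in\mathbf R^d$, $A\otimes B$ is the $d\times d$ matrix $A\cdot{}^TB$ and $A^{\otimes2}=A\otimes A$. $S_n(f)=\sum_{k=0}^{n-1}f\circ T^k$. Under the stated hypotheses the limit $D(f)=\lim_{n\to+\infty}\mathbf E_\nu\left[\left(\frac{S_n(f)}{\sqrt n}\right)^{\otimes2}\right]$ exists and $D(f)=\mathbf E_\nu[f\otimes f]+\sum_{k\ge1}(\mathbf E_\nu[f\otimes f\circ T^k]+\mathbf E_\nu[f\circ T^k\otimes f])$. $\nu_*(X)$ is the distribution (image measure) of $X$ under $\nu$. $\mathcal N(A,C)$ is the normal distribution with mean $A$ and covariance matrix $C$. The Prokhorov metric between Borel probability measures $P,Q$ on $\mathbf R^d$ is $\Pi(P,Q)=\inf\{\varepsilon>0:\sup_B(P(B)-Q(B^\varepsilon))\le\varepsilon\}$,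 the supremum being over Borel sets $B\subseteq\mathbf R^d$, with $B^\varepsilon$ the open $\varepsilon$-neighborhood of $B$ for $|\cdot|_\infty$. *)

theory Defs
  imports "HOL-Probability.Probability" "HOL-Library.Landau_Symbols"
    "HOL-Computational_Algebra.Polynomial"
begin

text \<open>
  For \<open>f\<close> with values in \<open>real ^ 'd\<close>, \<open>dist\<close> is the Euclidean distance; as all norms on
  \<open>real ^ 'd\<close> are equivalent, the maximum norm gives the same class of functions.
\<close>

definition bounded_holder :: "real \<Rightarrow> ('a::metric_space \<Rightarrow> 'b::metric_space) \<Rightarrow> bool" where
  "bounded_holder \<eta> f \<longleftrightarrow>
     bounded (range f) \<and> (\<exists>C. \<forall>x y. dist (f x) (f y) \<le> C * dist x y powr \<eta>)"

definition sup_norm :: "('a \<Rightarrow> complex) \<Rightarrow> real" where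
  "sup_norm f = (SUP x. norm (f x))"

text \<open>
  Inserting \<open>0\<close> only matters on a one-point space, where the supremum is over the empty set.
\<close>

definition holder_const :: "real \<Rightarrow> ('a::metric_space \<Rightarrow> complex) \<Rightarrow> real" where
  "holder_const \<eta> f =
     Sup (insert 0 {norm (f x - f y) / dist x y powr \<eta> | x y. x \<noteq> y})"

definition cov :: "'a measure \<Rightarrow> ('a \<Rightarrow> complex) \<Rightarrow> ('a \<Rightarrow> complex) \<Rightarrow> complex" where
  "cov M f g = (LINT x|M. f x * g x) - (LINT x|M. f x) * (LINT x|M. g x)"

text \<open>
  Property \<open>(P_r)\<close>.  Only strictly increasing sequences are considered; allowing repetitions would
  not make the property stronger, since factors composed with the same power of \<open>T\<close> can be merged
  into one bounded Hoelder factor without increasing the right-hand side.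
\<close>

definition property_P ::
  "'a::metric_space measure \<Rightarrow> ('a \<Rightarrow> 'a) \<Rightarrow> real \<Rightarrow> real \<Rightarrow> bool" where
  "property_P M T \<eta> r \<longleftrightarrow>
     (\<exists>(P :: real poly) \<delta>. (\<forall>i. 0 \<le> coeff P i) \<and> 0 < \<delta> \<and> \<delta> < 1 \<and>
       (\<forall>(m::nat) (m'::nat) (f :: nat \<Rightarrow> 'a \<Rightarrow> complex) (k :: nat \<Rightarrow> nat) (l :: nat \<Rightarrow> nat) (n::nat).
          1 \<le> m \<longrightarrow> 1 \<le> m' \<longrightarrow>
          (\<forall>i\<in>{1..m+m'}. bounded_holder \<eta> (f i)) \<longrightarrow>
          strict_mono_on {1..m} k \<longrightarrow> strict_mono_on {1..m'} l \<longrightarrow>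
          norm (cov M (\<lambda>x. \<Prod>i=1..m. f i ((T ^^ k i) x))
                      (\<lambda>x. \<Prod>j=1..m'. f (m + j) ((T ^^ (n + l j)) x)))
          \<le> ((\<Prod>i=1..m+m'. sup_norm (f i))
              + (\<Sum>i=1..m+m'. holder_const \<eta> (f i) * (\<Prod>j\<in>{1..m+m'} - {i}. sup_norm (f j))))
             * poly P (real (l m')) * \<delta> powr (real n - r * real (k m))))"

definition birkhoff_sum :: "('a \<Rightarrow> 'a) \<Rightarrow> ('a \<Rightarrow> 'b::comm_monoid_add) \<Rightarrow> nat \<Rightarrow> 'a \<Rightarrow> 'b" where
  "birkhoff_sum T f n x = (\<Sum>k<n. f ((T ^^ k) x))"

definition normalized_sum ::
  "('a \<Rightarrow> 'a) \<Rightarrow> ('a \<Rightarrow> real ^ 'd) \<Rightarrow> nat \<Rightarrow> 'a \<Rightarrow> real ^ 'd" where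
  "normalized_sum T f n x = (1 / sqrt (real n)) *\<^sub>R birkhoff_sum T f n x"

definition outer_prod :: "real ^ 'd \<Rightarrow> real ^ 'd \<Rightarrow> real ^ 'd ^ 'd" where
  "outer_prod A B = (\<chi> i j. A $ i * B $ j)"

definition asymp_cov :: "'a measure \<Rightarrow> ('a \<Rightarrow> 'a) \<Rightarrow> ('a \<Rightarrow> real ^ 'd) \<Rightarrow> real ^ 'd ^ 'd" where
  "asymp_cov M T f =
     lim (\<lambda>n. LINT x|M. outer_prod (normalized_sum T f n x) (normalized_sum T f n x))"

text \<open>
  Normal distribution with mean \<open>A\<close> and covariance matrix \<open>C\<close>, given by its Lebesgue density.
  This is meaningful only for symmetric positive definite \<open>C\<close>.
\<close>

definition normal_distr :: "real ^ 'd \<Rightarrow> real ^ 'd ^ 'd \<Rightarrow> (real ^ 'd) measure" where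
  "normal_distr A C = density lborel (\<lambda>x. ennreal
     (exp (- ((x - A) \<bullet> (matrix_inv C *v (x - A))) / 2) / sqrt ((2 * pi) ^ CARD('d) * det C)))"

definition weakly_converges ::
  "(nat \<Rightarrow> 'b::topological_space measure) \<Rightarrow> 'b measure \<Rightarrow> bool" where
  "weakly_converges \<mu> \<mu>' \<longleftrightarrow>
     (\<forall>g :: 'b \<Rightarrow> real. continuous_on UNIV g \<longrightarrow> bounded (range g) \<longrightarrow>
        (\<lambda>n. LINT x|\<mu> n. g x) \<longlonglongrightarrow> (LINT x|\<mu>'. g x))"

definition open_nbhd :: "real \<Rightarrow> (real ^ 'd) set \<Rightarrow> (real ^ 'd) set" where
  "open_nbhd \<epsilon> B = {x. \<exists>b\<in>B. infnorm (x - b) < \<epsilon>}"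

definition prokhorov :: "(real ^ 'd) measure \<Rightarrow> (real ^ 'd) measure \<Rightarrow> real" where
  "prokhorov P Q =
     Inf {\<epsilon>. 0 < \<epsilon> \<and> (SUP B\<in>sets borel. measure P B - measure Q (open_nbhd \<epsilon> B)) \<le> \<epsilon>}"

end

theory Submission
  imports Defs "HOL-Real_Asymp.Real_Asymp"
begin

text \<open>
  Write \<open>S_n\<close> for the Birkhoff sum, \<open>h_n(u) = E exp(i u.S_n)\<close> and \<open>\<sigma>\<^sup>2(u) = u.D u\<close>.
  Everything rests on one estimate, \<open>hchar_estimate\<close>: for all \<open>\<beta> > 0\<close> and \<open>A\<close>, uniformly for
  \<open>|u| \<le> n^(-3\<beta>)\<close>,
  \<open>|h_n(u) - exp(-n \<sigma>\<^sup>2(u) / 2)| \<le> C n^(2\<beta>) exp(-c n |u|\<^sup>2) (|u|\<^sup>2 + n |u|^3) + n^(-A)\<close>.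
  In terms of \<open>s = u sqrt n\<close> this compares the characteristic functions of \<open>S_n / sqrt n\<close> and of the
  normal distribution up to \<open>|s| = n^(1/2 - 3\<beta>)\<close>, with an error of order \<open>n^(-1/2 + 2\<beta>)\<close> that is
  integrable in \<open>s\<close>.

  Property \<open>(P_r)\<close> lets a past of length \<open>k\<close> be separated from the future only after a gap proportional to
  \<open>k\<close>, so one cannot cut \<open>S_n\<close> into long blocks with negligible gaps between them. Instead the first factor of
  \<open>exp(i u.S_n)\<close> is peeled off: with \<open>g_q = exp(i u.f(T^q x)) - 1 = O(|u|)\<close> one has
  \<open>h_n - h_(n-1) = E[g_0 exp(i u.(f(T x) + ... + f(T^(n-1) x)))]\<close>. The factors at the times
  \<open>1, ..., Q - 1\<close> are opened one after the other. Each step either leaves a gap of length \<open>Q\<close> after the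
  increment \<open>g_0\<close>, and then the expectation splits up to \<open>\<delta>^Q\<close>, or produces a further increment \<open>g_q\<close>. The
  same is done for products of several increments, with gaps growing geometrically
  (\<open>hierarchical_bound\<close>). With \<open>Q\<close> of order \<open>n^\<beta>\<close> every new increment gains a factor of order \<open>|u| Q\<close>, hence \<open>n^(-2\<beta>)\<close>, so after
  a bounded number of levels the remainder is below any power of \<open>n\<close>. The terms with one and two
  increments give \<open>-\<sigma>\<^sup>2(u) / 2\<close>, and the outcome is the recurrence \<open>hchar_recurrence\<close>,
  \<open>h_n = (1 - \<sigma>\<^sup>2(u) / 2) h_(n-1) + O(Q\<^sup>2 |u|^3 max |h_m|) + small\<close>, the maximum being over a window of
  length \<open>O(Q)\<close> before \<open>n\<close>. An induction on \<open>n\<close> turns it into the estimate (\<open>perturbed_decay\<close>).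

  The Prokhorov distance is reached by smoothing both distributions with a Gaussian of standard deviation
  \<open>\<epsilon> = n^(-1/2 + 4\<beta>)\<close>: this cuts off the frequencies beyond \<open>n^(1/2 - 3\<beta>)\<close> and moves mass by little more
  than \<open>\<epsilon>\<close>. Fourier inversion bounds the difference of the smoothed densities uniformly, and a uniform bound
  is enough for the difference of the measures, since both have mass one and the normal distribution has
  negligible mass outside a ball of radius \<open>n^\<beta>\<close> (\<open>smoothing_inequality\<close>). All losses are powers of
  \<open>n^\<beta>\<close> with \<open>\<beta>\<close> arbitrarily small. Convergence in distribution is a consequence of the inequalities
  \<open>P_n(F) \<le> N(F^\<epsilon>) + \<epsilon>\<close> obtained on the way.
\<close>

section \<open>Linear changes of variables for Lebesgue measure\<close>

text \<open>
  By Fubini the coordinate along \<open>b0\<close> may be integrated first, and in this coordinate the shear is a translation.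
\<close>

lemma nn_integral_lborel_shear:
  fixes g :: "'b::euclidean_space \<Rightarrow> ennreal"
  assumes b: "b0 \<in> Basis" "b1 \<in> Basis" "b0 \<noteq> b1" and g [measurable]: "g \<in> borel_measurable borel"
  shows "(\<integral>\<^sup>+x. g (x + (x \<bullet> b1) *\<^sub>R b0) \<partial>lborel) = (\<integral>\<^sup>+x. g x \<partial>lborel)"
proof -
  interpret product_sigma_finite "\<lambda>_::'b. lborel :: real measure"
    by standard
  let ?\<Phi> = "\<lambda>\<omega>::'b \<Rightarrow> real. \<Sum>b\<in>Basis. \<omega> b *\<^sub>R b"
  have [measurable]: "(\<lambda>\<omega>. ?\<Phi> \<omega>) \<in> borel_measurable (\<Pi>\<^sub>M b\<in>Basis. lborel)"
    by (rule borel_measurable_sum) simp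
  let ?I = "Basis - {b0}"
  have ins: "insert b0 ?I = Basis" using b by auto
  have key: "(\<integral>\<^sup>+x. k x \<partial>lborel) =
      (\<integral>\<^sup>+\<omega>. (\<integral>\<^sup>+y. k (?\<Phi> (fun_upd \<omega> b0 y)) \<partial>lborel) \<partial>(\<Pi>\<^sub>M b\<in>?I. lborel))"
    if [measurable]: "k \<in> borel_measurable borel" for k :: "'b \<Rightarrow> ennreal"
  proof -
    have m: "(\<lambda>\<omega>. k (?\<Phi> \<omega>)) \<in> borel_measurable (\<Pi>\<^sub>M b\<in>insert b0 ?I. lborel)"
      unfolding ins by measurable
    have "(\<integral>\<^sup>+x. k x \<partial>lborel) = (\<integral>\<^sup>+\<omega>. k (?\<Phi> \<omega>) \<partial>(\<Pi>\<^sub>M b\<in>Basis. lborel))"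
      by (subst lborel_eq) (simp add: nn_integral_distr)
    also have "\<dots> = (\<integral>\<^sup>+\<omega>. k (?\<Phi> \<omega>) \<partial>(\<Pi>\<^sub>M b\<in>insert b0 ?I. lborel))"
      unfolding ins ..
    also have "\<dots> = (\<integral>\<^sup>+\<omega>. (\<integral>\<^sup>+y. k (?\<Phi> (fun_upd \<omega> b0 y)) \<partial>lborel) \<partial>(\<Pi>\<^sub>M b\<in>?I. lborel))"
      by (rule product_nn_integral_insert[OF _ _ m]) auto
    finally show ?thesis .
  qed
  have upd: "?\<Phi> (fun_upd \<omega> b0 y) = y *\<^sub>R b0 + (\<Sum>b\<in>?I. \<omega> b *\<^sub>R b)" for \<omega> y
  proof -
    have "?\<Phi> (fun_upd \<omega> b0 y) = (fun_upd \<omega> b0 y) b0 *\<^sub>R b0 + (\<Sum>b\<in>?I. (fun_upd \<omega> b0 y) b *\<^sub>R b)"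
      by (rule sum.remove) (use b in auto)
    also have "(\<Sum>b\<in>?I. (fun_upd \<omega> b0 y) b *\<^sub>R b) = (\<Sum>b\<in>?I. \<omega> b *\<^sub>R b)"
      by (rule sum.cong) auto
    finally show ?thesis by simp
  qed
  have comp: "?\<Phi> (fun_upd \<omega> b0 y) + (?\<Phi> (fun_upd \<omega> b0 y) \<bullet> b1) *\<^sub>R b0 = ?\<Phi> (fun_upd \<omega> b0 (\<omega> b1 + 1 * y))" for \<omega> y
  proof -
    have "?\<Phi> (fun_upd \<omega> b0 y) \<bullet> b1 = \<omega> b1"
      using b by (simp add: inner_sum_left inner_Basis if_distrib [of "\<lambda>z. _ * z"] cong: if_cong)
    then show ?thesis unfolding upd by (simp add: algebra_simps)
  qed
  have "(\<integral>\<^sup>+x. g (x + (x \<bullet> b1) *\<^sub>R b0) \<partial>lborel) =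
    (\<integral>\<^sup>+\<omega>. (\<integral>\<^sup>+y. g (?\<Phi> (fun_upd \<omega> b0 (\<omega> b1 + 1 * y))) \<partial>lborel) \<partial>(\<Pi>\<^sub>M b\<in>?I. lborel))"
    by (subst key) (simp_all only: comp, measurable)
  also have "\<dots> = (\<integral>\<^sup>+\<omega>. (\<integral>\<^sup>+y. g (?\<Phi> (fun_upd \<omega> b0 y)) \<partial>lborel) \<partial>(\<Pi>\<^sub>M b\<in>?I. lborel))"
  proof (rule nn_integral_cong)
    fix \<omega> :: "'b \<Rightarrow> real"
    have m: "(\<lambda>y. g (?\<Phi> (fun_upd \<omega> b0 y))) \<in> borel_measurable borel"
      unfolding upd by measurable
    show "(\<integral>\<^sup>+y. g (?\<Phi> (fun_upd \<omega> b0 (\<omega> b1 + 1 * y))) \<partial>lborel) = (\<integral>\<^sup>+y. g (?\<Phi> (fun_upd \<omega> b0 y)) \<partial>lborel)"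
      using nn_integral_real_affine[OF m, of 1 "\<omega> b1"] by simp
  qed
  also have "\<dots> = (\<integral>\<^sup>+x. g x \<partial>lborel)" by (subst key) auto
  finally show ?thesis .
qed

text \<open>
  The formula is multiplicative in \<open>A\<close>, and every matrix is a product of diagonal matrices,
  coordinate transpositions and shears.
\<close>

lemma nn_integral_lborel_linear:
  fixes A :: "real^'n^'n"
  assumes "det A \<noteq> 0" and "g \<in> borel_measurable borel"
  shows "(\<integral>\<^sup>+x. g x \<partial>lborel) = ennreal \<bar>det A\<bar> * (\<integral>\<^sup>+x. g (A *v x) \<partial>lborel)"
proof -
  let ?P = "\<lambda>A::real^'n^'n. det A \<noteq> 0 \<longrightarrow> (\<forall>g\<in>borel_measurable borel.
    (\<integral>\<^sup>+x. g x \<partial>lborel) = ennreal \<bar>det A\<bar> * (\<integral>\<^sup>+x. g (A *v x) \<partial>lborel))"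
  have mA[measurable]: "(\<lambda>x. A *v x) \<in> borel_measurable borel" for A :: "real^'n^'n"
    by (intro borel_measurable_continuous_onI continuous_intros)
  have "?P A"
  proof (induction A rule: induct_matrix_elementary_alt)
    case (1 A B)
    show ?case
    proof (intro impI ballI)
      fix g :: "real^'n \<Rightarrow> ennreal" assume d: "det (A ** B) \<noteq> 0" and g[measurable]: "g \<in> borel_measurable borel"
      have dA: "det A \<noteq> 0" and dB: "det B \<noteq> 0" using d by (auto simp: det_mul)
      have gA: "(\<lambda>x. g (A *v x)) \<in> borel_measurable borel" by measurable
      have "(\<integral>\<^sup>+x. g x \<partial>lborel) = ennreal \<bar>det A\<bar> * (\<integral>\<^sup>+x. g (A *v x) \<partial>lborel)"
        using 1(1) dA g by blast
      also have "(\<integral>\<^sup>+x. g (A *v x) \<partial>lborel) = ennreal \<bar>det B\<bar> * (\<integral>\<^sup>+x. g (A *v (B *v x)) \<partial>lborel)"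
        using 1(2) dB gA by blast
      finally show "(\<integral>\<^sup>+x. g x \<partial>lborel) = ennreal \<bar>det (A ** B)\<bar> * (\<integral>\<^sup>+x. g ((A ** B) *v x) \<partial>lborel)"
        by (simp add: det_mul abs_mult ennreal_mult' mult.assoc matrix_vector_mul_assoc)
    qed
  next
    case (2 A i)
    then show ?case using det_zero_row(2) by blast
  next
    case (3 A)
    show ?case
    proof (intro impI ballI)
      fix g :: "real^'n \<Rightarrow> ennreal" assume d: "det A \<noteq> 0" and g[measurable]: "g \<in> borel_measurable borel"
      have dA: "det A = (\<Prod>i\<in>UNIV. A$i$i)" by (rule det_diagonal) (use 3 in auto)
      define c where "c \<equiv> \<lambda>b::real^'n. A $ (axis_index b) $ (axis_index b)"
      have caxis: "c (axis i 1) = A $ i $ i" for i by (simp add: c_def axis_index_axis)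
      have Tx: "0 + (\<Sum>j\<in>Basis. (c j * (x \<bullet> j)) *\<^sub>R j) = A *v x" for x
      proof -
        have "(\<Sum>j\<in>Basis. (c j * (x \<bullet> j)) *\<^sub>R j) = (\<Sum>i\<in>UNIV. (A$i$i * x$i) *\<^sub>R axis i 1)"
          by (subst sum.reindex_bij_betw[where h="\<lambda>i. axis i (1::real)" and S=UNIV, symmetric])
             (auto simp: caxis inner_axis Basis_vec_def bij_betw_def inj_on_def axis_eq_axis)
        also have "\<dots> = A *v x"
        proof -
          have "A $ i $ i * x $ i = (\<Sum>j\<in>UNIV. A $ i $ j * x $ j)" for i
            by (simp add: 3 sum.remove [where x=i])
          then show ?thesis
            by (simp add: vec_eq_iff matrix_vector_mult_def sum_component axis_def if_distrib cong: if_cong)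
        qed
        finally show ?thesis by simp
      qed
      have cnz: "c j \<noteq> 0" if "j \<in> Basis" for j
        using that d unfolding dA by (auto simp: Basis_vec_def caxis)
      have pr: "(\<Prod>j\<in>Basis. \<bar>c j\<bar>) = \<bar>det A\<bar>"
        unfolding dA abs_prod
        by (subst prod.reindex_bij_betw[where h="\<lambda>i. axis i (1::real)" and S=UNIV, symmetric])
           (auto simp: caxis inner_axis Basis_vec_def bij_betw_def inj_on_def axis_eq_axis)
      have lb: "lborel = density (distr lborel borel ((*v) A)) (\<lambda>_. ennreal \<bar>det A\<bar>)"
        using lborel_affine_euclidean[of c 0, unfolded Tx pr] cnz by blast
      show "(\<integral>\<^sup>+x. g x \<partial>lborel) = ennreal \<bar>det A\<bar> * (\<integral>\<^sup>+x. g (A *v x) \<partial>lborel)"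
        by (subst lb) (simp add: nn_integral_density nn_integral_distr nn_integral_cmult)
    qed
  next
    case (4 m n)
    let ?A = "(\<chi> i j. mat 1 $ i $ Transposition.transpose m n j) :: real^'n^'n"
    have d: "\<bar>det ?A\<bar> = 1"
    proof -
      have "det ?A = of_int (sign (Transposition.transpose m n)) * det (mat 1 :: real^'n^'n)"
        by (rule det_permute_columns) (simp add: permutes_swap_id)
      then show ?thesis using 4 by (simp add: sign_swap_id)
    qed
    have Ax: "?A *v x = (\<chi> i. x $ Transposition.transpose m n i)" for x
    proof -
      have eq: "(\<Sum>j\<in>UNIV. (if i = Transposition.transpose m n j then 1 else 0) * x $ j) =
              (\<Sum>j\<in>UNIV. if j = Transposition.transpose m n i then x $ j else 0)" for i
        by (rule sum.cong) (auto simp add: swap_id_eq)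
      show ?thesis by (simp add: vec_eq_iff matrix_vector_mult_def mat_def eq)
    qed
    have lb: "lborel = distr lborel borel ((*v) ?A)"
    proof (rule lborel_eqI)
      fix l u :: "real^'n" assume le: "\<And>b. b \<in> Basis \<Longrightarrow> l \<bullet> b \<le> u \<bullet> b"
      have le': "l $ i \<le> u $ i" for i
        using le[of "axis i 1"] by (simp add: inner_axis axis_in_Basis_iff)
      let ?s = "Transposition.transpose m n"
      have vim: "(*v) ?A -` box l u = box (\<chi> i. l $ ?s i) (\<chi> i. u $ ?s i)"
        by (auto simp: Ax mem_box_cart) (metis transpose_involutory)+
      have "emeasure (distr lborel borel ((*v) ?A)) (box l u) = emeasure lborel (box (\<chi> i. l $ ?s i) (\<chi> i. u $ ?s i))"
        by (subst emeasure_distr) (auto simp: vim)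
      also have "\<dots> = (\<Prod>b\<in>Basis. ((\<chi> i. u $ ?s i) - (\<chi> i. l $ ?s i)) \<bullet> b)"
        by (rule emeasure_lborel_box) (use le' in \<open>auto simp: Basis_vec_def inner_axis\<close>)
      also have "(\<Prod>b\<in>Basis. ((\<chi> i. u $ ?s i) - (\<chi> i. l $ ?s i)) \<bullet> b) = (\<Prod>i\<in>UNIV. u $ ?s i - l $ ?s i)"
        by (subst prod.reindex_bij_betw[where h="\<lambda>i. axis i (1::real)" and S=UNIV, symmetric])
           (auto simp: inner_axis Basis_vec_def bij_betw_def inj_on_def axis_eq_axis)
      also have "\<dots> = (\<Prod>i\<in>UNIV. u $ i - l $ i)"
        by (rule prod.reindex_bij_betw[where h="?s" and S=UNIV and T=UNIV]) (simp)
      also have "\<dots> = (\<Prod>b\<in>Basis. (u - l) \<bullet> b)"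
        by (subst prod.reindex_bij_betw[where h="\<lambda>i. axis i (1::real)" and S=UNIV, symmetric])
           (auto simp: inner_axis Basis_vec_def bij_betw_def inj_on_def axis_eq_axis)
      finally show "emeasure (distr lborel borel ((*v) ?A)) (box l u) = ennreal (\<Prod>b\<in>Basis. (u - l) \<bullet> b)" .
    qed simp
    show ?case
    proof (intro impI ballI)
      fix g :: "real^'n \<Rightarrow> ennreal" assume g[measurable]: "g \<in> borel_measurable borel"
      show "(\<integral>\<^sup>+x. g x \<partial>lborel) = ennreal \<bar>det ?A\<bar> * (\<integral>\<^sup>+x. g (?A *v x) \<partial>lborel)"
        unfolding d by (subst lb) (simp add: nn_integral_distr)
    qed
  next
    case (5 m n)
    let ?A = "(\<chi> i j. of_bool (i = m \<and> j = n \<or> i = j)) :: real^'n^'n"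
    have d: "det ?A = 1"
    proof -
      have "?A = (\<chi> k. if k = m then row m (mat 1) + 1 *s row n (mat 1) else row k (mat 1))"
        using 5 by (auto simp: vec_eq_iff row_def mat_def)
      then show ?thesis using det_row_operation[OF 5, of "mat 1 :: real^'n^'n" 1] by simp
    qed
    have Ax: "?A *v x = x + (x \<bullet> axis n 1) *\<^sub>R axis m 1" for x
    proof -
      have "x $ m + x $ n = (\<Sum>j\<in>UNIV. of_bool (j = n \<or> m = j) * x $ j)"
        using 5 by (auto simp: of_bool_def if_distrib [of "\<lambda>x. x * y" for y] sum.remove cong: if_cong)
      then show ?thesis
        unfolding matrix_vector_mult_def of_bool_def inner_axis
        by (auto simp: vec_eq_iff axis_def if_distrib [of "\<lambda>x. x * y" for y] cong: if_cong)
    qed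
    show ?case
    proof (intro impI ballI)
      fix g :: "real^'n \<Rightarrow> ennreal" assume g[measurable]: "g \<in> borel_measurable borel"
      show "(\<integral>\<^sup>+x. g x \<partial>lborel) = ennreal \<bar>det ?A\<bar> * (\<integral>\<^sup>+x. g (?A *v x) \<partial>lborel)"
        unfolding d Ax using 5 by (subst nn_integral_lborel_shear) (auto simp: axis_eq_axis)
    qed
  qed
  then show ?thesis using assms by blast
qed

section \<open>Gaussian kernels and their Fourier transforms\<close>

lemma gaussian_fourier_real:
  fixes y b :: real
  assumes b: "0 < b"
  shows "integrable lborel (\<lambda>s. cis (s * y) * of_real (exp (- (b * s\<^sup>2) / 2)))"
    and "(\<integral>s. cis (s * y) * of_real (exp (- (b * s\<^sup>2) / 2)) \<partial>lborel) =
      complex_of_real (sqrt (2 * pi / b) * exp (- y\<^sup>2 / (2 * b)))"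
proof -
  define F where "F \<equiv> \<lambda>t x. cis (t * x) * complex_of_real (exp (- x\<^sup>2 / 2))"
  have eF: "F t x = of_real (sqrt (2 * pi)) * (std_normal_density x *\<^sub>R iexp (t * x))" for t x
    by (simp add: F_def std_normal_density_def cis_conv_exp scaleR_conv_of_real)
  have [measurable]: "F t \<in> borel_measurable borel" for t
    unfolding F_def cis_conv_exp by measurable
  have intF: "integrable lborel (F t)" for t
  proof -
    have "integrable lborel (\<lambda>x. sqrt (2 * pi) * std_normal_density x)"
      using integrable_normal_density[of 1 0] by simp
    then show ?thesis
      by (rule Bochner_Integration.integrable_bound) (auto simp: eF norm_mult std_normal_density_def)
  qed
  have valF: "(\<integral>x. F t x \<partial>lborel) = of_real (sqrt (2 * pi) * exp (- t\<^sup>2 / 2))" for t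
  proof -
    have "(\<integral>x. std_normal_density x *\<^sub>R iexp (t * x) \<partial>lborel) = of_real (exp (- t\<^sup>2 / 2))"
      using fun_cong[OF char_std_normal_distribution, of t]
      by (simp add: char_def integral_density)
    then show ?thesis unfolding eF integral_mult_right_zero by simp
  qed
  let ?c = "sqrt b"
  have c: "?c > 0" "?c * ?c = b" using b by auto
  have eq: "F (y / ?c) (0 + ?c * s) = cis (s * y) * of_real (exp (- (b * s\<^sup>2) / 2))" for s
    using c by (simp add: F_def power_mult_distrib mult.commute)
  have "integrable lborel (\<lambda>s. F (y / ?c) (0 + ?c * s))"
    by (rule lborel_integrable_real_affine) (use intF c in auto)
  then show "integrable lborel (\<lambda>s. cis (s * y) * of_real (exp (- (b * s\<^sup>2) / 2)))"
    by (simp only: eq)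
  have "of_real (sqrt (2 * pi) * exp (- (y / ?c)\<^sup>2 / 2)) = \<bar>?c\<bar> *\<^sub>R (\<integral>s. F (y / ?c) (0 + ?c * s) \<partial>lborel)"
    unfolding valF[symmetric] by (rule lborel_integral_real_affine) (use c in auto)
  then have "(\<integral>s. F (y / ?c) (0 + ?c * s) \<partial>lborel) = of_real (sqrt (2 * pi) * exp (- (y / ?c)\<^sup>2 / 2)) / of_real ?c"
    using c by (simp add: scaleR_conv_of_real field_simps)
  also have "\<dots> = of_real (sqrt (2 * pi / b) * exp (- y\<^sup>2 / (2 * b)))"
    using c b by (simp add: power_divide real_sqrt_divide mult.commute)
  finally show "(\<integral>s. cis (s * y) * of_real (exp (- (b * s\<^sup>2) / 2)) \<partial>lborel) =
      complex_of_real (sqrt (2 * pi / b) * exp (- y\<^sup>2 / (2 * b)))"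
    by (simp only: eq)
qed

lemma cis_sum: "finite A \<Longrightarrow> cis (\<Sum>i\<in>A. g i) = (\<Prod>i\<in>A. cis (g i))"
  by (induction A rule: finite_induct) (auto simp: cis_mult[symmetric])

lemma integral_lborel_prod_Basis:
  fixes \<phi> :: "'b::euclidean_space \<Rightarrow> real \<Rightarrow> complex"
  assumes int: "\<And>b. b \<in> Basis \<Longrightarrow> integrable lborel (\<phi> b)"
  shows "integrable lborel (\<lambda>x. \<Prod>b\<in>Basis. \<phi> b (x \<bullet> b))"
    and "(\<integral>x. (\<Prod>b\<in>Basis. \<phi> b (x \<bullet> b)) \<partial>lborel) = (\<Prod>b\<in>Basis. \<integral>x. \<phi> b x \<partial>lborel)"
proof -
  interpret product_sigma_finite "\<lambda>_::'b. lborel :: real measure"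
    by standard
  let ?\<Phi> = "\<lambda>\<omega>::'b \<Rightarrow> real. \<Sum>b\<in>Basis. \<omega> b *\<^sub>R b"
  have m1: "?\<Phi> \<in> measurable (\<Pi>\<^sub>M b\<in>Basis. lborel) borel"
    by (rule borel_measurable_sum) simp
  have m2: "(\<lambda>x::'b. \<Prod>b\<in>Basis. \<phi> b (x \<bullet> b)) \<in> borel_measurable borel"
  proof (rule borel_measurable_prod)
    fix b :: 'b assume "b \<in> Basis"
    then have "\<phi> b \<in> borel_measurable borel" using int[of b] by auto
    then show "(\<lambda>x. \<phi> b (x \<bullet> b)) \<in> borel_measurable borel"
      by (rule measurable_compose[rotated]) simp
  qed
  have eq: "(\<Prod>b\<in>Basis. \<phi> b (?\<Phi> \<omega> \<bullet> b)) = (\<Prod>b\<in>Basis. \<phi> b (\<omega> b))" for \<omega>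
    by (rule prod.cong) auto
  show "integrable lborel (\<lambda>x. \<Prod>b\<in>Basis. \<phi> b (x \<bullet> b))"
    by (subst lborel_eq, subst integrable_distr_eq[OF m1 m2], unfold eq)
       (rule product_integrable_prod, use int in auto)
  show "(\<integral>x. (\<Prod>b\<in>Basis. \<phi> b (x \<bullet> b)) \<partial>lborel) = (\<Prod>b\<in>Basis. \<integral>x. \<phi> b x \<partial>lborel)"
    by (subst lborel_eq, subst integral_distr[OF m1 m2], unfold eq)
       (rule product_integral_prod, use int in auto)
qed

text \<open>
  The integrand is a product of functions of the single coordinates, so the one-dimensional transform
  suffices.
\<close>

lemma gaussian_fourier:
  fixes y :: "'b::euclidean_space"
  assumes b: "0 < b"
  shows "integrable lborel (\<lambda>s::'b. cis (s \<bullet> y) * of_real (exp (- (b * (norm s)\<^sup>2) / 2)))"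
    and "(\<integral>s. cis (s \<bullet> y) * of_real (exp (- (b * (norm s)\<^sup>2) / 2)) \<partial>lborel) =
      complex_of_real (sqrt (2 * pi / b) ^ DIM('b) * exp (- (norm y)\<^sup>2 / (2 * b)))"
proof -
  define \<phi> where "\<phi> \<equiv> \<lambda>(i::'b) (t::real). cis (t * (y \<bullet> i)) * complex_of_real (exp (- (b * t\<^sup>2) / 2))"
  have norm2: "(norm z)\<^sup>2 = (\<Sum>i\<in>Basis. (z \<bullet> i)\<^sup>2)" for z :: 'b
    by (metis (no_types, lifting) euclidean_inner power2_eq_square power2_norm_eq_inner sum.cong)
  have eq: "cis (s \<bullet> y) * of_real (exp (- (b * (norm s)\<^sup>2) / 2)) = (\<Prod>i\<in>Basis. \<phi> i (s \<bullet> i))" for s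
    unfolding \<phi>_def prod.distrib norm2
    by (subst euclidean_inner, subst cis_sum)
       (simp_all add: sum_distrib_left sum_negf[symmetric] sum_divide_distrib exp_sum flip: of_real_prod)
  have ip: "integrable lborel (\<phi> i)" and vp: "(\<integral>t. \<phi> i t \<partial>lborel) = of_real (sqrt (2 * pi / b) * exp (- (y \<bullet> i)\<^sup>2 / (2 * b)))" for i
    using gaussian_fourier_real[OF b, of "y \<bullet> i"] by (simp_all add: \<phi>_def)
  show "integrable lborel (\<lambda>s::'b. cis (s \<bullet> y) * of_real (exp (- (b * (norm s)\<^sup>2) / 2)))"
    unfolding eq by (rule integral_lborel_prod_Basis(1)) (rule ip)
  show "(\<integral>s. cis (s \<bullet> y) * of_real (exp (- (b * (norm s)\<^sup>2) / 2)) \<partial>lborel) =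
      complex_of_real (sqrt (2 * pi / b) ^ DIM('b) * exp (- (norm y)\<^sup>2 / (2 * b)))"
    unfolding eq
    by (subst integral_lborel_prod_Basis(2)[OF ip])
       (simp add: vp prod.distrib norm2[of y] sum_negf[symmetric] sum_divide_distrib exp_sum flip: of_real_prod)
qed

section \<open>Normal distributions with positive definite covariance\<close>

text \<open>
  Gram-Schmidt for the inner product defined by \<open>D\<close>: normalize one vector of \<open>S\<close> and continue in its
  \<open>D\<close>-orthogonal complement in \<open>S\<close>, which has dimension one less.
\<close>

lemma pos_def_orthonormal:
  fixes D :: "real^'d^'d"
  assumes sym: "\<And>u v. u \<bullet> (D *v v) = v \<bullet> (D *v u)" and pos: "\<And>u. u \<noteq> 0 \<Longrightarrow> 0 < u \<bullet> (D *v u)"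
  shows "subspace S \<Longrightarrow> dim S = n \<Longrightarrow> \<exists>E\<subseteq>S. finite E \<and> card E = n \<and>
     (\<forall>x\<in>E. \<forall>y\<in>E. x \<bullet> (D *v y) = (if x = y then 1 else 0))"
proof (induction n arbitrary: S)
  case 0
  then show ?case by (intro exI[of _ "{}"]) auto
next
  case (Suc n)
  obtain v where v: "v \<in> S" "v \<noteq> 0"
    using Suc.prems by (metis dim_eq_0 nat.distinct(1) subsetI singleton_iff)
  define e where "e = (1 / sqrt (v \<bullet> (D *v v))) *\<^sub>R v"
  have eS: "e \<in> S" using v Suc.prems by (simp add: e_def subspace_scale)
  have ee: "e \<bullet> (D *v e) = 1"
    using pos[OF v(2)] by (simp add: e_def matrix_vector_mult_scaleR)
  define S' where "S' = {x\<in>S. e \<bullet> (D *v x) = 0}"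
  have sub: "subspace S'"
    using Suc.prems(1) unfolding S'_def subspace_def
    by (auto simp: matrix_vector_mult_scaleR matrix_vector_right_distrib inner_add_right)
  have e_notin: "e \<notin> span S'" using ee by (simp add: span_eq_iff[THEN iffD2, OF sub]) (simp add: S'_def)
  have "S = span (insert e S')"
  proof
    show "S \<subseteq> span (insert e S')"
    proof
      fix x assume x: "x \<in> S"
      define k where "k = e \<bullet> (D *v x)"
      have "x - k *\<^sub>R e \<in> S'"
        using x eS Suc.prems(1) ee unfolding S'_def k_def
        by (auto simp: subspace_diff subspace_scale matrix_vector_mult_scaleR matrix_vector_mult_diff_distrib inner_diff_right)
      then show "x \<in> span (insert e S')"
        unfolding span_insert by (auto intro: span_base)
    qed
    show "span (insert e S') \<subseteq> S"
      by (rule span_minimal) (use eS Suc.prems in \<open>auto simp: S'_def\<close>)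
  qed
  then have "dim S = dim (insert e S')" by simp
  also have "\<dots> = Suc (dim S')" using e_notin by (simp add: dim_insert)
  finally have "dim S' = n" using Suc.prems by simp
  then obtain E where E: "E \<subseteq> S'" "finite E" "card E = n" "\<forall>x\<in>E. \<forall>y\<in>E. x \<bullet> (D *v y) = (if x = y then 1 else 0)"
    using Suc.IH[OF sub] by blast
  have "e \<notin> E" using E(1) e_notin by (auto intro: span_base)
  moreover have "e \<bullet> (D *v y) = 0" "y \<bullet> (D *v e) = 0" if "y \<in> E" for y
    using that E(1) sym[of y e] by (auto simp: S'_def)
  ultimately show ?case
    using E eS ee by (intro exI[of _ "insert e E"]) (auto simp: S'_def)
qed

text \<open>
  If \<open>V\<close> has \<open>D\<close>-orthonormal columns then \<open>V\<^sup>T D V = 1\<close>, so the inverse \<open>B\<close> of \<open>V\<^sup>T\<close> satisfies \<open>D = B B\<^sup>T\<close>.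
  The normal distribution with covariance \<open>D\<close> is then the image of the standard one under \<open>B\<close>.
\<close>

lemma pos_def_factorization:
  fixes D :: "real^'d^'d"
  assumes sym: "\<And>u v. u \<bullet> (D *v v) = v \<bullet> (D *v u)" and pos: "\<And>u. u \<noteq> 0 \<Longrightarrow> 0 < u \<bullet> (D *v u)"
  obtains B :: "real^'d^'d" where "D = B ** transpose B" "invertible B"
proof -
  obtain E where E: "finite E" "card E = CARD('d)" "\<forall>x\<in>E. \<forall>y\<in>E. x \<bullet> (D *v y) = (if x = y then 1 else 0)"
    using pos_def_orthonormal[OF sym pos, of UNIV "CARD('d)"] by auto
  obtain e where e: "bij_betw e (UNIV :: 'd set) E"
    using E finite_same_card_bij[of "UNIV :: 'd set" E] by auto
  define V :: "real^'d^'d" where "V = (\<chi> i j. e j $ i)"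
  have "(transpose V ** (D ** V)) $ i $ j = mat 1 $ i $ j" for i j
  proof -
    have "(transpose V ** (D ** V)) $ i $ j = e i \<bullet> (D *v e j)"
      by (simp add: matrix_matrix_mult_def matrix_vector_mult_def inner_vec_def V_def transpose_def)
    also have "\<dots> = (if e i = e j then 1 else 0)"
      using E(3) e by (auto simp: bij_betw_def)
    also have "\<dots> = mat 1 $ i $ j" using e by (auto simp: mat_def bij_betw_def inj_on_def)
    finally show ?thesis .
  qed
  then have VDV: "transpose V ** (D ** V) = mat 1" by (simp add: vec_eq_iff)
  have inv: "invertible (transpose V)"
    using VDV invertible_right_inverse by blast
  define B where "B = matrix_inv (transpose V)"
  have B1: "B ** transpose V = mat 1" "transpose V ** B = mat 1"
    using someI_ex[OF inv[unfolded invertible_def]] by (simp_all add: B_def matrix_inv_def)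
  have B2: "V ** transpose B = mat 1"
    using arg_cong[OF B1(1), of transpose] by (simp add: matrix_transpose_mul)
  have "D ** V = B"
    using VDV B1 by (metis matrix_mul_assoc matrix_mul_lid matrix_mul_rid)
  then have "D = B ** transpose B"
    using B2 by (metis matrix_mul_assoc matrix_mul_rid)
  moreover have "invertible B" using B1 invertible_right_inverse by blast
  ultimately show ?thesis using that by blast
qed

text \<open>
  Density of the centered normal distribution with covariance \<open>\<epsilon>\<^sup>2\<close> times the identity.
\<close>

definition gauss_kernel :: "real \<Rightarrow> 'b::euclidean_space \<Rightarrow> real" where
  "gauss_kernel \<epsilon> y = exp (- (norm y)\<^sup>2 / (2 * \<epsilon>\<^sup>2)) / (sqrt (2 * pi) * \<epsilon>) ^ DIM('b)"

lemma gauss_kernel_measurable [measurable]: "gauss_kernel \<epsilon> \<in> borel_measurable borel"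
  unfolding gauss_kernel_def by measurable

lemma gauss_kernel_nonneg: "0 < \<epsilon> \<Longrightarrow> 0 \<le> gauss_kernel \<epsilon> y"
  by (simp add: gauss_kernel_def)

lemma gaussian_integral:
  assumes b: "0 < b"
  shows "integrable lborel (\<lambda>s::'b::euclidean_space. exp (- (b * (norm s)\<^sup>2)))"
    and "(\<integral>s. exp (- (b * (norm (s::'b))\<^sup>2)) \<partial>lborel) = sqrt (pi / b) ^ DIM('b)"
proof -
  have i: "integrable lborel (\<lambda>s::'b. complex_of_real (exp (- (b * (norm s)\<^sup>2))))"
    using gaussian_fourier(1)[of "2 * b" "0::'b"] b by simp
  have v: "(\<integral>s. complex_of_real (exp (- (b * (norm (s::'b))\<^sup>2))) \<partial>lborel) = of_real (sqrt (pi / b) ^ DIM('b))"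
    using gaussian_fourier(2)[of "2 * b" "0::'b"] b by simp
  show i': "integrable lborel (\<lambda>s::'b. exp (- (b * (norm s)\<^sup>2)))"
    using i unfolding complex_of_real_integrable_eq .
  show "(\<integral>s. exp (- (b * (norm (s::'b))\<^sup>2)) \<partial>lborel) = sqrt (pi / b) ^ DIM('b)"
    using v unfolding integral_complex_of_real of_real_eq_iff .
qed

lemma gauss_kernel_integral:
  assumes e: "0 < \<epsilon>"
  shows "integrable lborel (gauss_kernel \<epsilon> :: 'b::euclidean_space \<Rightarrow> real)"
    and "(\<integral>y. gauss_kernel \<epsilon> (y::'b) \<partial>lborel) = 1"
proof -
  have eq: "gauss_kernel \<epsilon> y = exp (- (1 / (2 * \<epsilon>\<^sup>2) * (norm y)\<^sup>2)) / (sqrt (2 * pi) * \<epsilon>) ^ DIM('b)" for y :: 'b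
    by (simp add: gauss_kernel_def)
  have b: "0 < 1 / (2 * \<epsilon>\<^sup>2)" using e by simp
  show "integrable lborel (gauss_kernel \<epsilon> :: 'b \<Rightarrow> real)"
    unfolding eq[abs_def] by (rule integrable_divide_zero[OF gaussian_integral(1)[OF b]])
  have "sqrt (pi / (1 / (2 * \<epsilon>\<^sup>2))) = sqrt (2 * pi) * \<epsilon>"
    using e by (simp add: real_sqrt_mult)
  then show "(\<integral>y. gauss_kernel \<epsilon> (y::'b) \<partial>lborel) = 1"
    unfolding eq using gaussian_integral(2)[OF b, where 'b='b] e by simp
qed

text \<open>
  The kernel written as a Fourier integral; this is what converts differences of smoothed
  densities into differences of characteristic functions.
\<close>

lemma gauss_kernel_fourier:
  fixes y :: "'b::euclidean_space"
  assumes e: "0 < \<epsilon>"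
  shows "complex_of_real (gauss_kernel \<epsilon> y) =
    (\<integral>s. cis (s \<bullet> y) * of_real (exp (- (\<epsilon>\<^sup>2 * (norm s)\<^sup>2) / 2)) \<partial>lborel) / (2 * pi) ^ DIM('b)"
proof -
  have "sqrt (2 * pi / \<epsilon>\<^sup>2) / (2 * pi) = 1 / (sqrt (2 * pi) * \<epsilon>)"
    using e by (simp add: real_sqrt_divide field_simps)
  then have "sqrt (2 * pi / \<epsilon>\<^sup>2) ^ DIM('b) / (2 * pi) ^ DIM('b) = 1 / (sqrt (2 * pi) * \<epsilon>) ^ DIM('b)"
    by (metis power_divide power_one)
  then have "gauss_kernel \<epsilon> y = sqrt (2 * pi / \<epsilon>\<^sup>2) ^ DIM('b) * exp (- (norm y)\<^sup>2 / (2 * \<epsilon>\<^sup>2)) / (2 * pi) ^ DIM('b)"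
    by (simp add: gauss_kernel_def field_simps)
  then show ?thesis
    using e by (subst gaussian_fourier(2)) auto
qed

text \<open>
  For \<open>norm y \<ge> r\<close> one half of the exponent \<open>- (norm y)\<^sup>2 / (2 \<epsilon>\<^sup>2)\<close> is at most \<open>- (r / \<epsilon>)\<^sup>2 / 4\<close>; the other
  half is still integrable, and its integral exceeds that of the kernel by the factor \<open>(sqrt 2)^dim\<close>.
\<close>

lemma gauss_kernel_tail:
  assumes e: "0 < \<epsilon>" and r: "0 \<le> r"
  shows "(\<integral>y. gauss_kernel \<epsilon> (y::'b::euclidean_space) * indicator {y. r \<le> norm y} y \<partial>lborel)
    \<le> sqrt 2 ^ DIM('b) * exp (- (r / \<epsilon>)\<^sup>2 / 4)"
proof -
  have b: "0 < 1 / (4 * \<epsilon>\<^sup>2)" using e by simp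
  let ?k = "\<lambda>y::'b. exp (- (r / \<epsilon>)\<^sup>2 / 4) / (sqrt (2 * pi) * \<epsilon>) ^ DIM('b) * exp (- (1 / (4 * \<epsilon>\<^sup>2) * (norm y)\<^sup>2))"
  have "(\<integral>y. gauss_kernel \<epsilon> (y::'b) * indicator {y. r \<le> norm y} y \<partial>lborel) \<le> (\<integral>y. ?k y \<partial>lborel)"
  proof (rule integral_mono')
    show "integrable lborel ?k"
      by (intro integrable_mult_right gaussian_integral(1) b)
    fix y :: 'b
    have "gauss_kernel \<epsilon> y \<le> ?k y" if "r \<le> norm y"
    proof -
      have "r\<^sup>2 \<le> (norm y)\<^sup>2" using that r by (rule power_mono)
      then have "- (norm y)\<^sup>2 / (2 * \<epsilon>\<^sup>2) \<le> - (r / \<epsilon>)\<^sup>2 / 4 + - (1 / (4 * \<epsilon>\<^sup>2) * (norm y)\<^sup>2)"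
        using e by (simp add: field_simps)
      then have "exp (- (norm y)\<^sup>2 / (2 * \<epsilon>\<^sup>2)) \<le> exp (- (r / \<epsilon>)\<^sup>2 / 4) * exp (- (1 / (4 * \<epsilon>\<^sup>2) * (norm y)\<^sup>2))"
        by (simp only: exp_le_cancel_iff flip: exp_add)
      then show ?thesis
        using e by (simp add: gauss_kernel_def divide_right_mono)
    qed
    then show "gauss_kernel \<epsilon> y * indicator {y. r \<le> norm y} y \<le> ?k y"
      using e by (auto simp: indicator_def)
    show "0 \<le> ?k y" using e by simp
  qed
  also have "\<dots> = exp (- (r / \<epsilon>)\<^sup>2 / 4) / (sqrt (2 * pi) * \<epsilon>) ^ DIM('b) * (sqrt (2 * (2 * pi)) * \<epsilon>) ^ DIM('b)"
  proof -
    have "sqrt (pi / (1 / (4 * \<epsilon>\<^sup>2))) = sqrt (2 * (2 * pi)) * \<epsilon>"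
      using e by (simp add: real_sqrt_mult)
    then show ?thesis
      by (subst integral_mult_right_zero, subst gaussian_integral(2)[OF b]) simp
  qed
  also have "\<dots> = sqrt 2 ^ DIM('b) * exp (- (r / \<epsilon>)\<^sup>2 / 4)"
  proof -
    have "(sqrt (2 * (2 * pi)) * \<epsilon>) ^ DIM('b) = sqrt 2 ^ DIM('b) * (sqrt (2 * pi) * \<epsilon>) ^ DIM('b)"
      by (simp only: real_sqrt_mult power_mult_distrib mult.assoc)
    then show ?thesis using e by simp
  qed
  finally show ?thesis .
qed

text \<open>
  Change of variables \<open>x = B y\<close>: since \<open>D\<close> is \<open>B B\<^sup>T\<close>, the quadratic form of the inverse of \<open>D\<close> becomes
  \<open>(norm y)\<^sup>2\<close>, and \<open>sqrt (det D) = \<bar>det B\<bar>\<close> cancels the Jacobian.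
\<close>

lemma normal_distr_eq_linear_image:
  fixes B D :: "real^'d^'d"
  assumes D: "D = B ** transpose B" and B: "invertible B"
  shows "normal_distr 0 D = distr (density lborel (\<lambda>y. ennreal (gauss_kernel 1 y))) borel ((*v) B)"
proof (rule measure_eqI)
  show "sets (normal_distr 0 D) = sets (distr (density lborel (\<lambda>y. ennreal (gauss_kernel 1 y))) borel ((*v) B))"
    by (simp add: normal_distr_def)
  fix A assume "A \<in> sets (normal_distr 0 D)"
  then have A [measurable]: "A \<in> sets borel" by (simp add: normal_distr_def)
  have mB [measurable]: "((*v) C) \<in> borel_measurable borel" for C :: "real^'d^'d"
    by (intro borel_measurable_continuous_onI continuous_intros)
  define dens where "dens \<equiv> \<lambda>x::real^'d. exp (- ((x - 0) \<bullet> (matrix_inv D *v (x - 0))) / 2) / sqrt ((2 * pi) ^ CARD('d) * det D)"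
  have [measurable]: "dens \<in> borel_measurable borel"
    unfolding dens_def by measurable
  have dB: "det B \<noteq> 0" using B by (simp add: invertible_det_nz)
  have dD: "det D = (det B)\<^sup>2" by (simp add: D det_mul power2_eq_square)
  have "invertible D" using dB dD by (simp add: invertible_det_nz)
  then have iD: "matrix_inv D ** D = mat 1"
    using someI_ex[of "\<lambda>A'. D ** A' = mat 1 \<and> A' ** D = mat 1"] by (simp add: matrix_inv_def invertible_def)
  have "matrix_inv D ** B ** transpose B = mat 1" using iD D by (simp add: matrix_mul_assoc)
  then have "transpose B ** (matrix_inv D ** B) = mat 1" using matrix_left_right_inverse by blast
  then have quad: "(B *v y) \<bullet> (matrix_inv D *v (B *v y)) = (norm y)\<^sup>2" for y
    by (metis dot_lmul_matrix inner_commute matrix_vector_mul_assoc matrix_vector_mul_lid power2_norm_eq_inner transpose_matrix_vector)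
  have key: "\<bar>det B\<bar> * dens (B *v y) = gauss_kernel 1 y" for y
  proof -
    have "sqrt ((2 * pi) ^ CARD('d) * (det B)\<^sup>2) = sqrt (2 * pi) ^ CARD('d) * \<bar>det B\<bar>"
      by (simp only: real_sqrt_mult[of "(2 * pi) ^ _"] real_sqrt_power[of "2 * pi"] real_sqrt_abs)
    then show ?thesis using dB by (simp add: dens_def quad dD gauss_kernel_def)
  qed
  have "emeasure (normal_distr 0 D) A = (\<integral>\<^sup>+x. ennreal (dens x) * indicator A x \<partial>lborel)"
  proof -
    have "normal_distr 0 D = density lborel (\<lambda>x. ennreal (dens x))"
      by (simp only: normal_distr_def dens_def)
    then show ?thesis by (simp add: emeasure_density)
  qed
  also have "\<dots> = ennreal \<bar>det B\<bar> * (\<integral>\<^sup>+y. ennreal (dens (B *v y)) * indicator A (B *v y) \<partial>lborel)"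
    by (rule nn_integral_lborel_linear[OF dB]) measurable
  also have "\<dots> = (\<integral>\<^sup>+y. ennreal \<bar>det B\<bar> * (ennreal (dens (B *v y)) * indicator A (B *v y)) \<partial>lborel)"
    by (rule nn_integral_cmult[symmetric]) measurable
  also have "\<dots> = (\<integral>\<^sup>+y. ennreal (gauss_kernel 1 y) * indicator ((*v) B -` A) y \<partial>lborel)"
    by (rule nn_integral_cong)
       (simp add: key[symmetric] ennreal_mult' mult.assoc indicator_vimage)
  also have "\<dots> = emeasure (density lborel (\<lambda>y. ennreal (gauss_kernel 1 y))) ((*v) B -` A)"
    using measurable_sets[OF mB[of B] A] by (subst emeasure_density) auto
  also have "\<dots> = emeasure (distr (density lborel (\<lambda>y. ennreal (gauss_kernel 1 y))) borel ((*v) B)) A"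
    by (subst emeasure_distr) auto
  finally show "emeasure (normal_distr 0 D) A = emeasure (distr (density lborel (\<lambda>y. ennreal (gauss_kernel 1 y))) borel ((*v) B)) A" .
qed

lemma prob_space_gauss_density:
  assumes "0 < \<epsilon>"
  shows "prob_space (density lborel (\<lambda>y::'b::euclidean_space. ennreal (gauss_kernel \<epsilon> y)))"
proof (rule prob_spaceI)
  have "(\<integral>\<^sup>+y. ennreal (gauss_kernel \<epsilon> (y::'b)) \<partial>lborel) = ennreal (\<integral>y. gauss_kernel \<epsilon> (y::'b) \<partial>lborel)"
    by (rule nn_integral_eq_integral)
       (use gauss_kernel_integral(1)[OF assms] gauss_kernel_nonneg[OF assms] in auto)
  also have "\<dots> = 1"
    unfolding gauss_kernel_integral(2)[OF assms] by simp
  finally show "emeasure (density lborel (\<lambda>y::'b. ennreal (gauss_kernel \<epsilon> y)))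
      (space (density lborel (\<lambda>y::'b. ennreal (gauss_kernel \<epsilon> y)))) = 1"
    by (simp add: emeasure_density)
qed

lemma normal_distr_properties:
  fixes D :: "real^'d^'d"
  assumes sym: "\<And>u v. u \<bullet> (D *v v) = v \<bullet> (D *v u)" and pos: "\<And>u. u \<noteq> 0 \<Longrightarrow> 0 < u \<bullet> (D *v u)"
  shows "prob_space (normal_distr 0 D)" and "sets (normal_distr 0 D) = sets borel"
    and "(\<integral>x. cis (s \<bullet> x) \<partial>normal_distr 0 D) = of_real (exp (- (s \<bullet> (D *v s)) / 2))"
    and "\<exists>c>0. \<forall>r\<ge>0. measure (normal_distr 0 D) {x. r \<le> norm x} \<le> sqrt 2 ^ CARD('d) * exp (- (c * r\<^sup>2))"
proof -
  obtain B :: "real^'d^'d" where B: "D = B ** transpose B" "invertible B"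
    using pos_def_factorization[OF sym pos] by blast
  note eq = normal_distr_eq_linear_image[OF B]
  let ?G = "density lborel (\<lambda>y::real^'d. ennreal (gauss_kernel 1 y))"
  have mB [measurable]: "((*v) C) \<in> borel_measurable borel" for C :: "real^'d^'d"
    by (intro borel_measurable_continuous_onI continuous_intros)
  interpret G: prob_space ?G by (rule prob_space_gauss_density) simp
  show "prob_space (normal_distr 0 D)"
    unfolding eq by (rule G.prob_space_distr) simp
  show "sets (normal_distr 0 D) = sets borel" by (simp add: normal_distr_def)
  have cm: "(\<lambda>x. cis (s \<bullet> x)) \<in> borel_measurable borel"
    unfolding cis_conv_exp by measurable
  have "(\<integral>x. cis (s \<bullet> x) \<partial>normal_distr 0 D) = (\<integral>y. cis (s \<bullet> (B *v y)) \<partial>?G)"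
    unfolding eq using cm by (subst integral_distr) auto
  also have "\<dots> = (\<integral>y. gauss_kernel 1 y *\<^sub>R cis (s \<bullet> (B *v y)) \<partial>lborel)"
    using measurable_compose[OF mB[of B] cm] gauss_kernel_nonneg[of 1] by (subst integral_density) auto
  also have "\<dots> = (\<integral>y. cis (y \<bullet> (transpose B *v s)) * of_real (exp (- (1 * (norm y)\<^sup>2) / 2)) / of_real (sqrt (2 * pi) ^ CARD('d)) \<partial>lborel)"
    by (simp add: gauss_kernel_def scaleR_conv_of_real dot_lmul_matrix[symmetric] inner_commute mult.commute transpose_matrix_vector)
  also have "\<dots> = of_real (exp (- (norm (transpose B *v s))\<^sup>2 / 2))"
    unfolding integral_divide_zero
    by (subst gaussian_fourier(2)[OF zero_less_one]) simp
  also have "(norm (transpose B *v s))\<^sup>2 = s \<bullet> (D *v s)"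
    by (simp add: B power2_norm_eq_inner dot_lmul_matrix transpose_matrix_vector flip: matrix_vector_mul_assoc)
  finally show "(\<integral>x. cis (s \<bullet> x) \<partial>normal_distr 0 D) = of_real (exp (- (s \<bullet> (D *v s)) / 2))" .
  obtain K where K: "K > 0" "\<And>y. norm (B *v y) \<le> norm y * K"
    using bounded_linear.pos_bounded[OF matrix_vector_mul_bounded_linear[of B]] by blast
  show "\<exists>c>0. \<forall>r\<ge>0. measure (normal_distr 0 D) {x. r \<le> norm x} \<le> sqrt 2 ^ CARD('d) * exp (- (c * r\<^sup>2))"
  proof (intro exI[of _ "1 / (4 * K\<^sup>2)"] conjI allI impI)
    show "0 < 1 / (4 * K\<^sup>2)" using K by simp
    fix r :: real assume r: "0 \<le> r"
    have "measure (normal_distr 0 D) {x. r \<le> norm x} = measure ?G {y. r \<le> norm (B *v y)}"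
      unfolding eq by (subst measure_distr) (auto simp: vimage_def)
    also have "\<dots> \<le> measure ?G {y. r / K \<le> norm y}"
    proof (rule G.finite_measure_mono)
      show "{y. r \<le> norm (B *v y)} \<subseteq> {y. r / K \<le> norm y}"
        using K by (auto simp: field_simps intro: order_trans)
    qed simp
    also have "\<dots> = (\<integral>y. gauss_kernel 1 (y::real^'d) * indicator {y. r / K \<le> norm y} y \<partial>lborel)"
    proof -
      have "measure ?G {y. r / K \<le> norm y} = (\<integral>y. indicator {y. r / K \<le> norm y} y \<partial>?G)" by simp
      also have "\<dots> = (\<integral>y. gauss_kernel 1 (y::real^'d) *\<^sub>R indicator {y. r / K \<le> norm y} y \<partial>lborel)"
        using gauss_kernel_nonneg[of 1] by (subst integral_density) auto
      finally show ?thesis by simp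
    qed
    also have "\<dots> \<le> sqrt 2 ^ DIM(real^'d) * exp (- (r / K / 1)\<^sup>2 / 4)"
      by (rule gauss_kernel_tail) (use r K in auto)
    finally show "measure (normal_distr 0 D) {x. r \<le> norm x} \<le> sqrt 2 ^ CARD('d) * exp (- (1 / (4 * K\<^sup>2) * r\<^sup>2))"
      by (simp add: power_divide mult.commute)
  qed
qed

section \<open>The smoothing inequality\<close>

definition char_fun :: "'b::euclidean_space measure \<Rightarrow> 'b \<Rightarrow> complex" where
  "char_fun P s = (\<integral>x. cis (s \<bullet> x) \<partial>P)"

text \<open>
  Density of the convolution of \<open>P\<close> with the Gaussian kernel.
\<close>

definition smooth_density :: "real \<Rightarrow> 'b::euclidean_space measure \<Rightarrow> 'b \<Rightarrow> real" where
  "smooth_density \<epsilon> P y = (\<integral>x. gauss_kernel \<epsilon> (y - x) \<partial>P)"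

text \<open>
  Mass that the Gaussian centered at \<open>x\<close> gives to \<open>C\<close>. Its integral against \<open>P\<close> is the mass that the
  convolution of \<open>P\<close> with the kernel gives to \<open>C\<close>.
\<close>

definition smooth_mass :: "real \<Rightarrow> 'b::euclidean_space set \<Rightarrow> 'b \<Rightarrow> real" where
  "smooth_mass \<epsilon> C x = (\<integral>y. gauss_kernel \<epsilon> (y - x) * indicator C y \<partial>lborel)"

lemma cis_inner_measurable [measurable]: "(\<lambda>x::'b::euclidean_space. cis (s \<bullet> x)) \<in> borel_measurable borel"
  unfolding cis_conv_exp by measurable

text \<open>
  Insert the Fourier integral of the kernel and exchange the integrals; the Gaussian factor makes the
  double integral absolutely convergent whatever \<open>P\<close> is.
\<close>

lemma smooth_density_fourier:
  fixes P :: "'b::euclidean_space measure"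
  assumes "prob_space P" and s[measurable_cong]: "sets P = sets borel" and e: "0 < \<epsilon>"
  shows "integrable lborel (\<lambda>s. cis (- (s \<bullet> y)) * (of_real (exp (- (\<epsilon>\<^sup>2 * (norm s)\<^sup>2) / 2)) * char_fun P s))"
    and "complex_of_real (smooth_density \<epsilon> P y) =
      (\<integral>s. cis (- (s \<bullet> y)) * (of_real (exp (- (\<epsilon>\<^sup>2 * (norm s)\<^sup>2) / 2)) * char_fun P s) \<partial>lborel) / (2 * pi) ^ DIM('b)"
proof -
  interpret P: prob_space P by fact
  interpret pair_sigma_finite P lborel ..
  define G where "G \<equiv> \<lambda>s::'b. complex_of_real (exp (- (\<epsilon>\<^sup>2 * (norm s)\<^sup>2) / 2))"
  define F where "F \<equiv> \<lambda>x s::'b. cis (s \<bullet> (x - y)) * G s"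
  have [measurable]: "G \<in> borel_measurable borel" unfolding G_def by measurable
  have Fm[measurable]: "(\<lambda>(x, s). F x s) \<in> borel_measurable (P \<Otimes>\<^sub>M lborel)"
    unfolding F_def cis_conv_exp by measurable
  have intF: "integrable lborel (\<lambda>s. F x s)" for x
    unfolding F_def G_def using gaussian_fourier(1)[of "\<epsilon>\<^sup>2" "x - y"] e by simp
  have nF: "cmod (F x s) = exp (- (\<epsilon>\<^sup>2 * (norm s)\<^sup>2) / 2)" for x s
    by (simp add: F_def G_def norm_mult)
  have intP: "integrable (P \<Otimes>\<^sub>M lborel) (\<lambda>(x, s). F x s)"
  proof (rule Fubini_integrable)
    show "integrable P (\<lambda>x. \<integral>s. norm (case (x, s) of (x, s) \<Rightarrow> F x s) \<partial>lborel)"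
      by (simp add: nF)
    show "AE x in P. integrable lborel (\<lambda>s. case (x, s) of (x, s) \<Rightarrow> F x s)"
      using intF by simp
  qed measurable
  have inner: "(\<integral>x. F x s \<partial>P) = cis (- (s \<bullet> y)) * (G s * char_fun P s)" for s
  proof -
    have "F x s = (cis (- (s \<bullet> y)) * G s) * cis (s \<bullet> x)" for x
    proof -
      have "cis (s \<bullet> (x - y)) = cis (- (s \<bullet> y)) * cis (s \<bullet> x)"
        by (simp add: inner_diff_right cis_mult)
      then show ?thesis by (simp add: F_def mult.assoc mult.left_commute)
    qed
    then show ?thesis by (simp add: char_fun_def mult.assoc)
  qed
  have "integrable lborel (\<lambda>s. \<integral>x. F x s \<partial>P)"
    by (rule integrable_snd[OF intP])
  then show "integrable lborel (\<lambda>s. cis (- (s \<bullet> y)) * (of_real (exp (- (\<epsilon>\<^sup>2 * (norm s)\<^sup>2) / 2)) * char_fun P s))"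
    unfolding inner G_def .
  have "complex_of_real (smooth_density \<epsilon> P y) = (\<integral>x. complex_of_real (gauss_kernel \<epsilon> (x - y)) \<partial>P)"
    by (simp add: smooth_density_def gauss_kernel_def norm_minus_commute)
  also have "\<dots> = (\<integral>x. (\<integral>s. F x s \<partial>lborel) / (2 * pi) ^ DIM('b) \<partial>P)"
    by (simp add: gauss_kernel_fourier[OF e] F_def G_def)
  also have "\<dots> = (\<integral>x. (\<integral>s. F x s \<partial>lborel) \<partial>P) / (2 * pi) ^ DIM('b)"
    by simp
  also have "(\<integral>x. (\<integral>s. F x s \<partial>lborel) \<partial>P) = (\<integral>s. (\<integral>x. F x s \<partial>P) \<partial>lborel)"
    by (rule Fubini_integral[OF intP, symmetric])
  finally show "complex_of_real (smooth_density \<epsilon> P y) =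
      (\<integral>s. cis (- (s \<bullet> y)) * (of_real (exp (- (\<epsilon>\<^sup>2 * (norm s)\<^sup>2) / 2)) * char_fun P s) \<partial>lborel) / (2 * pi) ^ DIM('b)"
    unfolding inner G_def .
qed

lemma smooth_density_diff_le:
  fixes P Q :: "'b::euclidean_space measure"
  assumes P: "prob_space P" "sets P = sets borel" and Q: "prob_space Q" "sets Q = sets borel" and e: "0 < \<epsilon>"
  shows "\<bar>smooth_density \<epsilon> P y - smooth_density \<epsilon> Q y\<bar> \<le>
     (\<integral>s. cmod (char_fun P s - char_fun Q s) * exp (- (\<epsilon>\<^sup>2 * (norm s)\<^sup>2) / 2) \<partial>lborel) / (2 * pi) ^ DIM('b)"
proof -
  note fP = smooth_density_fourier[OF P e, of y] and fQ = smooth_density_fourier[OF Q e, of y]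
  have "complex_of_real (smooth_density \<epsilon> P y - smooth_density \<epsilon> Q y) =
    (\<integral>s. cis (- (s \<bullet> y)) * (of_real (exp (- (\<epsilon>\<^sup>2 * (norm s)\<^sup>2) / 2)) * char_fun P s)
      - cis (- (s \<bullet> y)) * (of_real (exp (- (\<epsilon>\<^sup>2 * (norm s)\<^sup>2) / 2)) * char_fun Q s) \<partial>lborel) / (2 * pi) ^ DIM('b)"
    unfolding of_real_diff fP(2) fQ(2) by (subst Bochner_Integration.integral_diff[OF fP(1) fQ(1)]) (simp add: diff_divide_distrib)
  moreover have "complex_of_real r = z / (2 * pi) ^ DIM('b) \<Longrightarrow> \<bar>r\<bar> = cmod z / (2 * pi) ^ DIM('b)" for r and z :: complex
    by (drule arg_cong[where f=cmod]) (simp add: norm_divide norm_power norm_mult)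
  ultimately have "\<bar>smooth_density \<epsilon> P y - smooth_density \<epsilon> Q y\<bar> =
    cmod (\<integral>s. cis (- (s \<bullet> y)) * (of_real (exp (- (\<epsilon>\<^sup>2 * (norm s)\<^sup>2) / 2)) * char_fun P s)
      - cis (- (s \<bullet> y)) * (of_real (exp (- (\<epsilon>\<^sup>2 * (norm s)\<^sup>2) / 2)) * char_fun Q s) \<partial>lborel) / (2 * pi) ^ DIM('b)"
    by blast
  also have "\<dots> \<le> (\<integral>s. cmod (cis (- (s \<bullet> y)) * (of_real (exp (- (\<epsilon>\<^sup>2 * (norm s)\<^sup>2) / 2)) * char_fun P s)
      - cis (- (s \<bullet> y)) * (of_real (exp (- (\<epsilon>\<^sup>2 * (norm s)\<^sup>2) / 2)) * char_fun Q s)) \<partial>lborel) / (2 * pi) ^ DIM('b)"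
    by (rule divide_right_mono[OF integral_norm_bound]) simp
  also have "\<dots> = (\<integral>s. cmod (char_fun P s - char_fun Q s) * exp (- (\<epsilon>\<^sup>2 * (norm s)\<^sup>2) / 2) \<partial>lborel) / (2 * pi) ^ DIM('b)"
  proof -
    have "cmod (cis (- (s \<bullet> y)) * (of_real (exp (- (\<epsilon>\<^sup>2 * (norm s)\<^sup>2) / 2)) * char_fun P s)
      - cis (- (s \<bullet> y)) * (of_real (exp (- (\<epsilon>\<^sup>2 * (norm s)\<^sup>2) / 2)) * char_fun Q s))
       = cmod (char_fun P s - char_fun Q s) * exp (- (\<epsilon>\<^sup>2 * (norm s)\<^sup>2) / 2)" for s
      by (simp only: right_diff_distrib[symmetric] norm_mult norm_cis norm_of_real) simp
    then show ?thesis by (simp only:)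
  qed
  finally show ?thesis .
qed

lemma gauss_kernel_shift:
  fixes x :: "'b::euclidean_space"
  assumes e: "0 < \<epsilon>"
  shows "integrable lborel (\<lambda>y. gauss_kernel \<epsilon> (y - x))" and "(\<integral>y. gauss_kernel \<epsilon> (y - x) \<partial>lborel) = 1"
    and "0 \<le> r \<Longrightarrow> (\<integral>y. gauss_kernel \<epsilon> (y - x) * indicator {y. r \<le> norm (y - x)} y \<partial>lborel)
      \<le> sqrt 2 ^ DIM('b) * exp (- (r / \<epsilon>)\<^sup>2 / 4)"
proof -
  have lb: "lborel = distr lborel borel (\<lambda>y. y - x)"
  proof -
    have "(\<lambda>y. y - x) = (+) (- x)" by auto
    then show ?thesis using lborel_distr_plus[of "- x"] by simp
  qed
  show "integrable lborel (\<lambda>y. gauss_kernel \<epsilon> (y - x))"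
    using gauss_kernel_integral(1)[OF e, where 'b='b] by (subst (asm) lb) (simp add: integrable_distr_eq)
  show "(\<integral>y. gauss_kernel \<epsilon> (y - x) \<partial>lborel) = 1"
    using gauss_kernel_integral(2)[OF e, where 'b='b] by (subst (asm) lb) (simp add: integral_distr)
  assume r: "0 \<le> r"
  have "(\<integral>y. gauss_kernel \<epsilon> (y::'b) * indicator {y. r \<le> norm y} y \<partial>lborel) =
    (\<integral>y. gauss_kernel \<epsilon> (y - x) * indicator {y. r \<le> norm (y - x)} y \<partial>lborel)"
  proof -
    have "(\<integral>y. gauss_kernel \<epsilon> (y::'b) * indicator {y. r \<le> norm y} y \<partial>distr lborel borel (\<lambda>y. y - x)) =
      (\<integral>y. gauss_kernel \<epsilon> (y - x) * indicator {y. r \<le> norm y} (y - x) \<partial>lborel)"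
      by (rule integral_distr) measurable
    then show ?thesis unfolding lb[symmetric] by (simp add: indicator_def)
  qed
  then show "(\<integral>y. gauss_kernel \<epsilon> (y - x) * indicator {y. r \<le> norm (y - x)} y \<partial>lborel)
      \<le> sqrt 2 ^ DIM('b) * exp (- (r / \<epsilon>)\<^sup>2 / 4)"
    using gauss_kernel_tail[OF e r, where 'b='b] by simp
qed

lemma smooth_mass_integrable:
  assumes "0 < \<epsilon>" and [measurable]: "C \<in> sets borel"
  shows "integrable lborel (\<lambda>y. gauss_kernel \<epsilon> (y - x) * indicator C y)"
  using integrable_real_mult_indicator[OF _ gauss_kernel_shift(1)[OF assms(1)], of C x] by simp

lemma smooth_mass_mono:
  assumes e: "0 < \<epsilon>" and "C \<in> sets borel" "C' \<in> sets borel" and "C \<subseteq> C'"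
  shows "smooth_mass \<epsilon> C x \<le> smooth_mass \<epsilon> C' x"
  unfolding smooth_mass_def
  by (rule integral_mono[OF smooth_mass_integrable smooth_mass_integrable])
     (use assms gauss_kernel_nonneg[OF e] in \<open>auto simp: indicator_def\<close>)

lemma smooth_mass_nonneg: "0 < \<epsilon> \<Longrightarrow> 0 \<le> smooth_mass \<epsilon> C x"
  unfolding smooth_mass_def by (rule Bochner_Integration.integral_nonneg) (simp add: gauss_kernel_nonneg)

lemma smooth_mass_Un:
  assumes e: "0 < \<epsilon>" and "C \<in> sets borel" "C' \<in> sets borel" and "C \<inter> C' = {}"
  shows "smooth_mass \<epsilon> (C \<union> C') x = smooth_mass \<epsilon> C x + smooth_mass \<epsilon> C' x"
proof -
  have "gauss_kernel \<epsilon> (y - x) * indicator (C \<union> C') y =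
    gauss_kernel \<epsilon> (y - x) * indicator C y + gauss_kernel \<epsilon> (y - x) * indicator C' y" for y
    using assms(4) by (auto simp: indicator_def)
  then show ?thesis
    unfolding smooth_mass_def
    by (simp only:) (rule Bochner_Integration.integral_add[OF smooth_mass_integrable smooth_mass_integrable], use assms in auto)
qed

lemma smooth_mass_UNIV: "0 < \<epsilon> \<Longrightarrow> smooth_mass \<epsilon> UNIV x = 1"
  by (simp add: smooth_mass_def gauss_kernel_shift)

lemma smooth_mass_Compl:
  assumes "0 < \<epsilon>" "C \<in> sets borel"
  shows "smooth_mass \<epsilon> (- C) x = 1 - smooth_mass \<epsilon> C x"
  using smooth_mass_Un[of \<epsilon> C "- C" x] assms smooth_mass_UNIV[of \<epsilon> x] by (simp add: Compl_partition)

lemma smooth_mass_le_1: "0 < \<epsilon> \<Longrightarrow> C \<in> sets borel \<Longrightarrow> smooth_mass \<epsilon> C x \<le> 1"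
  using smooth_mass_mono[of \<epsilon> C UNIV x] smooth_mass_UNIV[of \<epsilon> x] by simp

lemma smooth_mass_far:
  fixes x :: "'b::euclidean_space"
  assumes e: "0 < \<epsilon>" and C: "C \<in> sets borel" and r: "0 \<le> r" and far: "\<And>y. y \<in> C \<Longrightarrow> r \<le> norm (y - x)"
  shows "smooth_mass \<epsilon> C x \<le> sqrt 2 ^ DIM('b) * exp (- (r / \<epsilon>)\<^sup>2 / 4)"
proof -
  have "smooth_mass \<epsilon> C x \<le> smooth_mass \<epsilon> {y. r \<le> norm (y - x)} x"
    by (rule smooth_mass_mono) (use assms in auto)
  then show ?thesis
    using gauss_kernel_shift(3)[OF e r, of x] unfolding smooth_mass_def by simp
qed

lemma smooth_mass_measurable [measurable]:
  assumes [measurable]: "C \<in> sets borel"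
  shows "smooth_mass \<epsilon> C \<in> borel_measurable (borel :: 'b::euclidean_space measure)"
proof -
  have "(\<lambda>x. \<integral>y. gauss_kernel \<epsilon> (y - x) * indicator C y \<partial>lborel) \<in> borel_measurable (borel :: 'b measure)"
    by measurable
  then show ?thesis unfolding smooth_mass_def[abs_def] .
qed

lemma smooth_mass_Fubini:
  fixes P :: "'b::euclidean_space measure"
  assumes "prob_space P" and s[measurable_cong]: "sets P = sets borel" and e: "0 < \<epsilon>"
    and C[measurable]: "C \<in> sets borel"
  shows "integrable P (smooth_mass \<epsilon> C)"
    and "integrable lborel (\<lambda>y. smooth_density \<epsilon> P y * indicator C y)"
    and "(\<integral>x. smooth_mass \<epsilon> C x \<partial>P) = (\<integral>y. smooth_density \<epsilon> P y * indicator C y \<partial>lborel)"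
proof -
  interpret P: prob_space P by fact
  interpret pair_sigma_finite P lborel ..
  show i1: "integrable P (smooth_mass \<epsilon> C)"
  proof (rule P.integrable_const_bound[where B=1])
    show "AE x in P. norm (smooth_mass \<epsilon> C x) \<le> 1"
    proof (rule AE_I2)
      show "norm (smooth_mass \<epsilon> C x) \<le> 1" for x
        using smooth_mass_le_1[OF e C, of x] smooth_mass_nonneg[OF e, of C x] by simp
    qed
  qed measurable
  have intP: "integrable (P \<Otimes>\<^sub>M lborel) (\<lambda>(x, y). gauss_kernel \<epsilon> (y - x) * indicator C y)"
  proof (rule Fubini_integrable)
    have "\<bar>gauss_kernel \<epsilon> (y - x) * indicator C y\<bar> = gauss_kernel \<epsilon> (y - x) * indicator C y" for x y
      using gauss_kernel_nonneg[OF e, of "y - x"] by (simp add: abs_mult)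
    then show "integrable P (\<lambda>x. \<integral>y. norm (case (x, y) of (x, y) \<Rightarrow> gauss_kernel \<epsilon> (y - x) * indicator C y) \<partial>lborel)"
      using i1 unfolding smooth_mass_def[abs_def] by simp
    show "AE x in P. integrable lborel (\<lambda>y. case (x, y) of (x, y) \<Rightarrow> gauss_kernel \<epsilon> (y - x) * indicator C y)"
      using smooth_mass_integrable[OF e C] by simp
  qed measurable
  show "integrable lborel (\<lambda>y. smooth_density \<epsilon> P y * indicator C y)"
    using integrable_snd[OF intP] by (simp add: smooth_density_def)
  show "(\<integral>x. smooth_mass \<epsilon> C x \<partial>P) = (\<integral>y. smooth_density \<epsilon> P y * indicator C y \<partial>lborel)"
    using Fubini_integral[OF intP] by (simp add: smooth_density_def smooth_mass_def)
qed

lemma smooth_mass_integral_diff: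
  fixes P Q :: "'b::euclidean_space measure"
  assumes P: "prob_space P" "sets P = sets borel" and Q: "prob_space Q" "sets Q = sets borel" and e: "0 < \<epsilon>"
    and C [measurable]: "C \<in> sets borel" and CR: "C \<subseteq> cball 0 R"
    and d: "\<And>y. \<bar>smooth_density \<epsilon> P y - smooth_density \<epsilon> Q y\<bar> \<le> \<Delta>"
  shows "\<bar>(\<integral>x. smooth_mass \<epsilon> C x \<partial>P) - (\<integral>x. smooth_mass \<epsilon> C x \<partial>Q)\<bar> \<le> \<Delta> * measure lborel (cball (0::'b) R)"
proof -
  note fP = smooth_mass_Fubini[OF P e C] and fQ = smooth_mass_Fubini[OF Q e C]
  have "(\<integral>x. smooth_mass \<epsilon> C x \<partial>P) - (\<integral>x. smooth_mass \<epsilon> C x \<partial>Q) =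
    (\<integral>y. smooth_density \<epsilon> P y * indicator C y - smooth_density \<epsilon> Q y * indicator C y \<partial>lborel)"
    unfolding fP(3) fQ(3) by (rule Bochner_Integration.integral_diff[OF fP(2) fQ(2), symmetric])
  also have "\<bar>\<dots>\<bar> \<le> (\<integral>y. \<bar>smooth_density \<epsilon> P y * indicator C y - smooth_density \<epsilon> Q y * indicator C y\<bar> \<partial>lborel)"
    by (rule integral_abs_bound)
  also have "\<dots> \<le> (\<integral>y. \<Delta> * indicator (cball 0 R) y \<partial>(lborel :: 'b measure))"
  proof (rule integral_mono')
    show "integrable lborel (\<lambda>y::'b. \<Delta> * indicator (cball 0 R) y)"
      by (intro integrable_mult_right integrable_real_indicator) (use emeasure_lborel_cball_finite[of "0::'b" R] in auto)
    have "0 \<le> \<Delta>" using d[of 0] by linarith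
    then show "\<bar>smooth_density \<epsilon> P y * indicator C y - smooth_density \<epsilon> Q y * indicator C y\<bar> \<le> \<Delta> * indicator (cball 0 R) y" for y
      using d[of y] CR by (auto simp: indicator_def)
    then show "0 \<le> \<Delta> * indicator (cball 0 R) y" for y :: 'b using \<open>0 \<le> \<Delta>\<close> by simp
  qed
  also have "\<dots> = \<Delta> * measure lborel (cball (0::'b) R)" by simp
  finally show ?thesis .
qed

lemma open_open_nbhd: "open (open_nbhd \<delta> (B :: (real^'d) set))"
proof -
  have "open_nbhd \<delta> B = (\<Union>b\<in>B. {x. infnorm (x - b) < \<delta>})" by (auto simp: open_nbhd_def)
  moreover have "open {x. infnorm (x - b) < \<delta>}" for b :: "real^'d"
    by (intro open_Collect_less continuous_intros continuous_on_infnorm)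
  ultimately show ?thesis by auto
qed

lemma open_nbhd_mono: "\<delta> \<le> \<delta>' \<Longrightarrow> open_nbhd \<delta> B \<subseteq> open_nbhd \<delta>' B"
  by (force simp: open_nbhd_def)

text \<open>
  Let \<open>C\<close> be the \<open>a\<close>-neighborhood of \<open>B\<close>. A Gaussian centered in \<open>B\<close> has mass at least \<open>1 - \<tau> a\<close> in \<open>C\<close>, and
  one centered outside the \<open>2a\<close>-neighborhood of \<open>B\<close> has mass at most \<open>\<tau> a\<close> in \<open>C\<close>. It therefore suffices to compare
  the smoothed measures on \<open>C\<close>. Inside the ball of radius \<open>2R\<close> their difference is at most the uniform bound \<open>\<Delta>\<close> of
  the densities times the volume. Outside, the mass for \<open>P\<close> is one minus the mass inside, hence
  at most the mass for \<open>Q\<close> plus the same error; so only \<open>Q\<close> must have small tails.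
\<close>

proposition smoothing_inequality:
  fixes P Q :: "(real^'d) measure"
  assumes P: "prob_space P" "sets P = sets borel" and Q: "prob_space Q" "sets Q = sets borel" and e: "0 < \<epsilon>"
    and a: "0 < a" and R: "0 \<le> R" and B [measurable]: "B \<in> sets borel"
  defines "\<tau> \<equiv> \<lambda>r. sqrt 2 ^ CARD('d) * exp (- (r / \<epsilon>)\<^sup>2 / 4)"
    and "\<Delta> \<equiv> (\<integral>s. cmod (char_fun P s - char_fun Q s) * exp (- (\<epsilon>\<^sup>2 * (norm s)\<^sup>2) / 2) \<partial>lborel) / (2 * pi) ^ CARD('d)"
  shows "measure P B \<le> measure Q (open_nbhd (2 * a) B) + 2 * \<tau> a + \<tau> R
     + measure Q {x. R \<le> norm x} + 2 * \<Delta> * measure lborel (cball (0::real^'d) (2 * R))"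
proof -
  interpret P: prob_space P by fact
  interpret Q: prob_space Q by fact
  note [measurable_cong] = P(2) Q(2)
  define C where "C = (\<Union>b\<in>B. ball b a)"
  have C[measurable]: "C \<in> sets borel" unfolding C_def by (intro borel_open) auto
  have nb[measurable]: "open_nbhd (2 * a) B \<in> sets borel" by (intro borel_open open_open_nbhd)
  have UP: "space P = UNIV" "measure P UNIV = 1" and UQ: "space Q = UNIV" "measure Q UNIV = 1"
    using sets_eq_imp_space_eq[OF P(2)] sets_eq_imp_space_eq[OF Q(2)] P.prob_space Q.prob_space by auto
  have diff: "\<bar>smooth_density \<epsilon> P y - smooth_density \<epsilon> Q y\<bar> \<le> \<Delta>" for y
    using smooth_density_diff_le[OF P Q e, of y] by (simp add: \<Delta>_def)
  have \<tau>0: "0 \<le> \<tau> r" for r by (simp add: \<tau>_def)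
  let ?V = "measure lborel (cball (0::real^'d) (2 * R))"
  let ?O = "cball (0::real^'d) (2 * R)"
  note iP = smooth_mass_Fubini(1)[OF P e] and iQ = smooth_mass_Fubini(1)[OF Q e]
  \<comment> \<open>Smoothing moves little mass out of, or into, the \<open>a\<close>-neighborhood \<open>C\<close> of \<open>B\<close>.\<close>
  have low: "indicator B x - \<tau> a \<le> smooth_mass \<epsilon> C x" for x
  proof (cases "x \<in> B")
    case True
    have far: "a \<le> norm (y - x)" if "y \<in> - C" for y
      using True that by (auto simp: C_def dist_norm norm_minus_commute not_less)
    have "smooth_mass \<epsilon> (- C) x \<le> \<tau> a"
      unfolding \<tau>_def using smooth_mass_far[of \<epsilon> "- C" a x] far e a C by simp
    then show ?thesis using smooth_mass_Compl[OF e C, of x] True by simp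
  next
    case False
    then show ?thesis using smooth_mass_nonneg[OF e, of C x] \<tau>0[of a] by simp
  qed
  have up: "smooth_mass \<epsilon> C x \<le> indicator (open_nbhd (2 * a) B) x + \<tau> a" for x
  proof (cases "x \<in> open_nbhd (2 * a) B")
    case True
    then show ?thesis using smooth_mass_le_1[OF e C, of x] \<tau>0[of a] by simp
  next
    case False
    have "a \<le> norm (y - x)" if yC: "y \<in> C" for y
    proof (rule ccontr)
      assume n: "\<not> a \<le> norm (y - x)"
      obtain b where b: "b \<in> B" "dist b y < a" using yC by (auto simp: C_def)
      have "infnorm (x - b) \<le> norm (x - b)" by (rule infnorm_le_norm)
      also have "\<dots> \<le> norm (y - x) + norm (b - y)"
        using dist_triangle[of x b y] by (simp add: dist_norm norm_minus_commute)
      also have "\<dots> < 2 * a" using n b by (simp add: dist_norm)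
      finally show False using False b by (auto simp: open_nbhd_def)
    qed
    then have "smooth_mass \<epsilon> C x \<le> \<tau> a"
      unfolding \<tau>_def using smooth_mass_far[OF e C, of a x] a by simp
    then show ?thesis using False by simp
  qed
  have outQ: "smooth_mass \<epsilon> (- ?O) x \<le> indicator {x. R \<le> norm x} x + \<tau> R" for x
  proof (cases "R \<le> norm x")
    case True
    then show ?thesis using smooth_mass_le_1[OF e, of "- ?O" x] \<tau>0[of R] by simp
  next
    case False
    have "R \<le> norm (y - x)" if "y \<in> - ?O" for y
    proof -
      have "2 * R < norm y" using that by simp
      moreover have "norm y \<le> norm (y - x) + norm x" using norm_triangle_ineq[of "y - x" x] by simp
      ultimately show ?thesis using False by simp
    qed
    then have "smooth_mass \<epsilon> (- ?O) x \<le> \<tau> R"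
      unfolding \<tau>_def using smooth_mass_far[OF e, of "- ?O" R x] R by simp
    then show ?thesis using False by simp
  qed
  have "measure P B - \<tau> a = (\<integral>x. indicator B x - \<tau> a \<partial>P)"
    using B P(2) by (simp add: UP P.emeasure_eq_measure)
  also have "\<dots> \<le> (\<integral>x. smooth_mass \<epsilon> C x \<partial>P)"
    by (rule integral_mono[OF _ iP]) (auto intro!: low simp: P(2) P.emeasure_eq_measure)
  also have "\<dots> \<le> (\<integral>x. smooth_mass \<epsilon> (C \<inter> ?O) x + smooth_mass \<epsilon> (- ?O) x \<partial>P)"
  proof (rule integral_mono[OF iP])
    show "integrable P (\<lambda>x. smooth_mass \<epsilon> (C \<inter> ?O) x + smooth_mass \<epsilon> (- ?O) x)"
      by (intro Bochner_Integration.integrable_add iP) auto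
    show "smooth_mass \<epsilon> C x \<le> smooth_mass \<epsilon> (C \<inter> ?O) x + smooth_mass \<epsilon> (- ?O) x" for x
      by (subst smooth_mass_Un[OF e, symmetric]) (auto intro!: smooth_mass_mono[OF e])
  qed auto
  also have "\<dots> = (\<integral>x. smooth_mass \<epsilon> (C \<inter> ?O) x \<partial>P) + (\<integral>x. smooth_mass \<epsilon> (- ?O) x \<partial>P)"
    by (rule Bochner_Integration.integral_add; rule iP) auto
  also have "(\<integral>x. smooth_mass \<epsilon> (C \<inter> ?O) x \<partial>P) \<le> (\<integral>x. smooth_mass \<epsilon> (C \<inter> ?O) x \<partial>Q) + \<Delta> * ?V"
    using smooth_mass_integral_diff[OF P Q e _ _ diff, of "C \<inter> ?O" "2 * R"] by auto
  also have "(\<integral>x. smooth_mass \<epsilon> (C \<inter> ?O) x \<partial>Q) \<le> (\<integral>x. indicator (open_nbhd (2 * a) B) x + \<tau> a \<partial>Q)"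
  proof (rule integral_mono[OF iQ])
    show "smooth_mass \<epsilon> (C \<inter> ?O) x \<le> indicator (open_nbhd (2 * a) B) x + \<tau> a" for x
      using up[of x] smooth_mass_mono[OF e, of "C \<inter> ?O" C x] by auto
  qed (use nb in \<open>auto simp: Q(2) Q.emeasure_eq_measure\<close>)
  also have "\<dots> = measure Q (open_nbhd (2 * a) B) + \<tau> a" using nb Q(2) by (simp add: UQ Q.emeasure_eq_measure)
  \<comment> \<open>Both smoothed measures have mass one, so the mass of \<open>P\<close> outside the ball is controlled from inside.\<close>
  also have "(\<integral>x. smooth_mass \<epsilon> (- ?O) x \<partial>P) \<le> (\<integral>x. smooth_mass \<epsilon> (- ?O) x \<partial>Q) + \<Delta> * ?V"
  proof -
    have "(\<integral>x. smooth_mass \<epsilon> (- ?O) x \<partial>P) = 1 - (\<integral>x. smooth_mass \<epsilon> ?O x \<partial>P)"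
      using iP[of ?O] by (simp add: smooth_mass_Compl[OF e] P.prob_space)
    moreover have "(\<integral>x. smooth_mass \<epsilon> (- ?O) x \<partial>Q) = 1 - (\<integral>x. smooth_mass \<epsilon> ?O x \<partial>Q)"
      using iQ[of ?O] by (simp add: smooth_mass_Compl[OF e] Q.prob_space)
    ultimately show ?thesis
      using smooth_mass_integral_diff[OF P Q e _ _ diff, of ?O "2 * R"] by auto
  qed
  also have "(\<integral>x. smooth_mass \<epsilon> (- ?O) x \<partial>Q) \<le> (\<integral>x. indicator {x. R \<le> norm x} x + \<tau> R \<partial>Q)"
    by (rule integral_mono[OF iQ]) (auto intro!: outQ simp: Q(2) Q.emeasure_eq_measure)
  also have "\<dots> = measure Q {x. R \<le> norm x} + \<tau> R" using nb Q(2) by (simp add: UQ Q.emeasure_eq_measure)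
  finally show ?thesis by (simp add: algebra_simps)
qed

section \<open>Prokhorov distance and weak convergence\<close>

lemma prokhorov_bounds:
  fixes P Q :: "(real^'d) measure"
  assumes P: "prob_space P" and Q: "prob_space Q" "sets Q = sets borel" and e: "0 < \<epsilon>"
    and le: "\<And>B. B \<in> sets borel \<Longrightarrow> measure P B \<le> measure Q (open_nbhd \<epsilon> B) + \<epsilon>"
  shows "0 \<le> prokhorov P Q" "prokhorov P Q \<le> \<epsilon>"
proof -
  let ?S = "{\<epsilon>. 0 < \<epsilon> \<and> (SUP B\<in>sets borel. measure P B - measure Q (open_nbhd \<epsilon> B)) \<le> \<epsilon>}"
  have "(SUP B\<in>sets borel. measure P B - measure Q (open_nbhd \<epsilon> B)) \<le> \<epsilon>"
    by (rule cSUP_least) (use le in \<open>auto simp: algebra_simps\<close>)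
  then have S: "\<epsilon> \<in> ?S" using e by simp
  have bdd: "bdd_below ?S" by (rule bdd_belowI[of _ 0]) auto
  show "prokhorov P Q \<le> \<epsilon>" unfolding prokhorov_def by (rule cInf_lower[OF S bdd])
  show "0 \<le> prokhorov P Q" unfolding prokhorov_def by (rule cInf_greatest) (use S in auto)
qed

text \<open>
  The closed set \<open>F\<close> is the intersection of its neighborhoods, so one of them has almost the same mass for \<open>Q\<close>.
\<close>

lemma closed_limsup_le:
  fixes P :: "nat \<Rightarrow> (real^'d) measure"
  assumes Q: "prob_space Q" "sets Q = sets borel"
    and e: "e \<longlonglongrightarrow> 0"
    and le: "eventually (\<lambda>n. \<forall>B\<in>sets borel. measure (P n) B \<le> measure Q (open_nbhd (e n) B) + e n) sequentially"
    and F: "closed F" and d: "0 < \<delta>"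
  shows "eventually (\<lambda>n. measure (P n) F \<le> measure Q F + \<delta>) sequentially"
proof -
  interpret Q: prob_space Q by fact
  have Fb: "F \<in> sets borel" using F by simp
  define N where "N k = open_nbhd (1 / real (Suc k)) F" for k
  have "(\<lambda>k. measure Q (N k)) \<longlonglongrightarrow> measure Q (\<Inter>k. N k)"
  proof (rule Q.finite_Lim_measure_decseq)
    show "range N \<subseteq> Q.events" unfolding N_def Q(2) by (auto intro!: borel_open open_open_nbhd)
    show "decseq N" unfolding decseq_def N_def
      by (intro allI impI open_nbhd_mono) (simp add: frac_le)
  qed
  moreover have "(\<Inter>k. N k) = F"
  proof
    show "(\<Inter>k. N k) \<subseteq> F"
    proof
      fix x assume x: "x \<in> (\<Inter>k. N k)"
      have "\<exists>y\<in>F. dist y x < r" if r: "0 < r" for r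
      proof -
        have "0 < r / sqrt (real CARD('d))" using r by simp
        then obtain k where k: "1 / real (Suc k) < r / sqrt (real CARD('d))"
          using reals_Archimedean by (metis inverse_eq_divide)
        obtain b where b: "b \<in> F" "infnorm (x - b) < 1 / real (Suc k)"
          using x by (auto simp: N_def open_nbhd_def)
        have "norm (x - b) \<le> sqrt (real CARD('d)) * infnorm (x - b)"
          using norm_le_infnorm[of "x - b"] by simp
        also have "\<dots> < sqrt (real CARD('d)) * (r / sqrt (real CARD('d)))"
          using b k by (intro mult_strict_left_mono) auto
        also have "\<dots> = r" by simp
        finally show ?thesis using b by (auto simp: dist_norm norm_minus_commute)
      qed
      then show "x \<in> F" using closure_approachable[of x F] F by simp
    qed
    show "F \<subseteq> (\<Inter>k. N k)"
      by (auto simp: N_def open_nbhd_def infnorm_0 intro!: bexI)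
  qed
  ultimately have "(\<lambda>k. measure Q (N k)) \<longlonglongrightarrow> measure Q F" by simp
  then have "eventually (\<lambda>k. measure Q (N k) < measure Q F + \<delta> / 2) sequentially"
    by (rule order_tendstoD(2)) (use d in simp)
  then obtain k where k: "measure Q (N k) < measure Q F + \<delta> / 2"
    using eventually_happens trivial_limit_sequentially by blast
  have "eventually (\<lambda>n. e n < 1 / real (Suc k)) sequentially"
    by (rule order_tendstoD(2)[OF e]) simp
  moreover have "eventually (\<lambda>n. e n < \<delta> / 2) sequentially"
    by (rule order_tendstoD(2)[OF e]) (use d in simp)
  ultimately show ?thesis
    using le
  proof eventually_elim
    case (elim n)
    have "measure (P n) F \<le> measure Q (open_nbhd (e n) F) + e n" using elim Fb by blast
    also have "measure Q (open_nbhd (e n) F) \<le> measure Q (N k)"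
      unfolding N_def
      by (rule Q.finite_measure_mono) (use elim in \<open>auto simp: Q(2) intro!: open_nbhd_mono borel_open open_open_nbhd\<close>)
    finally show ?case using k elim by linarith
  qed
qed

text \<open>
  The sum is the integer part of \<open>m t\<close>. This approximates a function with values in the unit interval by an
  average of indicators of closed sets.
\<close>

lemma staircase:
  fixes t :: real
  assumes "0 \<le> t" "t \<le> 1" "1 \<le> m"
  shows "(\<Sum>i=1..m. of_bool (real i / real m \<le> t)) / real m \<le> t"
    and "t \<le> 1 / real m + (\<Sum>i=1..m. of_bool (real i / real m \<le> t)) / real m"
proof -
  let ?j = "nat \<lfloor>real m * t\<rfloor>"
  have m: "0 < real m" using assms by simp
  have le: "real m * t \<le> real m" using assms m by (simp add: mult_left_le)
  have mt: "0 \<le> real m * t" using assms by simp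
  have "(\<Sum>i=1..m. of_bool (real i / real m \<le> t)) = real (card {i\<in>{1..m}. real i / real m \<le> t})"
    by (simp add: of_bool_def flip: sum.inter_filter)
  also have "{i\<in>{1..m}. real i / real m \<le> t} = {1..?j}"
  proof -
    have "real i / real m \<le> t \<longleftrightarrow> i \<le> ?j" for i
    proof -
      have "real i / real m \<le> t \<longleftrightarrow> real i \<le> real m * t" using m by (simp add: field_simps)
      also have "\<dots> \<longleftrightarrow> int i \<le> \<lfloor>real m * t\<rfloor>" by (simp add: le_floor_iff)
      also have "\<dots> \<longleftrightarrow> i \<le> ?j" using mt by linarith
      finally show ?thesis .
    qed
    moreover have "?j \<le> m" using le by linarith
    ultimately have "i \<in> {i\<in>{1..m}. real i / real m \<le> t} \<longleftrightarrow> i \<in> {1..?j}" for i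
      by (simp only: mem_Collect_eq atLeastAtMost_iff) (meson le_trans)
    then show ?thesis by (rule set_eqI)
  qed
  finally have eq: "(\<Sum>i=1..m. of_bool (real i / real m \<le> t)) = real ?j" by simp
  have "real ?j \<le> real m * t" "real m * t \<le> 1 + real ?j" using mt by linarith+
  then show "(\<Sum>i=1..m. of_bool (real i / real m \<le> t)) / real m \<le> t"
    and "t \<le> 1 / real m + (\<Sum>i=1..m. of_bool (real i / real m \<le> t)) / real m"
    unfolding eq using m by (simp_all add: field_simps)
qed

lemma limsup_integral_le:
  fixes P :: "nat \<Rightarrow> (real^'d) measure" and g :: "real^'d \<Rightarrow> real"
  assumes P: "\<And>n. prob_space (P n)" "\<And>n. sets (P n) = sets borel"
    and Q: "prob_space Q" "sets Q = sets borel"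
    and cl: "\<And>F \<delta>. closed F \<Longrightarrow> 0 < \<delta> \<Longrightarrow> eventually (\<lambda>n. measure (P n) F \<le> measure Q F + \<delta>) sequentially"
    and g: "continuous_on UNIV g" "\<And>x. 0 \<le> g x" "\<And>x. g x \<le> 1" and d: "0 < \<delta>"
  shows "eventually (\<lambda>n. (\<integral>x. g x \<partial>P n) \<le> (\<integral>x. g x \<partial>Q) + \<delta>) sequentially"
proof -
  define m where "m = nat \<lceil>2 / \<delta>\<rceil> + 1"
  have m: "1 \<le> m" "1 / real m \<le> \<delta> / 2"
  proof -
    have m0: "0 < real m" by (simp add: m_def)
    have "2 / \<delta> \<le> real m" unfolding m_def by linarith
    then show "1 / real m \<le> \<delta> / 2" using d m0 by (simp add: field_simps)
  qed (simp add: m_def)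
  define F where "F i = {x. real i / real m \<le> g x}" for i
  have F: "closed (F i)" for i unfolding F_def
    by (rule closed_Collect_le) (auto intro: g continuous_intros)
  have gm: "g \<in> borel_measurable borel" by (rule borel_measurable_continuous_onI[OF g(1)])
  have int: "(\<integral>x. (\<Sum>i=1..m. of_bool (real i / real m \<le> g x)) / real m \<partial>R) = (\<Sum>i=1..m. measure R (F i)) / real m"
    and int2: "integrable R (\<lambda>x. (\<Sum>i=1..m. of_bool (real i / real m \<le> g x)) / real m)"
    and int3: "integrable R g"
    if R: "prob_space R" "sets R = sets borel" for R
  proof -
    interpret R: prob_space R by fact
    have Fm: "F i \<in> sets R" for i using F R by simp
    have eq: "(\<lambda>x. (\<Sum>i=1..m. of_bool (real i / real m \<le> g x)) / real m) = (\<lambda>x. (\<Sum>i=1..m. indicator (F i) x) / real m)"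
      by (simp add: F_def indicator_def)
    have i: "integrable R (\<lambda>x. indicator (F i) x :: real)" for i
      using Fm by (intro integrable_real_indicator) (auto simp: R.emeasure_eq_measure)
    show "(\<integral>x. (\<Sum>i=1..m. of_bool (real i / real m \<le> g x)) / real m \<partial>R) = (\<Sum>i=1..m. measure R (F i)) / real m"
      unfolding eq using Fm i sets_eq_imp_space_eq[OF R(2)] by (simp add: Bochner_Integration.integral_sum)
    show "integrable R (\<lambda>x. (\<Sum>i=1..m. of_bool (real i / real m \<le> g x)) / real m)"
      unfolding eq using i by (intro integrable_divide_zero Bochner_Integration.integrable_sum) auto
    show "integrable R g"
      by (rule R.integrable_const_bound[where B=1]) (use g gm R in \<open>auto cong: measurable_cong_sets\<close>)
  qed
  have "eventually (\<lambda>n. \<forall>i\<in>{1..m}. measure (P n) (F i) \<le> measure Q (F i) + \<delta> / 2) sequentially"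
    by (rule eventually_ball_finite) (use cl[OF F] d in auto)
  then show ?thesis
  proof eventually_elim
    case (elim n)
    interpret Pn: prob_space "P n" by (rule P)
    have "(\<integral>x. g x \<partial>P n) \<le> (\<integral>x. 1 / real m + (\<Sum>i=1..m. of_bool (real i / real m \<le> g x)) / real m \<partial>P n)"
      by (rule integral_mono[OF int3[OF P]])
         (use staircase(2)[OF g(2,3) m(1)] int2[OF P, of n] in auto)
    also have "\<dots> = (\<integral>x. 1 / real m \<partial>P n) + (\<integral>x. (\<Sum>i=1..m. of_bool (real i / real m \<le> g x)) / real m \<partial>P n)"
      by (rule Bochner_Integration.integral_add[OF _ int2[OF P]]) simp
    also have "\<dots> = 1 / real m + (\<Sum>i=1..m. measure (P n) (F i)) / real m"
      unfolding int[OF P] by (simp add: Pn.prob_space)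
    also have "(\<Sum>i=1..m. measure (P n) (F i)) / real m \<le> (\<Sum>i=1..m. measure Q (F i) + \<delta> / 2) / real m"
      by (rule divide_right_mono[OF sum_mono]) (use elim in auto)
    also have "\<dots> = (\<Sum>i=1..m. measure Q (F i)) / real m + \<delta> / 2"
      using m by (simp add: sum.distrib add_divide_distrib)
    also have "(\<Sum>i=1..m. measure Q (F i)) / real m \<le> (\<integral>x. g x \<partial>Q)"
      unfolding int[OF Q, symmetric]
      by (rule integral_mono[OF int2[OF Q] int3[OF Q]]) (use staircase(1)[OF g(2,3) m(1)] in auto)
    finally show ?case using m by linarith
  qed
qed

text \<open>
  The upper bound of \<open>limsup_integral_le\<close>, applied to \<open>(K + g) / (2 K)\<close> and \<open>(K - g) / (2 K)\<close> with \<open>K\<close> a bound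
  of \<open>\<bar>g\<bar>\<close>, bounds the integrals of \<open>g\<close> from both sides.
\<close>

proposition weakly_converges_if_nbhd:
  fixes P :: "nat \<Rightarrow> (real^'d) measure"
  assumes P: "\<And>n. prob_space (P n)" "\<And>n. sets (P n) = sets borel"
    and Q: "prob_space Q" "sets Q = sets borel"
    and e: "e \<longlonglongrightarrow> 0"
    and le: "eventually (\<lambda>n. \<forall>B\<in>sets borel. measure (P n) B \<le> measure Q (open_nbhd (e n) B) + e n) sequentially"
  shows "weakly_converges P Q"
  unfolding weakly_converges_def
proof (intro allI impI)
  fix g :: "real^'d \<Rightarrow> real"
  assume g: "continuous_on UNIV g" "bounded (range g)"
  obtain K where K: "0 < K" "\<And>x. \<bar>g x\<bar> \<le> K"
    using g(2) by (auto simp: bounded_pos)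
  note cl = closed_limsup_le[OF Q e le]
  have gm: "g \<in> borel_measurable borel" by (rule borel_measurable_continuous_onI[OF g(1)])
  have ints: "integrable R g" "(\<integral>x. (K + c * g x) / (2 * K) \<partial>R) = (K + c * (\<integral>x. g x \<partial>R)) / (2 * K)"
    if R: "prob_space R" "sets R = sets borel" for R c
  proof -
    interpret R: prob_space R by fact
    show *: "integrable R g"
      by (rule R.integrable_const_bound[where B=K]) (use K gm R in \<open>auto cong: measurable_cong_sets\<close>)
    show "(\<integral>x. (K + c * g x) / (2 * K) \<partial>R) = (K + c * (\<integral>x. g x \<partial>R)) / (2 * K)"
      using * by (simp add: R.prob_space)
  qed
  have half: "eventually (\<lambda>n. c * (\<integral>x. g x \<partial>P n) \<le> c * (\<integral>x. g x \<partial>Q) + \<delta>) sequentially"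
    if c: "c = 1 \<or> c = -1" and \<delta>: "0 < \<delta>" for c \<delta> :: real
  proof -
    have "eventually (\<lambda>n. (\<integral>x. (K + c * g x) / (2 * K) \<partial>P n) \<le> (\<integral>x. (K + c * g x) / (2 * K) \<partial>Q) + \<delta> / (2 * K)) sequentially"
    proof (rule limsup_integral_le[OF P Q cl])
      show "continuous_on UNIV (\<lambda>x. (K + c * g x) / (2 * K))"
        using g K by (auto intro!: continuous_intros)
      have "\<bar>c * g x\<bar> \<le> K" for x using K(2)[of x] c by auto
      then show "0 \<le> (K + c * g x) / (2 * K)" "(K + c * g x) / (2 * K) \<le> 1" for x
        using K(1) by (auto simp: abs_le_iff field_simps) (smt (verit, best))+
    qed (use K \<delta> in auto)
    then show ?thesis
      unfolding ints(2)[OF P] ints(2)[OF Q]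
    proof (rule eventually_mono)
      show "p \<le> q + \<delta>" if "(K + p) / (2 * K) \<le> (K + q) / (2 * K) + \<delta> / (2 * K)" for p q
        using that K(1) unfolding add_divide_distrib[symmetric] by (simp add: divide_le_cancel)
    qed
  qed
  show "(\<lambda>n. \<integral>x. g x \<partial>P n) \<longlonglongrightarrow> (\<integral>x. g x \<partial>Q)"
  proof (rule tendstoI)
    fix \<delta> :: real assume \<delta>: "0 < \<delta>"
    have "eventually (\<lambda>n. 1 * (\<integral>x. g x \<partial>P n) \<le> 1 * (\<integral>x. g x \<partial>Q) + \<delta> / 2) sequentially"
      by (rule half) (use \<delta> in auto)
    moreover have "eventually (\<lambda>n. - 1 * (\<integral>x. g x \<partial>P n) \<le> - 1 * (\<integral>x. g x \<partial>Q) + \<delta> / 2) sequentially"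
      by (rule half) (use \<delta> in auto)
    ultimately show "eventually (\<lambda>n. dist (\<integral>x. g x \<partial>P n) (\<integral>x. g x \<partial>Q) < \<delta>) sequentially"
      by eventually_elim (use \<delta> in \<open>auto simp: dist_real_def abs_less_iff\<close>)
  qed
qed

section \<open>Decorrelation of products of increments\<close>

lemma holder_data:
  fixes g :: "'a::metric_space \<Rightarrow> complex"
  assumes \<eta>: "0 < \<eta>" and b: "\<And>x. cmod (g x) \<le> b" and c: "\<And>x y. cmod (g x - g y) \<le> c * dist x y powr \<eta>" "0 \<le> c"
  shows "bounded_holder \<eta> g" and "0 \<le> sup_norm g" and "sup_norm g \<le> b" and "holder_const \<eta> g \<le> c"
proof -
  have bdd: "bounded (range g)" using b by (auto simp: bounded_iff)
  show "bounded_holder \<eta> g"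
    unfolding bounded_holder_def using bdd c by (auto simp: dist_norm)
  show "sup_norm g \<le> b" unfolding sup_norm_def by (rule cSUP_least) (use b in auto)
  have "bdd_above (range (\<lambda>x. cmod (g x)))" by (rule bdd_aboveI2[OF b])
  then have "cmod (g undefined) \<le> sup_norm g" unfolding sup_norm_def by (rule cSUP_upper[rotated]) simp
  then show "0 \<le> sup_norm g" using norm_ge_zero order_trans by blast
  show "holder_const \<eta> g \<le> c"
    unfolding holder_const_def
  proof (rule cSup_least)
    fix z assume "z \<in> insert 0 {cmod (g x - g y) / dist x y powr \<eta> |x y. x \<noteq> y}"
    then consider "z = 0" | x y where "x \<noteq> y" "z = cmod (g x - g y) / dist x y powr \<eta>" by blast
    then show "z \<le> c"
    proof cases
      case 2
      then have "0 < dist x y powr \<eta>" by simp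
      then show ?thesis using c(1)[of x y] 2(2) by (simp add: pos_divide_le_eq)
    qed (use c in simp)
  qed simp
qed

lemma norm_cis_minus_1: "cmod (cis t - 1) \<le> \<bar>t\<bar>"
  using iexp_approx1[of t 0] by (simp add: cis_conv_exp)

lemma norm_cis_approx1: "cmod (cis t - 1 - \<i> * t) \<le> t\<^sup>2"
proof -
  have "cmod (cis t - 1 - \<i> * t) \<le> t\<^sup>2 / 2"
    using iexp_approx1[of t 1] by (simp add: cis_conv_exp algebra_simps fact_numeral power2_eq_square)
  then show ?thesis using zero_le_power2[of t] by linarith
qed

lemma norm_cis_approx2: "cmod (cis t - 1 - \<i> * t + t\<^sup>2 / 2) \<le> \<bar>t\<bar> ^ 3"
proof -
  have "cmod (cis t - 1 - \<i> * t + t\<^sup>2 / 2) \<le> \<bar>t\<bar> ^ 3 / 6"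
    using iexp_approx1[of t 2]
    by (simp add: cis_conv_exp algebra_simps fact_numeral power2_eq_square numeral_eq_Suc)
  moreover have "\<bar>t\<bar> ^ 3 / 6 \<le> \<bar>t\<bar> ^ 3" by simp
  ultimately show ?thesis by linarith
qed

lemma poly_mono_nonneg:
  fixes P :: "real poly"
  assumes "\<And>i. 0 \<le> coeff P i" "0 \<le> x" "x \<le> y"
  shows "poly P x \<le> poly P y" and "0 \<le> poly P x"
  using assms by (auto simp: poly_altdef intro!: sum_mono sum_nonneg mult_left_mono power_mono)

lemma norm_le_add_diff:
  fixes x y :: "'a::real_normed_vector"
  shows "norm (x - y) \<le> e \<Longrightarrow> norm y \<le> b \<Longrightarrow> norm x \<le> b + e"
  using norm_triangle_ineq[of y "x - y"] by simp

text \<open>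
  The data of the theorem with all constants named. The parameter of the decorrelation property is a natural
  number \<open>R\<close> here: since \<open>\<delta> < 1\<close>, enlarging the parameter only weakens the property. \<open>B\<close> and \<open>H\<close> bound the
  observable and its Hoelder quotients.
\<close>

locale decorrelated_observable = prob_space M
  for M :: "'a::metric_space measure" +
  fixes T :: "'a \<Rightarrow> 'a" and \<eta> :: real and f :: "'a \<Rightarrow> real ^ 'd"
    and P :: "real poly" and \<delta> :: real and R :: nat and B H :: real
  assumes sets_M: "sets M = sets borel"
    and T_meas: "T \<in> measurable M M"
    and T_inv: "distr M M T = M"
    and \<eta>_pos: "0 < \<eta>"
    and P_nonneg: "\<And>i. 0 \<le> coeff P i"
    and \<delta>: "0 < \<delta>" "\<delta> < 1"
    and R_pos: "1 \<le> R"
    and decorrelation: "\<And>(m::nat) (m'::nat) (g :: nat \<Rightarrow> 'a \<Rightarrow> complex) (k :: nat \<Rightarrow> nat) (l :: nat \<Rightarrow> nat) (n::nat).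
          1 \<le> m \<Longrightarrow> 1 \<le> m' \<Longrightarrow>
          (\<forall>i\<in>{1..m+m'}. bounded_holder \<eta> (g i)) \<Longrightarrow>
          strict_mono_on {1..m} k \<Longrightarrow> strict_mono_on {1..m'} l \<Longrightarrow>
          norm (cov M (\<lambda>x. \<Prod>i=1..m. g i ((T ^^ k i) x))
                      (\<lambda>x. \<Prod>j=1..m'. g (m + j) ((T ^^ (n + l j)) x)))
          \<le> ((\<Prod>i=1..m+m'. sup_norm (g i))
              + (\<Sum>i=1..m+m'. holder_const \<eta> (g i) * (\<Prod>j\<in>{1..m+m'} - {i}. sup_norm (g j))))
             * poly P (real (l m')) * \<delta> powr (real n - real R * real (k m))"
    and B_pos: "0 < B" and f_bound: "\<And>x. norm (f x) \<le> B"
    and H_nonneg: "0 \<le> H" and f_holder: "\<And>x y. norm (f x - f y) \<le> H * dist x y powr \<eta>"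
    and f_centered: "(LINT x|M. f x) = 0"
begin

lemma f_meas [measurable]: "f \<in> borel_measurable M"
proof -
  have "continuous_on UNIV f"
    unfolding continuous_on_iff
  proof (intro ballI allI impI)
    fix x and e :: real assume e: "0 < e"
    define r where "r = (e / (H + 1)) powr (1 / \<eta>)"
    have r: "0 < r" using e H_nonneg by (simp add: r_def)
    have "dist (f y) (f x) < e" if "dist y x < r" for y
    proof -
      have "dist y x powr \<eta> < r powr \<eta>" using that \<eta>_pos by (intro powr_less_mono2) auto
      also have "r powr \<eta> = e / (H + 1)" using \<eta>_pos e H_nonneg by (simp add: r_def powr_powr)
      finally have lt: "dist y x powr \<eta> < e / (H + 1)" .
      have "dist (f y) (f x) \<le> H * dist y x powr \<eta>" using f_holder by (simp add: dist_norm)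
      also have "\<dots> \<le> (H + 1) * dist y x powr \<eta>" by (simp add: mult_right_mono)
      also have "\<dots> < (H + 1) * (e / (H + 1))" using lt H_nonneg by (intro mult_strict_left_mono) auto
      also have "\<dots> = e" using H_nonneg by simp
      finally show ?thesis .
    qed
    then show "\<exists>d>0. \<forall>y\<in>UNIV. dist y x < d \<longrightarrow> dist (f y) (f x) < e" using r by blast
  qed
  then have "f \<in> borel_measurable borel" by (rule borel_measurable_continuous_onI)
  then show ?thesis using sets_M by (simp cong: measurable_cong_sets)
qed

lemma iter_meas [measurable]: "(T ^^ k) \<in> measurable M M"
  by (induction k) (auto simp: comp_def intro: measurable_compose T_meas)

lemma iter_inv: "distr M M (T ^^ k) = M"
proof (induction k)
  case (Suc k)
  have "distr M M (T ^^ Suc k) = distr (distr M M (T ^^ k)) M T"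
    by (simp add: distr_distr[OF T_meas iter_meas])
  then show ?case by (simp only: Suc T_inv)
qed (simp add: distr_id)

lemma integral_iter:
  fixes g :: "'a \<Rightarrow> 'c::{banach, second_countable_topology}"
  assumes "g \<in> borel_measurable M"
  shows "(\<integral>x. g ((T ^^ k) x) \<partial>M) = (\<integral>x. g x \<partial>M)"
  using integral_distr[OF iter_meas assms, of k] by (simp add: iter_inv)

text \<open>
  For a frequency \<open>u\<close> this is the contribution of time \<open>k\<close> to \<open>u.S_n\<close>.
\<close>

definition phase :: "real^'d \<Rightarrow> nat \<Rightarrow> 'a \<Rightarrow> real" where
  "phase u k x = u \<bullet> f ((T ^^ k) x)"

text \<open>
  The exponential \<open>exp(i u.f(T^s x)) ... exp(i u.f(T^(n-1) x))\<close> of a stretch of the orbit.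
\<close>

definition osc :: "real^'d \<Rightarrow> nat \<Rightarrow> nat \<Rightarrow> 'a \<Rightarrow> complex" where
  "osc u s n x = (\<Prod>k\<in>{s..<n}. cis (phase u k x))"

text \<open>
  Product of the increments \<open>g_q\<close> over the times \<open>q\<close> in \<open>F\<close>. It is of order \<open>norm u ^ card F\<close>, and \<open>F\<close> records
  which factors have been opened.
\<close>

definition incr :: "real^'d \<Rightarrow> nat set \<Rightarrow> 'a \<Rightarrow> complex" where
  "incr u F x = (\<Prod>q\<in>F. cis (phase u q x) - 1)"

text \<open>
  Characteristic function of the Birkhoff sum of length \<open>n\<close>.
\<close>

definition hchar :: "real^'d \<Rightarrow> nat \<Rightarrow> complex" where
  "hchar u n = (\<integral>x. osc u 0 n x \<partial>M)"

lemma phase_meas [measurable]: "phase u k \<in> borel_measurable M"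
  unfolding phase_def[abs_def] by measurable

lemma phase_bound: "\<bar>phase u k x\<bar> \<le> B * norm u"
proof -
  have "\<bar>phase u k x\<bar> \<le> norm u * norm (f ((T ^^ k) x))"
    unfolding phase_def by (rule Cauchy_Schwarz_ineq2)
  also have "\<dots> \<le> norm u * B" by (intro mult_left_mono f_bound) simp
  finally show ?thesis by (simp add: mult.commute)
qed

lemma cis_phase_meas [measurable]: "(\<lambda>x. cis (phase u k x)) \<in> borel_measurable M"
  unfolding cis_conv_exp by measurable

lemma osc_meas [measurable]: "osc u s n \<in> borel_measurable M"
  unfolding osc_def[abs_def] by measurable

lemma incr_meas [measurable]: "incr u F \<in> borel_measurable M"
  unfolding incr_def[abs_def] by measurable

lemma norm_osc [simp]: "cmod (osc u s n x) = 1"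
  unfolding osc_def by (simp add: prod_norm[symmetric])

lemma norm_incr: "cmod (incr u F x) \<le> (B * norm u) ^ card F"
proof -
  have "cmod (incr u F x) = (\<Prod>q\<in>F. cmod (cis (phase u q x) - 1))"
    unfolding incr_def by (simp add: prod_norm)
  also have "\<dots> \<le> (\<Prod>q\<in>F. B * norm u)"
    by (intro prod_mono conjI norm_ge_zero order_trans[OF norm_cis_minus_1 phase_bound])
  finally show ?thesis by simp
qed

lemma integrable_bounded:
  fixes g :: "'a \<Rightarrow> 'c::{banach, second_countable_topology}"
  assumes "g \<in> borel_measurable M" "\<And>x. norm (g x) \<le> c"
  shows "integrable M g"
  by (rule integrable_const_bound[where B=c]) (use assms in auto)

lemma norm_integral_le:
  fixes g :: "'a \<Rightarrow> 'c::{banach, second_countable_topology}"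
  assumes g: "g \<in> borel_measurable M" "\<And>x. norm (g x) \<le> c"
  shows "norm (\<integral>x. g x \<partial>M) \<le> c"
proof -
  have "norm (\<integral>x. g x \<partial>M) \<le> (\<integral>x. norm (g x) \<partial>M)" by (rule integral_norm_bound)
  also have "\<dots> \<le> (\<integral>x. c \<partial>M)"
    by (rule integral_mono) (use integrable_bounded[OF g] g in auto)
  finally show ?thesis by (simp add: prob_space)
qed

lemma norm_incr_osc: "cmod (incr u F x * osc u s n x) \<le> (B * norm u) ^ card F"
  using norm_incr[of u F x] by (simp add: norm_mult)

lemma integrable_incr_osc: "integrable M (\<lambda>x. incr u F x * osc u s n x)"
  by (rule integrable_bounded[OF _ norm_incr_osc]) measurable

lemma norm_hchar_le: "cmod (hchar u n) \<le> 1"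
  unfolding hchar_def by (rule norm_integral_le) auto

lemma osc_shift: "s \<le> n \<Longrightarrow> osc u s n x = osc u 0 (n - s) ((T ^^ s) x)"
proof -
  have it: "(T ^^ k) ((T ^^ s) x) = (T ^^ (k + s)) x" for k by (simp add: funpow_add)
  show ?thesis
    unfolding osc_def phase_def it
    by (rule prod.reindex_bij_witness[of _ "\<lambda>k. k + s" "\<lambda>k. k - s"]) auto
qed

lemma integral_osc: "s \<le> n \<Longrightarrow> (\<integral>x. osc u s n x \<partial>M) = hchar u (n - s)"
  unfolding hchar_def by (simp only: osc_shift[of s n] integral_iter[OF osc_meas])

lemma osc_Suc: "q < n \<Longrightarrow> osc u q n x = cis (phase u q x) * osc u (Suc q) n x"
  unfolding osc_def by (simp add: prod.atLeast_Suc_lessThan)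

text \<open>
  Open the factors at times \<open>q0, ..., s - 1\<close> one by one, using \<open>osc u q n = osc u (Suc q) n + g_q osc u (Suc q) n\<close>.
\<close>

lemma telescope:
  assumes "q0 \<le> s" "s \<le> n" "finite F" "\<And>q. q \<in> F \<Longrightarrow> q < q0"
  shows "(\<integral>x. incr u F x * osc u q0 n x \<partial>M) =
    (\<integral>x. incr u F x * osc u s n x \<partial>M) + (\<Sum>q\<in>{q0..<s}. \<integral>x. incr u (insert q F) x * osc u (Suc q) n x \<partial>M)"
  using assms
proof (induction s rule: dec_induct)
  case (step s)
  have sF: "s \<notin> F" using step.prems(3) step.hyps(1) by force
  have "incr u F x * osc u s n x = incr u F x * osc u (Suc s) n x + incr u (insert s F) x * osc u (Suc s) n x" for x
  proof -
    have "osc u s n x = cis (phase u s x) * osc u (Suc s) n x"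
      by (rule osc_Suc) (use step in auto)
    moreover have "incr u (insert s F) x = (cis (phase u s x) - 1) * incr u F x"
      using sF \<open>finite F\<close> by (simp add: incr_def)
    ultimately show ?thesis by (simp only:) (simp add: algebra_simps)
  qed
  then have "(\<integral>x. incr u F x * osc u s n x \<partial>M) =
     (\<integral>x. incr u F x * osc u (Suc s) n x \<partial>M) + (\<integral>x. incr u (insert s F) x * osc u (Suc s) n x \<partial>M)"
    by (simp add: Bochner_Integration.integral_add integrable_incr_osc)
  then show ?case using step by simp
qed simp

text \<open>
  Bound given by the decorrelation property, for \<open>norm u \<le> 1\<close>, when at most \<open>K\<close> increments are followed by a
  future that begins \<open>Q\<close> later than \<open>R\<close> times the last time of the past, and all times are below \<open>N\<close>.
\<close>

definition err :: "nat \<Rightarrow> nat \<Rightarrow> nat \<Rightarrow> real" where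
  "err K N Q = 2 ^ K * (1 + (real K + real N) * H) * poly P (real N) * \<delta> ^ Q"

lemma err_nonneg: "0 \<le> err K N Q"
  unfolding err_def using H_nonneg \<delta> poly_mono_nonneg(2)[of P "real N" "real N"] P_nonneg by simp

text \<open>
  Increments have supremum norm at most \<open>2\<close> and the factors of \<open>osc\<close> have modulus one, while both have Hoelder constant at
  most \<open>H\<close> when \<open>norm u \<le> 1\<close>. So the right-hand side of the decorrelation property grows only polynomially with
  the number of factors of the future.
\<close>

lemma incr_osc_decorrelation:
  assumes u: "norm u \<le> 1" and F: "finite F" "F \<noteq> {}" "card F \<le> K"
    and s: "R * Max F + Q \<le> s" "s < n" "n \<le> N"
  shows "cmod ((\<integral>x. incr u F x * osc u s n x \<partial>M) - (\<integral>x. incr u F x \<partial>M) * hchar u (n - s)) \<le> err K N Q"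
proof -
  define m where "m = card F"
  define m' where "m' = n - s"
  have m: "1 \<le> m" "1 \<le> m'" using F s by (auto simp: m_def m'_def Suc_leI card_gt_0_iff)
  obtain e where e: "bij_betw e {..<m} F" "strict_mono_on {..<m} e"
    unfolding m_def using ex_bij_betw_strict_mono_card[OF F(1)] by blast
  define k where "k i = e (i - 1)" for i
  define l where "l j = j - 1" for j :: nat
  \<comment> \<open>The first \<open>m\<close> functions are the increments, the others the factors of \<open>osc\<close>; past and future times
    are enumerated from \<open>1\<close>.\<close>
  define g where "g i = (if i \<le> m then (\<lambda>x. cis (u \<bullet> f x) - 1) else (\<lambda>x. cis (u \<bullet> f x)))" for i
  have lip: "cmod (cis (u \<bullet> f x) - cis (u \<bullet> f y)) \<le> H * dist x y powr \<eta>" for x y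
  proof -
    have "cis (u \<bullet> f x) - cis (u \<bullet> f y) = cis (u \<bullet> f y) * (cis (u \<bullet> (f x - f y)) - 1)"
      by (simp add: algebra_simps cis_mult inner_diff_right)
    then have "cmod (cis (u \<bullet> f x) - cis (u \<bullet> f y)) \<le> \<bar>u \<bullet> (f x - f y)\<bar>"
      using norm_cis_minus_1 by (simp add: norm_mult)
    also have "\<dots> \<le> norm u * norm (f x - f y)" by (rule Cauchy_Schwarz_ineq2)
    also have "\<dots> \<le> 1 * norm (f x - f y)" by (rule mult_right_mono[OF u]) simp
    finally show ?thesis using f_holder[of x y] by simp
  qed
  have g: "bounded_holder \<eta> (g i)" "0 \<le> sup_norm (g i)" "sup_norm (g i) \<le> (if i \<le> m then 2 else 1)"
    "holder_const \<eta> (g i) \<le> H" for i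
  proof -
    have "cmod (g i x) \<le> (if i \<le> m then 2 else 1)" for x
      using norm_triangle_ineq4[of "cis (u \<bullet> f x)" 1] by (simp add: g_def)
    moreover have "cmod (g i x - g i y) \<le> H * dist x y powr \<eta>" for x y
      using lip by (simp add: g_def)
    ultimately show "bounded_holder \<eta> (g i)" "0 \<le> sup_norm (g i)" "sup_norm (g i) \<le> (if i \<le> m then 2 else 1)"
      "holder_const \<eta> (g i) \<le> H"
      using holder_data[OF \<eta>_pos, of "g i" "if i \<le> m then 2 else 1" H] H_nonneg by blast+
  qed
  have mono_k: "strict_mono_on {1..m} k"
    unfolding strict_mono_on_def k_def
    by (intro allI impI strict_mono_onD[OF e(2)]) auto
  have mono_l: "strict_mono_on {1..m'} l" by (auto simp: strict_mono_on_def l_def)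
  have km: "k m = Max F"
  proof (rule Max_eqI[symmetric])
    show "k m \<in> F" using e(1) m by (auto simp: k_def bij_betw_def)
    fix y assume "y \<in> F"
    then obtain i where i: "i < m" "y = e i" using e(1) by (auto simp: bij_betw_def)
    then show "y \<le> k m"
      using strict_mono_on_leD[OF e(2), of i "m - 1"] by (auto simp: k_def)
  qed (use F in auto)
  have p1: "(\<Prod>i=1..m. g i ((T ^^ k i) x)) = incr u F x" for x
  proof -
    have "(\<Prod>i=1..m. g i ((T ^^ k i) x)) = (\<Prod>i\<in>{..<m}. cis (phase u (e i) x) - 1)"
      by (rule prod.reindex_bij_witness[of _ "\<lambda>i. i + 1" "\<lambda>i. i - 1"]) (auto simp: k_def g_def phase_def)
    also have "\<dots> = incr u F x"
      unfolding incr_def by (rule prod.reindex_bij_betw[OF e(1)])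
    finally show ?thesis .
  qed
  have p2: "(\<Prod>j=1..m'. g (m + j) ((T ^^ (s + l j)) x)) = osc u s n x" for x
    unfolding osc_def
    by (rule prod.reindex_bij_witness[of _ "\<lambda>j. j - s + 1" "\<lambda>j. s + (j - 1)"]) (auto simp: l_def g_def phase_def m'_def)
  have prodle: "(\<Prod>i\<in>S. sup_norm (g i)) \<le> 2 ^ m" if S: "S \<subseteq> {1..m+m'}" for S
  proof -
    have "(\<Prod>i\<in>S. sup_norm (g i)) \<le> (\<Prod>i\<in>S. if i \<le> m then 2 else 1)"
      by (intro prod_mono conjI g)
    also have "\<dots> \<le> (\<Prod>i\<in>{1..m+m'}. if i \<le> m then 2 else 1)"
      by (rule prod_mono2) (use S in auto)
    also have "\<dots> = 2 ^ m"
    proof -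
      have "{1..m+m'} \<inter> {i. i \<le> m} = {1..m}" by auto
      then show ?thesis by (simp add: prod.If_cases)
    qed
    finally show ?thesis .
  qed
  have poly_nn: "0 \<le> poly P (real i)" for i
    by (rule poly_mono_nonneg(2)[OF P_nonneg, of "real i" "real i"]) auto
  have prodnn: "0 \<le> (\<Prod>i\<in>S. sup_norm (g i))" for S by (intro prod_nonneg g)
  have "cmod (cov M (incr u F) (osc u s n)) \<le> ((\<Prod>i=1..m+m'. sup_norm (g i))
              + (\<Sum>i=1..m+m'. holder_const \<eta> (g i) * (\<Prod>j\<in>{1..m+m'} - {i}. sup_norm (g j))))
             * poly P (real (l m')) * \<delta> powr (real s - real R * real (k m))"
    using decorrelation[OF m _ mono_k mono_l, of g s] g(1) unfolding p1 p2 by simp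
  also have "\<dots> \<le> (2 ^ m + (\<Sum>i=1..m+m'. H * 2 ^ m)) * poly P (real N) * \<delta> ^ Q"
  proof (intro mult_mono add_mono sum_mono)
    show "(\<Prod>i=1..m+m'. sup_norm (g i)) \<le> 2 ^ m" by (rule prodle) simp
    show "holder_const \<eta> (g i) \<le> H" for i by (rule g)
    show "(\<Prod>j\<in>{1..m+m'} - {i}. sup_norm (g j)) \<le> 2 ^ m" for i by (rule prodle) auto
    show "poly P (real (l m')) \<le> poly P (real N)"
      by (rule poly_mono_nonneg) (use P_nonneg s in \<open>auto simp: l_def m'_def\<close>)
    have "real R * real (k m) + real Q \<le> real s"
      unfolding km using s(1) by (metis of_nat_add of_nat_le_iff of_nat_mult)
    then have "\<delta> powr (real s - real R * real (k m)) \<le> \<delta> powr real Q"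
      using \<delta> by (intro powr_mono') auto
    then show "\<delta> powr (real s - real R * real (k m)) \<le> \<delta> ^ Q" using \<delta> by (simp add: powr_realpow)
  qed (use prodnn H_nonneg \<delta> poly_nn in \<open>auto intro!: add_nonneg_nonneg sum_nonneg mult_nonneg_nonneg\<close>)
  also have "\<dots> = 2 ^ m * (1 + real (m + m') * H) * poly P (real N) * \<delta> ^ Q"
    by (simp add: algebra_simps)
  also have "\<dots> \<le> err K N Q"
    unfolding err_def
  proof (intro mult_right_mono mult_mono)
    show "(2::real) ^ m \<le> 2 ^ K" using F by (intro power_increasing) (auto simp: m_def)
    have "real (m + m') \<le> real K + real N" using F s by (simp add: m_def m'_def)
    then show "1 + real (m + m') * H \<le> 1 + (real K + real N) * H"
      using H_nonneg by (simp add: mult_right_mono)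
  qed (use H_nonneg \<delta> poly_nn in auto)
  finally have "cmod (cov M (incr u F) (osc u s n)) \<le> err K N Q" .
  then show ?thesis
    unfolding cov_def using s by (simp add: integral_osc)
qed

text \<open>
  Open the factors after the last increment up to time \<open>L (k + 1)\<close>. The gap is then long enough to split off
  \<open>hchar u (n - s)\<close>, because \<open>R * L k + Q \<le> L (k + 1)\<close>; this is why the levels grow geometrically. The opened
  factors contribute terms with one more increment whose last time is at most \<open>L (k + 1)\<close>, to which the
  same is applied. There are at most \<open>L K\<close> of them, and each has gained a factor \<open>a\<close>, so after \<open>j\<close> rounds the
  trivial bound leaves \<open>(L K)^j a^(card F + j)\<close>. Choosing \<open>a * L K\<close> small makes this negligible.
\<close>

lemma hierarchical_bound:
  fixes L :: "nat \<Rightarrow> nat"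
  assumes u: "norm u \<le> 1" and Q: "1 \<le> Q" and L: "\<And>k. L k = (R + 1) ^ k * Q"
    and n: "L K < n" "n \<le> N" and h: "\<And>s. s \<in> {1..L K} \<Longrightarrow> cmod (hchar u (n - s)) \<le> b"
  defines "a \<equiv> B * norm u"
  shows "finite F \<Longrightarrow> F \<noteq> {} \<Longrightarrow> Max F \<le> L k \<Longrightarrow> card F + j \<le> K \<Longrightarrow> k + j \<le> K \<Longrightarrow>
    cmod (\<integral>x. incr u F x * osc u (Suc (Max F)) n x \<partial>M) \<le>
      a ^ card F * (\<Sum>i<j. (a * L K) ^ i) * b + (\<Sum>i<j. real (L K) ^ i) * err K N Q + real (L K) ^ j * a ^ (card F + j)"
proof (induction j arbitrary: F k)
  case 0
  have "cmod (\<integral>x. incr u F x * osc u (Suc (Max F)) n x \<partial>M) \<le> a ^ card F"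
    unfolding a_def by (rule norm_integral_le[OF _ norm_incr_osc]) measurable
  then show ?case by simp
next
  case (Suc j)
  have a0: "0 \<le> a" using B_pos by (simp add: a_def)
  have Lmono: "L i \<le> L i'" if "i \<le> i'" for i i'
    unfolding L using that by (intro mult_right_mono power_increasing) auto
  \<comment> \<open>Factors are opened up to time \<open>s\<close>; after that the gap suffices for decorrelation.\<close>
  define s where "s = L (Suc k)"
  have Lk: "Q \<le> L k" unfolding L by simp
  have s_eq: "s = R * L k + L k" unfolding s_def L by (simp add: algebra_simps)
  have sK: "s \<le> L K" unfolding s_def using Suc.prems(5) by (intro Lmono) linarith
  have sQ: "R * Max F + Q \<le> s" unfolding s_eq by (intro add_mono mult_le_mono2 Lk Suc.prems(3))
  have sM: "Suc (Max F) \<le> s"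
  proof -
    have "1 * Max F + Q \<le> R * Max F + Q" by (intro add_mono mult_le_mono R_pos) auto
    then show ?thesis using sQ Q by linarith
  qed
  have s1: "s \<in> {1..L K}" using sM sK by auto
  have b0: "0 \<le> b" using h[OF s1] norm_ge_zero order_trans by blast
  have one: "cmod (\<integral>x. incr u F x * osc u s n x \<partial>M) \<le> a ^ card F * b + err K N Q"
  proof -
    have "cmod ((\<integral>x. incr u F x * osc u s n x \<partial>M) - (\<integral>x. incr u F x \<partial>M) * hchar u (n - s)) \<le> err K N Q"
      by (rule incr_osc_decorrelation) (use u Suc.prems(1,2,4) sQ sK n in auto)
    moreover have "cmod ((\<integral>x. incr u F x \<partial>M) * hchar u (n - s)) \<le> a ^ card F * b"
      unfolding norm_mult
      by (intro mult_mono h s1 norm_integral_le) (use norm_incr a0 in \<open>auto simp: a_def\<close>)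
    ultimately show ?thesis by (rule norm_le_add_diff)
  qed
  have tel: "(\<integral>x. incr u F x * osc u (Suc (Max F)) n x \<partial>M) =
     (\<integral>x. incr u F x * osc u s n x \<partial>M) + (\<Sum>q\<in>{Suc (Max F)..<s}. \<integral>x. incr u (insert q F) x * osc u (Suc q) n x \<partial>M)"
    by (rule telescope[OF sM]) (use sK n Suc.prems(1,2) in \<open>auto simp: less_Suc_eq_le\<close>)
  define X where "X = a ^ (card F + 1) * (\<Sum>i<j. (a * L K) ^ i) * b + (\<Sum>i<j. real (L K) ^ i) * err K N Q + real (L K) ^ j * a ^ (card F + 1 + j)"
  have X0: "0 \<le> X" unfolding X_def using a0 b0 err_nonneg by (intro add_nonneg_nonneg mult_nonneg_nonneg sum_nonneg) auto
  have each: "cmod (\<integral>x. incr u (insert q F) x * osc u (Suc q) n x \<partial>M) \<le> X" if q: "q \<in> {Suc (Max F)..<s}" for q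
  proof -
    have qF: "q \<notin> F"
    proof
      assume "q \<in> F"
      then have "q \<le> Max F" using Suc.prems(1) by simp
      then show False using q by simp
    qed
    have M: "Max (insert q F) = q" using q Suc.prems(1,2) by (simp add: Max_insert max_def)
    have "cmod (\<integral>x. incr u (insert q F) x * osc u (Suc (Max (insert q F))) n x \<partial>M) \<le>
      a ^ card (insert q F) * (\<Sum>i<j. (a * L K) ^ i) * b + (\<Sum>i<j. real (L K) ^ i) * err K N Q + real (L K) ^ j * a ^ (card (insert q F) + j)"
      by (rule Suc.IH[of "insert q F" "Suc k"]) (use Suc.prems(1,4,5) q qF in \<open>auto simp: M s_def\<close>)
    then show ?thesis using Suc.prems(1) qF unfolding X_def M by simp
  qed
  have "cmod (\<Sum>q\<in>{Suc (Max F)..<s}. \<integral>x. incr u (insert q F) x * osc u (Suc q) n x \<partial>M) \<le> (\<Sum>q\<in>{Suc (Max F)..<s}. X)"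
    by (rule order_trans[OF norm_sum sum_mono[OF each]])
  also have "\<dots> \<le> real (L K) * X" using sK X0 by (simp add: mult_right_mono)
  finally have "cmod (\<integral>x. incr u F x * osc u (Suc (Max F)) n x \<partial>M) \<le> a ^ card F * b + err K N Q + real (L K) * X"
    unfolding tel by (intro norm_triangle_le add_mono one)
  also have "\<dots> = a ^ card F * (\<Sum>i<Suc j. (a * L K) ^ i) * b + (\<Sum>i<Suc j. real (L K) ^ i) * err K N Q + real (L K) ^ Suc j * a ^ (card F + Suc j)"
    unfolding X_def sum.lessThan_Suc_shift by (simp add: algebra_simps sum_distrib_left sum_distrib_right)
  finally show ?case .
qed


text \<open>
  Bound for the part of \<open>hierarchical_bound\<close> that does not involve the values of \<open>hchar\<close> when all \<open>K\<close> levels are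
  used.
\<close>

definition trunc_err :: "nat \<Rightarrow> nat \<Rightarrow> nat \<Rightarrow> nat \<Rightarrow> real^'d \<Rightarrow> real" where
  "trunc_err K N Q L u = real K * real L ^ K * err K N Q + (B * norm u * real L) ^ K"

lemma trunc_err_nonneg: "0 \<le> trunc_err K N Q L u"
  unfolding trunc_err_def using err_nonneg B_pos by (intro add_nonneg_nonneg mult_nonneg_nonneg) auto

lemma incr_osc_bound:
  fixes L :: "nat \<Rightarrow> nat"
  assumes u: "norm u \<le> 1" and Q: "1 \<le> Q" and L: "\<And>k. L k = (R + 1) ^ k * Q"
    and n: "L K < n" "n \<le> N" and h: "\<And>s. s \<in> {1..L K} \<Longrightarrow> cmod (hchar u (n - s)) \<le> b"
    and small: "B * norm u * L K \<le> 1 / 2"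
    and F: "finite F" "F \<noteq> {}" "Max F \<le> L k" "card F \<le> K" "k \<le> card F"
  shows "cmod (\<integral>x. incr u F x * osc u (Suc (Max F)) n x \<partial>M) \<le> 2 * (B * norm u) ^ card F * b + trunc_err K N Q (L K) u"
proof -
  define a where "a = B * norm u"
  define j where "j = K - card F"
  have a0: "0 \<le> a" using B_pos by (simp add: a_def)
  have "1 * 1 \<le> (R + 1) ^ K * Q" using Q by (intro mult_le_mono) auto
  then have "1 \<le> L K" unfolding L[of K] by simp
  then have L1: "1 \<le> real (L K)" by linarith
  have "1 \<in> {1..L K}" using L1 by auto
  then have b0: "0 \<le> b" using h norm_ge_zero order_trans by blast
  have "cmod (\<integral>x. incr u F x * osc u (Suc (Max F)) n x \<partial>M) \<le>
      a ^ card F * (\<Sum>i<j. (a * L K) ^ i) * b + (\<Sum>i<j. real (L K) ^ i) * err K N Q + real (L K) ^ j * a ^ (card F + j)"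
    unfolding a_def by (rule hierarchical_bound[OF u Q L n h]) (use F in \<open>auto simp: j_def\<close>)
  also have "\<dots> \<le> a ^ card F * 2 * b + (real K * real (L K) ^ K) * err K N Q + (a * real (L K)) ^ K"
  proof (intro add_mono mult_right_mono mult_left_mono)
    have "(\<Sum>i<j. (a * L K) ^ i) \<le> (\<Sum>i<j. (1 / 2) ^ i)"
      using small a0 by (intro sum_mono power_mono) (auto simp: a_def)
    also have "\<dots> \<le> (\<Sum>i. (1 / 2 :: real) ^ i)"
      by (rule sum_le_suminf) (auto intro: summable_geometric)
    also have "\<dots> = 2" by (simp add: suminf_geometric)
    finally show "(\<Sum>i<j. (a * L K) ^ i) \<le> 2" .
    have "(\<Sum>i<j. real (L K) ^ i) \<le> (\<Sum>i<j. real (L K) ^ K)"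
      using L1 by (intro sum_mono power_increasing) (auto simp: j_def)
    also have "\<dots> \<le> real K * real (L K) ^ K"
      by (simp add: j_def mult_right_mono)
    finally show "(\<Sum>i<j. real (L K) ^ i) \<le> real K * real (L K) ^ K" .
    have "card F + j = K" using F by (simp add: j_def)
    then have "real (L K) ^ j * a ^ (card F + j) = real (L K) ^ j * a ^ K" by simp
    also have "\<dots> \<le> real (L K) ^ K * a ^ K"
      using L1 a0 by (intro mult_right_mono power_increasing) (auto simp: j_def)
    finally show "real (L K) ^ j * a ^ (card F + j) \<le> (a * real (L K)) ^ K" by (simp add: power_mult_distrib mult.commute)
  qed (use a0 b0 err_nonneg in auto)
  finally show ?thesis by (simp add: trunc_err_def a_def mult.commute mult.left_commute)
qed

section \<open>The recurrence for the characteristic function\<close>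

text \<open>
  Correlation of \<open>u.f\<close> with \<open>v.f\<close> at time distance \<open>k\<close>.
\<close>

definition bicorr :: "real^'d \<Rightarrow> real^'d \<Rightarrow> nat \<Rightarrow> real" where
  "bicorr u v k = (\<integral>x. phase u 0 x * phase v k x \<partial>M)"

lemma integral_phase: "(\<integral>x. phase u k x \<partial>M) = 0"
proof -
  have "(\<integral>x. phase u k x \<partial>M) = (\<integral>x. u \<bullet> f x \<partial>M)"
    unfolding phase_def by (rule integral_iter) measurable
  also have "\<dots> = u \<bullet> (\<integral>x. f x \<partial>M)"
    by (rule integral_inner_right) (use integrable_bounded[OF f_meas f_bound] in simp)
  finally show ?thesis using f_centered by simp
qed

definition corr_const :: real where
  "corr_const = (B * B + H * B + H * B) * poly P 0"

lemma corr_const_nonneg: "0 \<le> corr_const"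
  unfolding corr_const_def using B_pos H_nonneg poly_mono_nonneg(2)[OF P_nonneg, of 0 0] by simp

text \<open>
  The decorrelation property with one factor in the past and one in the future; the observable is centered, so the
  covariance is the correlation.
\<close>

lemma bicorr_bound: "\<bar>bicorr u v k\<bar> \<le> norm u * norm v * corr_const * \<delta> ^ k"
proof -
  define w where "w i = (if i = (1::nat) then u else v)" for i
  define g where "g i x = complex_of_real (w i \<bullet> f x)" for i x
  have g: "bounded_holder \<eta> (g i)" "0 \<le> sup_norm (g i)" "sup_norm (g i) \<le> norm (w i) * B"
    "holder_const \<eta> (g i) \<le> norm (w i) * H" for i
  proof -
    have "cmod (g i x) \<le> norm (w i) * B" for x
    proof -
      have "cmod (g i x) \<le> norm (w i) * norm (f x)" unfolding g_def norm_of_real by (rule Cauchy_Schwarz_ineq2)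
      also have "\<dots> \<le> norm (w i) * B" by (intro mult_left_mono f_bound) simp
      finally show ?thesis .
    qed
    moreover have "cmod (g i x - g i y) \<le> (norm (w i) * H) * dist x y powr \<eta>" for x y
    proof -
      have "cmod (g i x - g i y) = \<bar>w i \<bullet> (f x - f y)\<bar>"
        unfolding g_def of_real_diff[symmetric] norm_of_real by (simp add: inner_diff_right)
      also have "\<dots> \<le> norm (w i) * norm (f x - f y)" by (rule Cauchy_Schwarz_ineq2)
      also have "\<dots> \<le> norm (w i) * (H * dist x y powr \<eta>)" by (intro mult_left_mono f_holder) simp
      finally show ?thesis by simp
    qed
    ultimately show "bounded_holder \<eta> (g i)" "0 \<le> sup_norm (g i)" "sup_norm (g i) \<le> norm (w i) * B"
      "holder_const \<eta> (g i) \<le> norm (w i) * H"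
      using holder_data[OF \<eta>_pos, of "g i" "norm (w i) * B" "norm (w i) * H"] H_nonneg by simp_all
  qed
  have e: "(\<Prod>i=1..1+1. F i) = F 1 * F 2" "(\<Sum>i=1..1+1. F i) = F 1 + F 2"
    "(\<Prod>j\<in>{1..1+1} - {1}. F j) = F 2" "(\<Prod>j\<in>{1..1+1} - {2}. F j) = F 1" for F :: "nat \<Rightarrow> real"
  proof -
    have "{1..1 + 1} - {1} = {2::nat}" "{1..1 + 1} - {2} = {1::nat}" by auto
    then show "(\<Prod>i=1..1+1. F i) = F 1 * F 2" "(\<Sum>i=1..1+1. F i) = F 1 + F 2"
      "(\<Prod>j\<in>{1..1+1} - {1}. F j) = F 2" "(\<Prod>j\<in>{1..1+1} - {2}. F j) = F 1"
      by (simp_all add: numeral_2_eq_2)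
  qed
  have "cmod (cov M (\<lambda>x. \<Prod>i=1..1. g i ((T ^^ 0) x)) (\<lambda>x. \<Prod>j=1..1. g (1 + j) ((T ^^ (k + (j - 1))) x)))
     \<le> ((\<Prod>i=1..1+1. sup_norm (g i)) + (\<Sum>i=1..1+1. holder_const \<eta> (g i) * (\<Prod>j\<in>{1..1+1} - {i}. sup_norm (g j))))
       * poly P (real (1 - 1)) * \<delta> powr (real k - real R * real 0)"
    by (rule decorrelation[where k="\<lambda>_. 0" and l="\<lambda>j. j - 1" and m=1 and m'=1 and g=g and n=k])
       (auto simp: g strict_mono_on_def)
  then have "cmod (cov M (g 1) (\<lambda>x. g 2 ((T ^^ k) x))) \<le>
    (sup_norm (g 1) * sup_norm (g 2) + (holder_const \<eta> (g 1) * sup_norm (g 2) + holder_const \<eta> (g 2) * sup_norm (g 1))) * poly P 0 * \<delta> powr (real k)"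
    unfolding e by (simp add: numeral_2_eq_2)
  also have "\<dots> \<le> ((norm u * B) * (norm v * B) + ((norm u * H) * (norm v * B) + (norm v * H) * (norm u * B))) * poly P 0 * \<delta> powr (real k)"
    by (intro mult_right_mono add_mono mult_mono order_trans[OF g(3)] order_trans[OF g(4)] g)
       (use B_pos H_nonneg poly_mono_nonneg(2)[OF P_nonneg, of 0 0] in \<open>auto simp: w_def\<close>)
  also have "\<dots> = norm u * norm v * corr_const * \<delta> ^ k"
    using \<delta> by (simp add: corr_const_def powr_realpow algebra_simps)
  also have "cov M (g 1) (\<lambda>x. g 2 ((T ^^ k) x)) = of_real (bicorr u v k)"
  proof -
    have "(\<integral>x. g 1 x \<partial>M) = of_real (\<integral>x. phase u 0 x \<partial>M)"
      unfolding g_def by (simp add: w_def phase_def)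
    moreover have "(\<integral>x. g 1 x * g 2 ((T ^^ k) x) \<partial>M) = of_real (bicorr u v k)"
      unfolding g_def bicorr_def by (simp add: w_def phase_def flip: of_real_mult)
    ultimately show ?thesis unfolding cov_def by (simp add: integral_phase)
  qed
  finally show ?thesis by simp
qed

text \<open>
  The asymptotic variance of \<open>u.S_n\<close>. That it is \<open>u.D u\<close> is shown in \<open>asymp_cov_form\<close>.
\<close>

definition sigma2 :: "real^'d \<Rightarrow> real" where
  "sigma2 u = bicorr u u 0 + 2 * (\<Sum>k. bicorr u u (Suc k))"

lemma summable_bicorr: "summable (\<lambda>k. bicorr u v (k + m))"
proof (rule summable_comparison_test')
  show "summable (\<lambda>k. norm u * norm v * corr_const * \<delta> ^ m * \<delta> ^ k)"
    by (intro summable_mult summable_geometric) (use \<delta> in auto)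
  show "norm (bicorr u v (k + m)) \<le> norm u * norm v * corr_const * \<delta> ^ m * \<delta> ^ k" for k
    using bicorr_bound[of u v "k + m"] by (simp add: power_add mult_ac)
qed

lemma bicorr_tail: "\<bar>\<Sum>k. bicorr u v (k + m)\<bar> \<le> norm u * norm v * corr_const * \<delta> ^ m / (1 - \<delta>)"
proof -
  have s: "summable (\<lambda>k. norm u * norm v * corr_const * \<delta> ^ m * \<delta> ^ k)"
    by (intro summable_mult summable_geometric) (use \<delta> in auto)
  have "norm (\<Sum>k. bicorr u v (k + m)) \<le> (\<Sum>k. norm u * norm v * corr_const * \<delta> ^ m * \<delta> ^ k)"
  proof (rule norm_suminf_le[OF _ s])
    show "norm (bicorr u v (k + m)) \<le> norm u * norm v * corr_const * \<delta> ^ m * \<delta> ^ k" for k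
      using bicorr_bound[of u v "k + m"] by (simp add: power_add mult_ac)
  qed
  also have "\<dots> = norm u * norm v * corr_const * \<delta> ^ m * (\<Sum>k. \<delta> ^ k)"
    by (rule suminf_mult) (use \<delta> in \<open>auto intro: summable_geometric\<close>)
  also have "\<dots> = norm u * norm v * corr_const * \<delta> ^ m / (1 - \<delta>)"
    using \<delta> by (simp add: suminf_geometric)
  finally show ?thesis by simp
qed

text \<open>
  Second order expansion of \<open>exp(i a) - 1\<close>; the linear term has mean zero. This is what makes a single increment
  contribute at order \<open>norm u ^ 2\<close>.
\<close>

lemma incr_single:
  defines "a u \<equiv> B * norm u"
  shows "cmod (\<integral>x. incr u {0} x \<partial>M) \<le> a u ^ 2"
    and "cmod ((\<integral>x. incr u {0} x \<partial>M) + bicorr u u 0 / 2) \<le> a u ^ 3"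
proof -
  have ph: "integrable M (\<lambda>x. \<i> * complex_of_real (phase u 0 x))"
    by (intro integrable_mult_right integrable_of_real integrable_bounded[where c="a u"])
       (use phase_bound in \<open>auto simp: a_def\<close>)
  have ph0: "(\<integral>x. \<i> * complex_of_real (phase u 0 x) \<partial>M) = 0"
    by (simp add: integral_phase)
  have i: "integrable M (incr u {0})" using norm_incr by (intro integrable_bounded) auto
  have sq: "integrable M (\<lambda>x. complex_of_real ((phase u 0 x)\<^sup>2 / 2))"
  proof (intro integrable_of_real integrable_bounded)
    show "norm ((phase u 0 x)\<^sup>2 / 2) \<le> (a u)\<^sup>2" for x
    proof -
      have "(phase u 0 x)\<^sup>2 \<le> (a u)\<^sup>2"
        using power_mono[OF phase_bound[of u 0 x] abs_ge_zero, of 2] by (simp add: a_def)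
      moreover have "norm ((phase u 0 x)\<^sup>2 / 2) = (phase u 0 x)\<^sup>2 / 2" "0 \<le> (phase u 0 x)\<^sup>2" by simp_all
      ultimately show ?thesis by linarith
    qed
  qed measurable
  have ab: "\<bar>phase u k x\<bar> ^ m \<le> a u ^ m" for k m x
    unfolding a_def by (intro power_mono phase_bound) simp
  have "(\<integral>x. incr u {0} x \<partial>M) = (\<integral>x. incr u {0} x - \<i> * complex_of_real (phase u 0 x) \<partial>M)"
    using ph ph0 i by simp
  also have "cmod \<dots> \<le> a u ^ 2"
  proof (rule norm_integral_le)
    show "cmod (incr u {0} x - \<i> * complex_of_real (phase u 0 x)) \<le> a u ^ 2" for x
      using norm_cis_approx1[of "phase u 0 x"] ab[of 0 x 2] by (simp add: incr_def)
  qed measurable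
  finally show "cmod (\<integral>x. incr u {0} x \<partial>M) \<le> a u ^ 2" .
  have "(\<integral>x. complex_of_real ((phase u 0 x)\<^sup>2 / 2) \<partial>M) = bicorr u u 0 / 2"
    unfolding bicorr_def integral_complex_of_real by (simp add: power2_eq_square)
  then have "(\<integral>x. incr u {0} x \<partial>M) + bicorr u u 0 / 2 =
    (\<integral>x. incr u {0} x - \<i> * complex_of_real (phase u 0 x) + complex_of_real ((phase u 0 x)\<^sup>2 / 2) \<partial>M)"
    using ph ph0 i sq by simp
  also have "cmod \<dots> \<le> a u ^ 3"
  proof (rule norm_integral_le)
    show "cmod (incr u {0} x - \<i> * complex_of_real (phase u 0 x) + complex_of_real ((phase u 0 x)\<^sup>2 / 2)) \<le> a u ^ 3" for x
      using norm_cis_approx2[of "phase u 0 x"] ab[of 0 x 3] by (simp add: incr_def)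
  qed measurable
  finally show "cmod ((\<integral>x. incr u {0} x \<partial>M) + bicorr u u 0 / 2) \<le> a u ^ 3" .
qed

lemma norm_cis_product_approx:
  assumes "\<bar>s\<bar> \<le> c" "\<bar>t\<bar> \<le> c"
  shows "cmod ((cis s - 1) * (cis t - 1) + s * t) \<le> 2 * c ^ 3"
proof -
  have c: "0 \<le> c" using assms by linarith
  have "(cis s - 1) * (cis t - 1) + s * t =
    \<i> * s * (cis t - 1 - \<i> * t) + (cis s - 1 - \<i> * s) * (cis t - 1)"
    by (simp add: algebra_simps)
  also have "cmod \<dots> \<le> \<bar>s\<bar> * t\<^sup>2 + s\<^sup>2 * \<bar>t\<bar>"
    by (intro norm_triangle_le add_mono)
       (auto simp: norm_mult intro!: mult_mono norm_cis_approx1 norm_cis_minus_1)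
  also have "\<dots> \<le> c * c\<^sup>2 + c\<^sup>2 * c"
    using assms c abs_le_square_iff[of s c] abs_le_square_iff[of t c] by (intro add_mono mult_mono) auto
  finally show ?thesis by (simp add: power2_eq_square power3_eq_cube)
qed

lemma incr_pair:
  assumes q: "1 \<le> q"
  shows "cmod ((\<integral>x. incr u {q, 0} x \<partial>M) + bicorr u u q) \<le> 2 * (B * norm u) ^ 3"
proof -
  have i: "integrable M (incr u {q, 0})" using norm_incr by (intro integrable_bounded) auto
  have pp: "cmod (complex_of_real (phase u 0 x * phase u q x)) \<le> B * norm u * (B * norm u)" for x
    unfolding norm_of_real abs_mult by (intro mult_mono phase_bound) (use B_pos in auto)
  have sq: "integrable M (\<lambda>x. complex_of_real (phase u 0 x * phase u q x))"
    by (rule integrable_bounded[OF _ pp]) measurable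
  have "(\<integral>x. incr u {q, 0} x \<partial>M) + bicorr u u q =
    (\<integral>x. incr u {q, 0} x + complex_of_real (phase u 0 x * phase u q x) \<partial>M)"
    using i sq unfolding bicorr_def integral_complex_of_real[symmetric] by (simp only: Bochner_Integration.integral_add)
  also have "cmod \<dots> \<le> 2 * (B * norm u) ^ 3"
  proof (rule norm_integral_le)
    show "cmod (incr u {q, 0} x + complex_of_real (phase u 0 x * phase u q x)) \<le> 2 * (B * norm u) ^ 3" for x
      using norm_cis_product_approx[OF phase_bound[of u q x] phase_bound[of u 0 x]] q
      by (simp add: incr_def mult.commute)
  qed measurable
  finally show ?thesis .
qed

text \<open>
  The first factor is opened. The resulting bound is of order \<open>norm u\<close> only, which suffices where it is multiplied by
  a coefficient of order \<open>norm u ^ 2\<close>.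
\<close>

lemma hchar_increment:
  fixes L :: "nat \<Rightarrow> nat"
  assumes u: "norm u \<le> 1" and Q: "1 \<le> Q" and K: "1 \<le> K" and L: "\<And>k. L k = (R + 1) ^ k * Q"
    and n: "L K < n" "n \<le> N" and h: "\<And>s. s \<in> {1..L K} \<Longrightarrow> cmod (hchar u (n - s)) \<le> b"
    and small: "B * norm u * L K \<le> 1 / 2"
  shows "hchar u n = hchar u (n - 1) + (\<integral>x. incr u {0} x * osc u 1 n x \<partial>M)"
    and "cmod (hchar u n - hchar u (n - 1)) \<le> 2 * (B * norm u) * b + trunc_err K N Q (L K) u"
proof -
  have "(\<integral>x. incr u {} x * osc u 0 n x \<partial>M) =
    (\<integral>x. incr u {} x * osc u 1 n x \<partial>M) + (\<Sum>q\<in>{0..<1}. \<integral>x. incr u (insert q {}) x * osc u (Suc q) n x \<partial>M)"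
    by (rule telescope) (use n in auto)
  then show eq: "hchar u n = hchar u (n - 1) + (\<integral>x. incr u {0} x * osc u 1 n x \<partial>M)"
    using integral_osc[of 1 n u] n by (simp add: incr_def hchar_def)
  have "cmod (\<integral>x. incr u {0} x * osc u (Suc (Max {0})) n x \<partial>M) \<le> 2 * (B * norm u) ^ card {0::nat} * b + trunc_err K N Q (L K) u"
    by (rule incr_osc_bound[OF u Q L n h small, where k=0]) (use K in auto)
  then show "cmod (hchar u n - hchar u (n - 1)) \<le> 2 * (B * norm u) * b + trunc_err K N Q (L K) u"
    unfolding eq by simp
qed

definition total_err :: "nat \<Rightarrow> nat \<Rightarrow> nat \<Rightarrow> nat \<Rightarrow> real^'d \<Rightarrow> real" where
  "total_err K N Q L u = real L * err K N Q + 2 * real L ^ 2 * trunc_err K N Q L u + corr_const * \<delta> ^ Q / (1 - \<delta>)"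

text \<open>
  Open the factor at time \<open>0\<close>, then those before time \<open>Q\<close>, then those before time \<open>L 1\<close>. Up to decorrelation errors,
  \<open>hchar u n - hchar u (n - 1)\<close> equals \<open>c0 hchar u (n - Q) + (\<Sum>q. c q hchar u (n - L 1))\<close> plus
  terms with three increments, which are \<open>O((B norm u)^3 (L K)\<^sup>2)\<close> by \<open>incr_osc_bound\<close>. The arguments \<open>n - Q\<close> and
  \<open>n - L 1\<close> may be replaced by \<open>n - 1\<close> at the price of another term of third order, and \<open>c0 + (\<Sum>q. c q)\<close> is
  \<open>- sigma2 u / 2\<close> up to third order and the tail of the correlation series. This needs a window of twice the
  length \<open>L K\<close>, because the replacement uses \<open>incr_osc_bound\<close> at times down to \<open>n - L K\<close>.
\<close>

proposition hchar_recurrence: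
  fixes L :: "nat \<Rightarrow> nat"
  assumes u: "norm u \<le> 1" and Q: "1 \<le> Q" and K: "3 \<le> K" and L: "\<And>k. L k = (R + 1) ^ k * Q"
    and n: "2 * L K < n" "n \<le> N" and h: "\<And>s. s \<in> {1..2 * L K} \<Longrightarrow> cmod (hchar u (n - s)) \<le> b"
    and small: "B * norm u * L K \<le> 1 / 2"
  shows "cmod (hchar u n - (1 - sigma2 u / 2) * hchar u (n - 1))
    \<le> 6 * real (L K) ^ 2 * (B * norm u) ^ 3 * b + total_err K N Q (L K) u"
proof -
  define a where "a = B * norm u"
  define E where "E = trunc_err K N Q (L K) u"
  define l where "l = real (L K)"
  have a0: "0 \<le> a" using B_pos by (simp add: a_def)
  have L1: "1 \<le> L K" unfolding L using Q by simp
  have l1: "1 \<le> l" using L1 by (simp add: l_def)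
  have a1: "a \<le> 1"
  proof -
    have "a * 1 \<le> a * l" using a0 l1 by (intro mult_left_mono) auto
    then show ?thesis using small by (simp add: a_def l_def)
  qed
  have E0: "0 \<le> E" unfolding E_def by (rule trunc_err_nonneg)
  have "1 \<in> {1..2 * L K}" using L1 by auto
  then have b0: "0 \<le> b" and h1: "cmod (hchar u (n - 1)) \<le> b" using h norm_ge_zero order_trans by blast+
  have Lmono: "L i \<le> L i'" if "i \<le> i'" for i i'
    unfolding L using that by (intro mult_right_mono power_increasing) auto
  have LQ: "Q \<le> L 1" "R * q + Q \<le> L 1" if "q < Q" for q
  proof -
    have "R * q + Q \<le> R * Q + Q" using that by simp
    then show "R * q + Q \<le> L 1" "Q \<le> L 1" by (simp_all add: L)
  qed
  have LK: "L 1 \<le> L K" using K by (intro Lmono) simp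
  have QK: "Q \<le> L K" using LQ(1)[of 0] LK Q by simp
  define c where "c q = (\<integral>x. incr u {q, 0} x \<partial>M)" for q
  define c0 where "c0 = (\<integral>x. incr u {0} x \<partial>M)"
  have c0_le: "cmod c0 \<le> a ^ 2" unfolding c0_def a_def by (rule incr_single)
  have c_le: "cmod (c q) \<le> a ^ 2" if "1 \<le> q" for q
  proof -
    have "card {q, 0} = 2" using that by auto
    then have "cmod (incr u {q, 0} x) \<le> a ^ 2" for x using norm_incr[of u "{q, 0}" x] by (simp only: a_def)
    then show ?thesis unfolding c_def by (intro norm_integral_le) auto
  qed
  \<comment> \<open>Opening the factors at time \<open>0\<close>, before \<open>Q\<close> and before \<open>L 1\<close>.\<close>
  have h': "cmod (hchar u (n - s)) \<le> b" if "s \<in> {1..L K}" for s using h that by auto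
  have n': "L K < n" using n by simp
  have step1: "hchar u n = hchar u (n - 1) + (\<integral>x. incr u {0} x * osc u 1 n x \<partial>M)"
    by (rule hchar_increment(1)[OF u Q _ L n' n(2) h' small]) (use K in auto)
  have step2: "(\<integral>x. incr u {0} x * osc u 1 n x \<partial>M) =
    (\<integral>x. incr u {0} x * osc u Q n x \<partial>M) + (\<Sum>q\<in>{1..<Q}. \<integral>x. incr u {q, 0} x * osc u (Suc q) n x \<partial>M)"
    by (rule telescope) (use Q QK n' in auto)
  have d0: "cmod ((\<integral>x. incr u {0} x * osc u Q n x \<partial>M) - c0 * hchar u (n - Q)) \<le> err K N Q"
    unfolding c0_def by (rule incr_osc_decorrelation[OF u]) (use K QK n in auto)
  have third: "cmod (\<integral>x. incr u {p, q, 0} x * osc u (Suc p) n x \<partial>M) \<le> 2 * a ^ 3 * b + E"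
    if "1 \<le> q" "q < p" "p < L 1" for p q
  proof -
    have M: "Max {p, q, 0} = p" and cd: "card {p, q, 0} = 3" using that by auto
    have "cmod (\<integral>x. incr u {p, q, 0} x * osc u (Suc (Max {p, q, 0})) n x \<partial>M) \<le> 2 * (B * norm u) ^ card {p, q, 0} * b + trunc_err K N Q (L K) u"
      by (rule incr_osc_bound[OF u Q L n' n(2) h' small, where k=1]) (use K that M cd in auto)
    then show ?thesis unfolding M cd a_def E_def .
  qed
  have dq: "cmod ((\<integral>x. incr u {q, 0} x * osc u (Suc q) n x \<partial>M) - c q * hchar u (n - L 1)) \<le> err K N Q + l * (2 * a ^ 3 * b + E)"
    if q: "q \<in> {1..<Q}" for q
  proof -
    have t: "(\<integral>x. incr u {q, 0} x * osc u (Suc q) n x \<partial>M) =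
      (\<integral>x. incr u {q, 0} x * osc u (L 1) n x \<partial>M) + (\<Sum>p\<in>{Suc q..<L 1}. \<integral>x. incr u {p, q, 0} x * osc u (Suc p) n x \<partial>M)"
      by (rule telescope) (use q LQ[of q] LK n' in auto)
    have M: "Max {q, 0} = q" and cd: "card {q, 0} = 2" using q by auto
    have d: "cmod ((\<integral>x. incr u {q, 0} x * osc u (L 1) n x \<partial>M) - c q * hchar u (n - L 1)) \<le> err K N Q"
      unfolding c_def by (rule incr_osc_decorrelation[OF u]) (use K LQ[of q] LK n q M cd in auto)
    have "cmod (\<Sum>p\<in>{Suc q..<L 1}. \<integral>x. incr u {p, q, 0} x * osc u (Suc p) n x \<partial>M) \<le> (\<Sum>p\<in>{Suc q..<L 1}. 2 * a ^ 3 * b + E)"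
      by (rule order_trans[OF norm_sum sum_mono[OF third]]) (use q in auto)
    also have "\<dots> \<le> l * (2 * a ^ 3 * b + E)"
      using LK a0 b0 E0 by (simp add: l_def mult_right_mono)
    finally have "cmod (((\<integral>x. incr u {q, 0} x * osc u (L 1) n x \<partial>M) - c q * hchar u (n - L 1))
      + (\<Sum>p\<in>{Suc q..<L 1}. \<integral>x. incr u {p, q, 0} x * osc u (Suc p) n x \<partial>M)) \<le> err K N Q + l * (2 * a ^ 3 * b + E)"
      by (intro norm_triangle_mono d)
    then show ?thesis unfolding t by (simp only: add_diff_eq diff_add_eq)
  qed
  \<comment> \<open>Moving the argument of \<open>hchar\<close> to \<open>n - 1\<close> costs one first-order increment per step.\<close>
  have inc: "cmod (hchar u (n - i) - hchar u (n - 1)) \<le> real i * (2 * a * b + E)" if "1 \<le> i" "i \<le> L K" for i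
    using that
  proof (induction i rule: dec_induct)
    case base
    then show ?case using a0 b0 E0 by simp
  next
    case (step i)
    have "cmod (hchar u (n - i) - hchar u (n - i - 1)) \<le> 2 * (B * norm u) * b + trunc_err K N Q (L K) u"
    proof (rule hchar_increment(2)[OF u Q _ L _ _ _ small])
      show "cmod (hchar u (n - i - s)) \<le> b" if "s \<in> {1..L K}" for s
        using h[of "i + s"] that step by auto
    qed (use n step K in auto)
    then have "cmod (hchar u (n - Suc i) - hchar u (n - i)) \<le> 2 * a * b + E"
      by (simp add: norm_minus_commute a_def E_def)
    moreover have "cmod (hchar u (n - i) - hchar u (n - 1)) \<le> real i * (2 * a * b + E)" using step by simp
    ultimately have "cmod ((hchar u (n - Suc i) - hchar u (n - i)) + (hchar u (n - i) - hchar u (n - 1))) \<le> (2 * a * b + E) + real i * (2 * a * b + E)"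
      by (rule norm_triangle_mono)
    then show ?case by (simp add: algebra_simps)
  qed
  define G where "G = l * (2 * a * b + E)"
  have G0: "0 \<le> G" unfolding G_def using l1 a0 b0 E0 by simp
  have inc': "cmod (hchar u (n - i) - hchar u (n - 1)) \<le> G" if "1 \<le> i" "i \<le> L K" for i
  proof -
    have "real i * (2 * a * b + E) \<le> l * (2 * a * b + E)"
      using that a0 b0 E0 by (intro mult_right_mono) (auto simp: l_def)
    then show ?thesis using inc[OF that] unfolding G_def by simp
  qed
  \<comment> \<open>The coefficients add up to the truncated correlation series, up to third order.\<close>
  have coef: "cmod (c0 + (\<Sum>q\<in>{1..<Q}. c q) + sigma2 u / 2) \<le> 2 * real Q * a ^ 3 + corr_const * \<delta> ^ Q / (1 - \<delta>)"
  proof -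
    have "(\<Sum>k. bicorr u u (Suc k)) = (\<Sum>k. bicorr u u (Suc k + (Q - 1))) + (\<Sum>k<Q - 1. bicorr u u (Suc k))"
      using suminf_split_initial_segment[of "\<lambda>k. bicorr u u (Suc k)" "Q - 1"] summable_bicorr[of u u 1] by simp
    also have "(\<Sum>k<Q - 1. bicorr u u (Suc k)) = (\<Sum>q\<in>{1..<Q}. bicorr u u q)"
      by (rule sum.reindex_bij_witness[of _ "\<lambda>q. q - 1" Suc]) auto
    also have "(\<Sum>k. bicorr u u (Suc k + (Q - 1))) = (\<Sum>k. bicorr u u (k + Q))"
      using Q by simp
    finally have s: "sigma2 u / 2 = bicorr u u 0 / 2 + (\<Sum>q\<in>{1..<Q}. bicorr u u q) + (\<Sum>k. bicorr u u (k + Q))"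
      by (simp add: sigma2_def)
    have "c0 + (\<Sum>q\<in>{1..<Q}. c q) + sigma2 u / 2 =
      (c0 + bicorr u u 0 / 2) + (\<Sum>q\<in>{1..<Q}. c q + bicorr u u q) + of_real (\<Sum>k. bicorr u u (k + Q))"
      by (subst s) (simp add: sum.distrib)
    also have "cmod \<dots> \<le> a ^ 3 + (\<Sum>q\<in>{1..<Q}. 2 * a ^ 3) + corr_const * \<delta> ^ Q / (1 - \<delta>)"
    proof (rule norm_triangle_mono, rule norm_triangle_mono)
      show "cmod (c0 + bicorr u u 0 / 2) \<le> a ^ 3" unfolding c0_def a_def using incr_single(2)[of u] by simp
      show "cmod (\<Sum>q\<in>{1..<Q}. c q + bicorr u u q) \<le> (\<Sum>q\<in>{1..<Q}. 2 * a ^ 3)"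
        by (rule order_trans[OF norm_sum sum_mono]) (use incr_pair[of _ u] in \<open>auto simp: c_def a_def\<close>)
      have "norm u * norm u * corr_const * \<delta> ^ Q / (1 - \<delta>) \<le> 1 * 1 * corr_const * \<delta> ^ Q / (1 - \<delta>)"
        using u corr_const_nonneg \<delta> by (intro divide_right_mono mult_right_mono mult_mono) auto
      then show "cmod (complex_of_real (\<Sum>k. bicorr u u (k + Q))) \<le> corr_const * \<delta> ^ Q / (1 - \<delta>)"
        using bicorr_tail[of u u Q] by simp
    qed
    also have "a ^ 3 + (\<Sum>q\<in>{1..<Q}. 2 * a ^ 3) \<le> 2 * real Q * a ^ 3"
      using Q a0 by (simp add: of_nat_diff algebra_simps)
    finally show ?thesis by simp
  qed
  define X0 where "X0 = (\<integral>x. incr u {0} x * osc u Q n x \<partial>M) - c0 * hchar u (n - Q)"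
  define X where "X q = (\<integral>x. incr u {q, 0} x * osc u (Suc q) n x \<partial>M) - c q * hchar u (n - L 1)" for q
  have dec: "hchar u n - (1 - sigma2 u / 2) * hchar u (n - 1) =
      (X0 + c0 * (hchar u (n - Q) - hchar u (n - 1)))
    + (\<Sum>q\<in>{1..<Q}. X q + c q * (hchar u (n - L 1) - hchar u (n - 1)))
    + (c0 + (\<Sum>q\<in>{1..<Q}. c q) + sigma2 u / 2) * hchar u (n - 1)"
    unfolding step1 step2 X0_def X_def
    by (simp add: algebra_simps sum.distrib sum_subtractf sum_distrib_left sum_distrib_right)
  have each0: "cmod (X0 + c0 * (hchar u (n - Q) - hchar u (n - 1))) \<le> err K N Q + l * (2 * a ^ 3 * b + E) + a ^ 2 * G"
  proof (intro norm_triangle_le add_mono)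
    have "0 \<le> l * (2 * a ^ 3 * b + E)" using l1 a0 b0 E0 by simp
    then show "cmod X0 \<le> err K N Q + l * (2 * a ^ 3 * b + E)" using d0 unfolding X0_def by linarith
    show "cmod (c0 * (hchar u (n - Q) - hchar u (n - 1))) \<le> a ^ 2 * G"
      unfolding norm_mult by (intro mult_mono c0_le inc') (use Q QK a0 in auto)
  qed
  have each: "cmod (X q + c q * (hchar u (n - L 1) - hchar u (n - 1))) \<le> err K N Q + l * (2 * a ^ 3 * b + E) + a ^ 2 * G"
    if "q \<in> {1..<Q}" for q
  proof (intro norm_triangle_le add_mono)
    show "cmod (X q) \<le> err K N Q + l * (2 * a ^ 3 * b + E)" using dq[OF that] unfolding X_def .
    show "cmod (c q * (hchar u (n - L 1) - hchar u (n - 1))) \<le> a ^ 2 * G"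
      unfolding norm_mult by (intro mult_mono c_le inc') (use that LQ[of q] LK Q a0 in auto)
  qed
  have last: "cmod ((c0 + (\<Sum>q\<in>{1..<Q}. c q) + sigma2 u / 2) * hchar u (n - 1)) \<le> 2 * real Q * a ^ 3 * b + corr_const * \<delta> ^ Q / (1 - \<delta>)"
  proof -
    have "cmod ((c0 + (\<Sum>q\<in>{1..<Q}. c q) + sigma2 u / 2) * hchar u (n - 1)) \<le> (2 * real Q * a ^ 3 + corr_const * \<delta> ^ Q / (1 - \<delta>)) * cmod (hchar u (n - 1))"
      unfolding norm_mult by (rule mult_right_mono[OF coef]) simp
    also have "\<dots> = 2 * real Q * a ^ 3 * cmod (hchar u (n - 1)) + corr_const * \<delta> ^ Q / (1 - \<delta>) * cmod (hchar u (n - 1))"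
      by (simp add: algebra_simps)
    also have "\<dots> \<le> 2 * real Q * a ^ 3 * b + corr_const * \<delta> ^ Q / (1 - \<delta>) * 1"
      by (intro add_mono mult_left_mono h1 norm_hchar_le) (use a0 corr_const_nonneg \<delta> in auto)
    finally show ?thesis by simp
  qed
  define Y where "Y = err K N Q + l * (2 * a ^ 3 * b + E) + a ^ 2 * G"
  have Y0: "0 \<le> Y" unfolding Y_def using err_nonneg l1 a0 b0 E0 G0 by (intro add_nonneg_nonneg mult_nonneg_nonneg) auto
  have "cmod (hchar u n - (1 - sigma2 u / 2) * hchar u (n - 1)) \<le> Y + (\<Sum>q\<in>{1..<Q}. Y) + (2 * real Q * a ^ 3 * b + corr_const * \<delta> ^ Q / (1 - \<delta>))"
    unfolding dec
  proof (rule norm_triangle_mono[OF norm_triangle_mono last])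
    show "cmod (X0 + c0 * (hchar u (n - Q) - hchar u (n - 1))) \<le> Y" using each0 unfolding Y_def .
    show "cmod (\<Sum>q\<in>{1..<Q}. X q + c q * (hchar u (n - L 1) - hchar u (n - 1))) \<le> (\<Sum>q\<in>{1..<Q}. Y)"
      by (rule order_trans[OF norm_sum sum_mono]) (use each in \<open>simp add: Y_def\<close>)
  qed
  also have "\<dots> = real Q * Y + 2 * real Q * a ^ 3 * b + corr_const * \<delta> ^ Q / (1 - \<delta>)"
    using Q by (simp add: of_nat_diff algebra_simps)
  also have "\<dots> \<le> l * Y + 2 * l\<^sup>2 * a ^ 3 * b + corr_const * \<delta> ^ Q / (1 - \<delta>)"
  proof (intro add_mono mult_right_mono order_refl)
    show q: "real Q \<le> l" using QK by (simp add: l_def)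
    have "l * 1 \<le> l * l" using l1 by (intro mult_left_mono) auto
    then show "2 * real Q \<le> 2 * l\<^sup>2" using q by (simp add: power2_eq_square)
  qed (use a0 b0 Y0 in auto)
  also have "l * Y = l * err K N Q + 4 * l\<^sup>2 * a ^ 3 * b + l\<^sup>2 * E + a\<^sup>2 * (l\<^sup>2 * E)"
    unfolding Y_def G_def by (simp add: algebra_simps power2_eq_square power3_eq_cube)
  also have "a\<^sup>2 * (l\<^sup>2 * E) \<le> 1 * (l\<^sup>2 * E)"
    by (rule mult_right_mono) (use a0 a1 E0 in \<open>auto simp: power_le_one\<close>)
  finally show ?thesis
    unfolding total_err_def by (simp add: a_def E_def l_def algebra_simps)
qed

text \<open>
  The Birkhoff sum is centered, so the linear term of the exponential has mean zero.
\<close>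

lemma hchar_near_1: "cmod (hchar u m - 1) \<le> (real m * (B * norm u))\<^sup>2"
proof -
  define S where "S x = (\<Sum>k\<in>{0..<m}. phase u k x)" for x
  have [measurable]: "S \<in> borel_measurable M" unfolding S_def[abs_def] by measurable
  have Sb: "\<bar>S x\<bar> \<le> real m * (B * norm u)" for x
  proof -
    have "\<bar>S x\<bar> \<le> (\<Sum>k\<in>{0..<m}. \<bar>phase u k x\<bar>)" unfolding S_def by (rule sum_abs)
    also have "\<dots> \<le> (\<Sum>k\<in>{0..<m}. B * norm u)" by (intro sum_mono phase_bound)
    finally show ?thesis by simp
  qed
  have iph: "integrable M (phase u k)" for k
    by (rule integrable_bounded[where c="B * norm u"]) (use phase_bound in auto)
  have "(\<integral>x. S x \<partial>M) = 0"
    unfolding S_def by (subst Bochner_Integration.integral_sum) (auto simp: iph integral_phase)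
  then have S0: "(\<integral>x. \<i> * complex_of_real (S x) \<partial>M) = 0" by simp
  have iS: "integrable M (\<lambda>x. \<i> * complex_of_real (S x))"
    by (intro integrable_mult_right integrable_of_real integrable_bounded[where c="real m * (B * norm u)"]) (use Sb in auto)
  have osc: "osc u 0 m x = cis (S x)" for x unfolding osc_def S_def by (simp add: cis_sum)
  have io: "integrable M (osc u 0 m)" by (rule integrable_bounded[where c=1]) auto
  have "hchar u m - 1 = (\<integral>x. osc u 0 m x - 1 - \<i> * complex_of_real (S x) \<partial>M)"
    using io iS S0 by (simp add: hchar_def prob_space)
  also have "cmod \<dots> \<le> (real m * (B * norm u))\<^sup>2"
  proof (rule norm_integral_le)
    show "cmod (osc u 0 m x - 1 - \<i> * complex_of_real (S x)) \<le> (real m * (B * norm u))\<^sup>2" for x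
      unfolding osc using norm_cis_approx1[of "S x"] power_mono[OF Sb[of x] abs_ge_zero, of 2] by simp
  qed measurable
  finally show ?thesis .
qed

end

section \<open>Solving the recurrence\<close>

text \<open>
  A recurrence \<open>h m = (1 - x / 2) h (m - 1) + O(\<kappa> max |h| + \<epsilon>)\<close>, with the maximum over the preceding \<open>W\<close> values. Let
  \<open>E m = exp (- m x / 4)\<close>. Over a window \<open>E\<close> varies by a factor of at most \<open>2\<close>, because \<open>W x \<le> 1\<close>. As \<open>\<kappa>\<close> is small
  compared with \<open>x\<close>, induction gives first the rough bound \<open>2 E m + m \<epsilon>\<close> for \<open>|h m|\<close>. Inserted
  into the recurrence, it makes the perturbation explicit, and a second induction bounds the difference from the
  solution \<open>exp (- m x / 2)\<close> of the unperturbed problem. Half of the decay rate is given up in order to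
  absorb the perturbation.
\<close>

lemma perturbed_decay:
  fixes h :: "nat \<Rightarrow> complex" and x \<kappa> \<epsilon> \<Delta> :: real
  assumes h1: "\<And>m. cmod (h m) \<le> 1" and x: "0 \<le> x" "x \<le> 1" and Wx: "real W * x \<le> 1"
    and \<kappa>: "0 \<le> \<kappa>" "\<kappa> \<le> x / 16" and \<epsilon>: "0 \<le> \<epsilon>"
    and init: "\<And>m. m \<le> W \<Longrightarrow> cmod (h m - 1) \<le> \<Delta>"
    and rec: "\<And>m b. W < m \<Longrightarrow> m \<le> N \<Longrightarrow> (\<And>s. s \<in> {1..W} \<Longrightarrow> cmod (h (m - s)) \<le> b) \<Longrightarrow>
       cmod (h m - (1 - x / 2) * h (m - 1)) \<le> \<kappa> * b + \<epsilon>"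
  shows "cmod (h N - exp (- (real N * x / 2))) \<le>
     exp (- (real N * x / 4)) * (2 * \<Delta> + 2 * real W * x + real N * (4 * \<kappa> + x\<^sup>2)) + 2 * (real N + 1)\<^sup>2 * \<epsilon>"
proof -
  define E where "E m = exp (- (real m * x / 4))" for m :: nat
  have E0: "0 < E m" for m by (simp add: E_def)
  have Eadd: "E (m + k) = E m * E k" for m k by (simp add: E_def algebra_simps add_divide_distrib flip: exp_add)
  have E1: "E 1 \<le> 1 - x / 8"
  proof -
    have "exp (- (x / 4)) \<le> 1 - x / 4 + (x / 4)\<^sup>2"
    proof -
      have "inverse (1 + x / 4) \<le> 1 - x / 4 + (x / 4)\<^sup>2"
      proof -
        have "1 \<le> (1 - x / 4 + (x / 4)\<^sup>2) * (1 + x / 4)"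
          using x by (simp add: algebra_simps power2_eq_square power3_eq_cube)
        then show ?thesis using x by (simp add: field_simps)
      qed
      moreover have "exp (- (x / 4)) \<le> inverse (1 + x / 4)"
        using x exp_ge_add_one_self[of "x / 4"] by (simp add: exp_minus le_imp_inverse_le)
      ultimately show ?thesis by linarith
    qed
    moreover have "(x / 4)\<^sup>2 \<le> x / 8"
    proof -
      have "x * x \<le> 1 * x" using x by (intro mult_right_mono) auto
      then show ?thesis using x by (simp add: power2_eq_square)
    qed
    ultimately show ?thesis by (simp add: E_def)
  qed
  have half: "1 - x / 2 \<le> E 1 * E 1"
  proof -
    have "1 - x / 2 \<le> exp (- (x / 2))" using exp_ge_add_one_self[of "- (x / 2)"] by simp
    also have "exp (- (x / 2)) = E 1 * E 1" by (simp add: E_def flip: exp_add)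
    finally show ?thesis .
  qed
  have EW: "1 / 2 \<le> E W"
  proof -
    have "1 / 2 \<le> 1 + - (real W * x / 4)" using Wx by linarith
    also have "\<dots> \<le> E W" unfolding E_def by (rule exp_ge_add_one_self)
    finally show ?thesis .
  qed
  have Emono: "E m \<le> E k" if "k \<le> m" for m k
    using that x by (simp add: E_def mult_right_mono)
  have x2: "0 \<le> 1 - x / 2" using x by simp
  have Eshift: "E (m - s) \<le> 2 * E m" if "s \<le> W" for m s
  proof (cases "s \<le> m")
    case True
    have "E (m - s) * (1 / 2) \<le> E (m - s) * E s"
      using EW Emono[OF that] E0[of "m - s"] by (intro mult_left_mono) auto
    also have "\<dots> = E m" using Eadd[of "m - s" s] True by simp
    finally show ?thesis by simp
  next
    case False
    then have "m \<le> W" using that by simp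
    then have "E W \<le> E m" by (rule Emono)
    moreover have "E (m - s) = 1" using False by (simp add: E_def)
    ultimately show ?thesis using EW by linarith
  qed
  \<comment> \<open>First induction: a rough bound on \<open>h\<close> itself.\<close>
  have A: "cmod (h m) \<le> 2 * E m + real m * \<epsilon>" if "m \<le> N" for m
    using that
  proof (induction m rule: less_induct)
    case (less m)
    show ?case
    proof (cases "m \<le> W")
      case True
      then have "1 \<le> 2 * E m" using EW Emono[of m W] by simp
      then show ?thesis using h1[of m] \<epsilon> by (simp add: add_increasing2)
    next
      case False
      define b where "b = 4 * E m + (real m - 1) * \<epsilon>"
      have m1: "1 \<le> m" using False by simp
      have b: "cmod (h (m - s)) \<le> b" if s: "s \<in> {1..W}" for s
      proof -
        have "cmod (h (m - s)) \<le> 2 * E (m - s) + real (m - s) * \<epsilon>"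
          by (rule less.IH) (use s False less.prems in auto)
        also have "\<dots> \<le> 2 * (2 * E m) + (real m - 1) * \<epsilon>"
          using s False \<epsilon> by (intro add_mono mult_left_mono mult_right_mono Eshift) (auto simp: of_nat_diff)
        finally show ?thesis by (simp add: b_def)
      qed
      have IH: "cmod (h (m - 1)) \<le> 2 * E (m - 1) + (real m - 1) * \<epsilon>"
        using less.IH[of "m - 1"] m1 less.prems by (simp add: of_nat_diff)
      have Em: "E m = E (m - 1) * E 1" using Eadd[of "m - 1" 1] m1 by simp
      have "cmod (h m) \<le> cmod ((1 - x / 2) * h (m - 1)) + (\<kappa> * b + \<epsilon>)"
        using rec[of m b] b False less.prems by (intro norm_le_add_diff[of "h m"]) auto
      also have "cmod ((1 - x / 2) * h (m - 1)) = (1 - x / 2) * cmod (h (m - 1))"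
      proof -
        have "cmod (1 - complex_of_real x / 2) = 1 - x / 2"
          using x2 by (metis abs_of_nonneg norm_of_real of_real_1 of_real_diff of_real_divide of_real_numeral)
        then show ?thesis by (simp add: norm_mult)
      qed
      also have "\<dots> \<le> (1 - x / 2) * (2 * E (m - 1) + (real m - 1) * \<epsilon>)"
        by (rule mult_left_mono[OF IH x2])
      also have "\<dots> + (\<kappa> * b + \<epsilon>) = (1 - x / 2) * (2 * E (m - 1)) + \<kappa> * (4 * E m) + (1 - x / 2 + \<kappa>) * ((real m - 1) * \<epsilon>) + \<epsilon>"
        by (simp add: b_def algebra_simps)
      also have "\<dots> \<le> 2 * E m * (E 1 + 2 * \<kappa>) + 1 * ((real m - 1) * \<epsilon>) + \<epsilon>"
      proof (intro add_mono mult_right_mono order_refl)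
        have "(1 - x / 2) * (2 * E (m - 1)) \<le> (E 1 * E 1) * (2 * E (m - 1))"
          using half E0[of "m - 1"] by (intro mult_right_mono) auto
        then show "(1 - x / 2) * (2 * E (m - 1)) + \<kappa> * (4 * E m) \<le> 2 * E m * (E 1 + 2 * \<kappa>)"
          by (simp add: Em algebra_simps)
        show "1 - x / 2 + \<kappa> \<le> 1" using \<kappa> x by simp
      qed (use m1 \<epsilon> in auto)
      also have "\<dots> \<le> 2 * E m * 1 + 1 * ((real m - 1) * \<epsilon>) + \<epsilon>"
        using E1 \<kappa> E0[of m] m1 \<epsilon> by (intro add_mono mult_left_mono) auto
      finally show ?thesis by (simp add: algebra_simps)
    qed
  qed
  define D where "D m = h m - exp (- (real m * x / 2))" for m :: nat
  define G where "G = 2 * (\<Delta> + real W * x)"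
  define c where "c = 4 * \<kappa> + x\<^sup>2"
  define e where "e = (real N + 2) * \<epsilon>"
  have c0: "0 \<le> c" using \<kappa> by (simp add: c_def)
  have e0: "0 \<le> e" using \<epsilon> by (simp add: e_def)
  have \<Delta>0: "0 \<le> \<Delta>" using init[of 0] norm_ge_zero order_trans by blast
  have G0: "0 \<le> G" using \<Delta>0 x by (simp add: G_def)
  \<comment> \<open>Second induction: the difference from the unperturbed solution.\<close>
  have B: "cmod (D m) \<le> E m * (G + real m * c) + real m * e" if "m \<le> N" for m
    using that
  proof (induction m rule: less_induct)
    case (less m)
    show ?case
    proof (cases "m \<le> W")
      case True
      have "cmod (D m) = cmod ((h m - 1) + complex_of_real (1 - exp (- (real m * x / 2))))"
        by (simp add: D_def)
      also have "\<dots> \<le> \<Delta> + real W * x"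
      proof (rule norm_triangle_mono[OF init[OF True]])
        have "real m * x \<le> real W * x" using True x by (intro mult_right_mono) auto
        moreover have "1 - real m * x / 2 \<le> exp (- (real m * x / 2))"
          using exp_ge_add_one_self[of "- (real m * x / 2)"] by simp
        moreover have "0 \<le> real m * x" using x by simp
        ultimately show "cmod (complex_of_real (1 - exp (- (real m * x / 2)))) \<le> real W * x"
          unfolding norm_of_real by (simp add: abs_le_iff)
      qed
      also have "\<dots> \<le> E m * G"
      proof -
        have "1 / 2 * G \<le> E m * G" using EW Emono[OF True] G0 by (intro mult_right_mono) auto
        then show ?thesis by (simp add: G_def)
      qed
      also have "\<dots> \<le> E m * (G + real m * c) + real m * e"
        using E0[of m] c0 e0 by (simp add: algebra_simps)
      finally show ?thesis .
    next
      case False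
      have m1: "1 \<le> m" using False by simp
      define b where "b = 4 * E m + real m * \<epsilon>"
      have b: "cmod (h (m - s)) \<le> b" if s: "s \<in> {1..W}" for s
      proof -
        have "cmod (h (m - s)) \<le> 2 * E (m - s) + real (m - s) * \<epsilon>"
          by (rule A) (use s False less.prems in auto)
        also have "\<dots> \<le> 2 * (2 * E m) + real m * \<epsilon>"
          using s False \<epsilon> by (intro add_mono mult_left_mono mult_right_mono Eshift) auto
        finally show ?thesis by (simp add: b_def)
      qed
      have IH: "cmod (D (m - 1)) \<le> E (m - 1) * (G + (real m - 1) * c) + (real m - 1) * e"
        using less.IH[of "m - 1"] m1 less.prems by (simp add: of_nat_diff)
      have Em: "E m = E (m - 1) * E 1" using Eadd[of "m - 1" 1] m1 by simp
      define r where "r = exp (- (real (m - 1) * x / 2)) * ((1 - x / 2) - exp (- (x / 2)))"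
      have rm: "exp (- (real m * x / 2)) = exp (- (real (m - 1) * x / 2)) * exp (- (x / 2))"
        using m1 by (simp add: of_nat_diff algebra_simps diff_divide_distrib flip: exp_add)
      have "D m = (h m - (1 - x / 2) * h (m - 1)) + (1 - x / 2) * D (m - 1) + complex_of_real r"
        unfolding D_def r_def rm by (simp add: algebra_simps)
      also have "cmod \<dots> \<le> (\<kappa> * b + \<epsilon>) + (1 - x / 2) * cmod (D (m - 1)) + E m * x\<^sup>2"
      proof (rule norm_triangle_mono, rule norm_triangle_mono)
        show "cmod (h m - (1 - x / 2) * h (m - 1)) \<le> \<kappa> * b + \<epsilon>"
          using rec[of m b] b False less.prems by auto
        have "cmod (1 - complex_of_real x / 2) = 1 - x / 2"
          using x2 by (metis abs_of_nonneg norm_of_real of_real_1 of_real_diff of_real_divide of_real_numeral)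
        then show "cmod ((1 - x / 2) * D (m - 1)) \<le> (1 - x / 2) * cmod (D (m - 1))"
          by (simp add: norm_mult)
        have "\<bar>(1 - x / 2) - exp (- (x / 2))\<bar> \<le> x\<^sup>2 / 4"
        proof -
          have "1 - x / 2 \<le> exp (- (x / 2))" using exp_ge_add_one_self[of "- (x / 2)"] by simp
          moreover have "exp (- (x / 2)) \<le> 1 - x / 2 + x\<^sup>2 / 4"
          proof -
            have "1 \<le> (1 - x / 2 + x\<^sup>2 / 4) * (1 + x / 2)"
              using x by (simp add: algebra_simps power2_eq_square power3_eq_cube)
            then have "inverse (1 + x / 2) \<le> 1 - x / 2 + x\<^sup>2 / 4" using x by (simp add: field_simps)
            moreover have "exp (- (x / 2)) \<le> inverse (1 + x / 2)"
              using x exp_ge_add_one_self[of "x / 2"] by (simp add: exp_minus le_imp_inverse_le)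
            ultimately show ?thesis by linarith
          qed
          ultimately show ?thesis by simp
        qed
        moreover have "exp (- (real (m - 1) * x / 2)) \<le> 2 * E m"
        proof -
          have "exp (- (real (m - 1) * x / 2)) \<le> E (m - 1)" using x by (simp add: E_def)
          also have "\<dots> \<le> 2 * E m"
          proof (cases "W = 0")
            case True
            have "3 / 4 \<le> E 1" using exp_ge_add_one_self[of "- (x / 4)"] x by (simp add: E_def)
            then have "E (m - 1) * (1 / 2) \<le> E (m - 1) * E 1" using E0[of "m - 1"] by (intro mult_left_mono) auto
            then show ?thesis using Em by simp
          next
            case False
            then show ?thesis using Eshift[of 1 m] by simp
          qed
          finally show ?thesis .
        qed
        ultimately have "\<bar>r\<bar> \<le> (2 * E m) * (x\<^sup>2 / 4)"
          unfolding r_def abs_mult using E0[of m] by (intro mult_mono) auto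
        also have "\<dots> \<le> E m * x\<^sup>2" using E0[of m] by (simp add: zero_le_mult_iff)
        finally show "cmod (complex_of_real r) \<le> E m * x\<^sup>2" by simp
      qed
      also have "\<dots> \<le> (\<kappa> * (4 * E m) + real N * \<epsilon> + \<epsilon>) + (E m * (G + (real m - 1) * c) + (real m - 1) * e) + E m * x\<^sup>2"
      proof (rule add_mono[OF add_mono order_refl])
        have "\<kappa> * (real m * \<epsilon>) \<le> 1 * (real N * \<epsilon>)"
          using \<kappa> x less.prems \<epsilon> by (intro mult_mono) auto
        then show "\<kappa> * b + \<epsilon> \<le> \<kappa> * (4 * E m) + real N * \<epsilon> + \<epsilon>" by (simp add: b_def algebra_simps)
        have GG: "0 \<le> G + (real m - 1) * c" using G0 c0 m1 by simp
        have "E 1 \<le> 1" using E1 x(1) by linarith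
        then have "E 1 * E 1 \<le> E 1 * 1" by (rule mult_left_mono) (use E0[of 1] in simp)
        then have x12: "1 - x / 2 \<le> E 1" using half by linarith
        have "(1 - x / 2) * cmod (D (m - 1)) \<le> (1 - x / 2) * (E (m - 1) * (G + (real m - 1) * c)) + (1 - x / 2) * ((real m - 1) * e)"
          using mult_left_mono[OF IH x2] by (simp add: algebra_simps)
        also have "\<dots> \<le> E 1 * (E (m - 1) * (G + (real m - 1) * c)) + 1 * ((real m - 1) * e)"
          using x12 x GG e0 m1 E0[of "m - 1"] by (intro add_mono mult_right_mono mult_nonneg_nonneg) auto
        finally show "(1 - x / 2) * cmod (D (m - 1)) \<le> E m * (G + (real m - 1) * c) + (real m - 1) * e"
          by (simp add: Em mult_ac)
      qed
      also have "\<dots> \<le> E m * (G + real m * c) + real m * e"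
        using \<epsilon> by (simp add: c_def e_def algebra_simps)
      finally show ?thesis .
    qed
  qed
  have "cmod (D N) \<le> E N * (G + real N * c) + real N * e" by (rule B) simp
  also have "real N * e \<le> 2 * (real N + 1)\<^sup>2 * \<epsilon>"
  proof -
    have "real N * (real N + 2) \<le> 2 * (real N + 1)\<^sup>2" by (simp add: power2_eq_square algebra_simps)
    from mult_right_mono[OF this \<epsilon>] show ?thesis by (simp add: e_def mult_ac)
  qed
  finally show ?thesis
    by (simp add: D_def E_def G_def c_def algebra_simps)
qed

context decorrelated_observable
begin

text \<open>
  The bilinear form of the asymptotic covariance, as a series of correlations.
\<close>

definition corr_sum :: "real^'d \<Rightarrow> real^'d \<Rightarrow> real" where
  "corr_sum u v = bicorr u v 0 + (\<Sum>k. bicorr u v (Suc k) + bicorr v u (Suc k))"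

definition sum_cov :: "nat \<Rightarrow> real^'d \<Rightarrow> real^'d \<Rightarrow> real" where
  "sum_cov n u v = (\<integral>x. (u \<bullet> birkhoff_sum T f n x) * (v \<bullet> birkhoff_sum T f n x) \<partial>M)"

lemma sigma2_eq_corr_sum: "sigma2 u = corr_sum u u"
proof -
  have "(\<Sum>k. bicorr u u (Suc k) + bicorr u u (Suc k)) = (\<Sum>k. bicorr u u (Suc k)) + (\<Sum>k. bicorr u u (Suc k))"
    using summable_bicorr[of u u 1] by (intro suminf_add[symmetric]) auto
  then show ?thesis by (simp add: sigma2_def corr_sum_def)
qed

lemma birkhoff_meas [measurable]: "birkhoff_sum T f n \<in> borel_measurable M"
  unfolding birkhoff_sum_def[abs_def] by measurable

lemma birkhoff_bound: "norm (birkhoff_sum T f n x) \<le> real n * B"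
proof -
  have "norm (birkhoff_sum T f n x) \<le> (\<Sum>k<n. B)"
    unfolding birkhoff_sum_def by (rule order_trans[OF norm_sum sum_mono]) (rule f_bound)
  then show ?thesis by simp
qed

lemma inner_birkhoff: "u \<bullet> birkhoff_sum T f n x = (\<Sum>k<n. phase u k x)"
  by (simp add: birkhoff_sum_def phase_def inner_sum_right)

lemma integrable_inner_birkhoff: "integrable M (\<lambda>x. (u \<bullet> birkhoff_sum T f n x) * (v \<bullet> birkhoff_sum T f m (T x)))"
  "integrable M (\<lambda>x. (u \<bullet> birkhoff_sum T f n x) * (v \<bullet> birkhoff_sum T f m x))"
proof -
  have b: "\<bar>u \<bullet> birkhoff_sum T f n x\<bar> \<le> norm u * (real n * B)" for u n x
    by (rule order_trans[OF Cauchy_Schwarz_ineq2]) (intro mult_left_mono birkhoff_bound norm_ge_zero)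
  have [measurable]: "(\<lambda>x. birkhoff_sum T f m (T x)) \<in> borel_measurable M"
    by (rule measurable_compose[OF T_meas birkhoff_meas])
  have "norm ((u \<bullet> birkhoff_sum T f n x) * (v \<bullet> birkhoff_sum T f m y)) \<le> (norm u * (real n * B)) * (norm v * (real m * B))" for x y
    unfolding real_norm_def abs_mult by (intro mult_mono b) (use B_pos in auto)
  then show "integrable M (\<lambda>x. (u \<bullet> birkhoff_sum T f n x) * (v \<bullet> birkhoff_sum T f m (T x)))"
    "integrable M (\<lambda>x. (u \<bullet> birkhoff_sum T f n x) * (v \<bullet> birkhoff_sum T f m x))"
    by (auto intro!: integrable_bounded)
qed

text \<open>
  Split \<open>S_(n+1)(x) = f(x) + S_n(T x)\<close> and use invariance for the product of the second summands.
\<close>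

lemma sum_cov_Suc:
  "sum_cov (Suc n) u v = sum_cov n u v + bicorr u v 0 + (\<Sum>k<n. bicorr u v (Suc k) + bicorr v u (Suc k))"
proof -
  have bs: "birkhoff_sum T f (Suc n) x = f x + birkhoff_sum T f n (T x)" for x
    unfolding birkhoff_sum_def by (subst sum.lessThan_Suc_shift) (simp add: funpow_swap1)
  have f1: "f x = birkhoff_sum T f 1 x" for x by (simp add: birkhoff_sum_def)
  have [measurable]: "(\<lambda>x. birkhoff_sum T f n (T x)) \<in> borel_measurable M"
    by (rule measurable_compose[OF T_meas birkhoff_meas])
  have i1: "integrable M (\<lambda>x. (u \<bullet> f x) * (v \<bullet> f x))" for u v
    using integrable_inner_birkhoff(2)[of u 1 v 1] by (simp add: f1)
  have i2: "integrable M (\<lambda>x. (u \<bullet> f x) * (v \<bullet> birkhoff_sum T f n (T x)))" for u v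
    using integrable_inner_birkhoff(1)[of u 1 v n] by (simp add: f1)
  have i4: "integrable M (\<lambda>x. (u \<bullet> birkhoff_sum T f n (T x)) * (v \<bullet> birkhoff_sum T f n (T x)))"
    using integrable_distr_eq[of T M M "\<lambda>x. (u \<bullet> birkhoff_sum T f n x) * (v \<bullet> birkhoff_sum T f n x)"]
      integrable_inner_birkhoff(2)[of u n v n] T_meas T_inv by simp
  have mixed: "(\<integral>x. (u \<bullet> f x) * (v \<bullet> birkhoff_sum T f n (T x)) \<partial>M) = (\<Sum>k<n. bicorr u v (Suc k))" for u v
  proof -
    have "(u \<bullet> f x) * (v \<bullet> birkhoff_sum T f n (T x)) = (\<Sum>k<n. phase u 0 x * phase v (Suc k) x)" for x
      by (simp add: inner_birkhoff sum_distrib_left phase_def funpow_swap1)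
    moreover have "integrable M (\<lambda>x. phase u 0 x * phase v k x)" for k
    proof (rule integrable_bounded)
      show "norm (phase u 0 x * phase v k x) \<le> (B * norm u) * (B * norm v)" for x
        unfolding real_norm_def abs_mult by (intro mult_mono phase_bound) (use B_pos in auto)
    qed measurable
    ultimately show ?thesis by (simp add: bicorr_def)
  qed
  have last: "(\<integral>x. (u \<bullet> birkhoff_sum T f n (T x)) * (v \<bullet> birkhoff_sum T f n (T x)) \<partial>M) = sum_cov n u v"
    unfolding sum_cov_def
    using integral_iter[of "\<lambda>x. (u \<bullet> birkhoff_sum T f n x) * (v \<bullet> birkhoff_sum T f n x)" 1] by simp
  have "sum_cov (Suc n) u v = (\<integral>x. (u \<bullet> f x) * (v \<bullet> f x) + (u \<bullet> f x) * (v \<bullet> birkhoff_sum T f n (T x))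
     + (v \<bullet> f x) * (u \<bullet> birkhoff_sum T f n (T x)) + (u \<bullet> birkhoff_sum T f n (T x)) * (v \<bullet> birkhoff_sum T f n (T x)) \<partial>M)"
    unfolding sum_cov_def bs by (simp add: inner_add_right algebra_simps)
  also have "\<dots> = (\<integral>x. (u \<bullet> f x) * (v \<bullet> f x) \<partial>M) + (\<Sum>k<n. bicorr u v (Suc k)) + (\<Sum>k<n. bicorr v u (Suc k)) + sum_cov n u v"
    using i1 i2 i4 by (simp add: mixed last)
  also have "(\<integral>x. (u \<bullet> f x) * (v \<bullet> f x) \<partial>M) = bicorr u v 0" by (simp add: bicorr_def phase_def)
  finally show ?thesis by (simp add: sum.distrib)
qed

text \<open>
  The increments of \<open>sum_cov\<close> converge to \<open>corr_sum\<close> exponentially fast.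
\<close>

lemma sum_cov_asymptotics: "\<exists>C. \<forall>n. \<bar>sum_cov n u v - real n * corr_sum u v\<bar> \<le> C"
proof -
  define C where "C = 2 * norm u * norm v * corr_const / (1 - \<delta>)"
  have C0: "0 \<le> C" using corr_const_nonneg \<delta> by (simp add: C_def)
  have s: "summable (\<lambda>k. bicorr u v (Suc k) + bicorr v u (Suc k))"
    using summable_bicorr[of u v 1] summable_bicorr[of v u 1] by (intro summable_add) auto
  have step: "\<bar>sum_cov (Suc n) u v - sum_cov n u v - corr_sum u v\<bar> \<le> C * \<delta> ^ n" for n
  proof -
    have "(\<Sum>k. bicorr u v (Suc k) + bicorr v u (Suc k)) =
      (\<Sum>k. bicorr u v (Suc (k + n)) + bicorr v u (Suc (k + n))) + (\<Sum>k<n. bicorr u v (Suc k) + bicorr v u (Suc k))"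
      using suminf_split_initial_segment[OF s, of n] .
    also have "(\<Sum>k. bicorr u v (Suc (k + n)) + bicorr v u (Suc (k + n))) =
      (\<Sum>k. bicorr u v (k + Suc n)) + (\<Sum>k. bicorr v u (k + Suc n))"
      using summable_bicorr[of u v "Suc n"] summable_bicorr[of v u "Suc n"] by (subst suminf_add) auto
    finally have "sum_cov (Suc n) u v - sum_cov n u v - corr_sum u v =
      - ((\<Sum>k. bicorr u v (k + Suc n)) + (\<Sum>k. bicorr v u (k + Suc n)))"
      by (simp add: sum_cov_Suc corr_sum_def)
    also have "\<bar>\<dots>\<bar> \<le> norm u * norm v * corr_const * \<delta> ^ Suc n / (1 - \<delta>) + norm v * norm u * corr_const * \<delta> ^ Suc n / (1 - \<delta>)"
      unfolding abs_minus_cancel by (rule order_trans[OF abs_triangle_ineq add_mono[OF bicorr_tail bicorr_tail]])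
    also have "\<dots> = C * \<delta> ^ Suc n" by (simp add: C_def algebra_simps)
    also have "\<dots> \<le> C * \<delta> ^ n" using C0 \<delta> by (intro mult_left_mono power_decreasing) auto
    finally show ?thesis .
  qed
  have "\<bar>sum_cov n u v - real n * corr_sum u v\<bar> \<le> (\<Sum>k<n. C * \<delta> ^ k)" for n
  proof (induction n)
    case 0
    then show ?case by (simp add: sum_cov_def birkhoff_sum_def)
  next
    case (Suc n)
    have "sum_cov (Suc n) u v - real (Suc n) * corr_sum u v =
      (sum_cov n u v - real n * corr_sum u v) + (sum_cov (Suc n) u v - sum_cov n u v - corr_sum u v)"
      by (simp add: algebra_simps)
    then show ?case using Suc step[of n] by simp
  qed
  moreover have "(\<Sum>k<n. C * \<delta> ^ k) \<le> C * (\<Sum>k. \<delta> ^ k)" for n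
    unfolding sum_distrib_left[symmetric] using C0 \<delta>
    by (intro mult_left_mono sum_le_suminf) (auto intro: summable_geometric)
  ultimately show ?thesis by (meson order_trans)
qed

lemma sum_cov_limit: "(\<lambda>n. sum_cov n u v / real n) \<longlonglongrightarrow> corr_sum u v"
proof -
  obtain C where C: "\<And>n. \<bar>sum_cov n u v - real n * corr_sum u v\<bar> \<le> C"
    using sum_cov_asymptotics[of u v] by blast
  have "(\<lambda>n. (sum_cov n u v - real n * corr_sum u v) / real n) \<longlonglongrightarrow> 0"
  proof (rule Lim_null_comparison)
    show "(\<lambda>n. C / real n) \<longlonglongrightarrow> 0" by real_asymp
    show "eventually (\<lambda>n. norm ((sum_cov n u v - real n * corr_sum u v) / real n) \<le> C / real n) sequentially"
      by (intro always_eventually allI) (simp add: abs_divide divide_right_mono C)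
  qed
  then have "(\<lambda>n. (sum_cov n u v - real n * corr_sum u v) / real n + corr_sum u v) \<longlonglongrightarrow> 0 + corr_sum u v"
    by (intro tendsto_add tendsto_const)
  then have "(\<lambda>n. sum_cov n u v / real n) \<longlonglongrightarrow> 0 + corr_sum u v"
    by (rule Lim_transform_eventually)
       (rule eventually_mono[OF eventually_gt_at_top[of 0]], simp add: field_simps)
  then show ?thesis by simp
qed

text \<open>
  The integral commutes with the linear functional that sends a matrix \<open>A\<close> to \<open>u.A v\<close>.
\<close>

lemma empirical_cov:
  fixes n :: nat
  defines "A \<equiv> (LINT x|M. outer_prod (normalized_sum T f n x) (normalized_sum T f n x))"
  shows "u \<bullet> (A *v v) = sum_cov n u v / real n"
proof -
  define N where "N = normalized_sum T f n"
  have Nm [measurable]: "N \<in> borel_measurable M"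
    unfolding N_def normalized_sum_def[abs_def] by measurable
  have Nb: "norm (N x) \<le> real n * B" for x
  proof -
    have "\<bar>1 / sqrt (real n)\<bar> \<le> 1" by (cases n) auto
    then have "\<bar>1 / sqrt (real n)\<bar> * norm (birkhoff_sum T f n x) \<le> 1 * (real n * B)"
      by (intro mult_mono birkhoff_bound) auto
    then show ?thesis by (simp add: N_def normalized_sum_def)
  qed
  have bl: "bounded_linear (\<lambda>A::real^'d^'d. u \<bullet> (A *v v))"
  proof -
    have "linear (\<lambda>A::real^'d^'d. u \<bullet> (A *v v))"
      by (intro linearI) (simp_all add: matrix_vector_mult_add_rdistrib inner_add_right scaleR_matrix_vector_assoc[symmetric])
    then show ?thesis by (rule linear_conv_bounded_linear[THEN iffD1])
  qed
  have op: "continuous_on UNIV (\<lambda>x::real^'d. outer_prod x x)"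
    unfolding outer_prod_def by (intro continuous_intros)
  have "integrable M (\<lambda>x. outer_prod (N x) (N x))"
  proof -
    have "compact ((\<lambda>x::real^'d. outer_prod x x) ` cball 0 (real n * B))"
      by (intro compact_continuous_image continuous_on_subset[OF op]) auto
    then obtain c where c: "\<And>x::real^'d. x \<in> cball 0 (real n * B) \<Longrightarrow> norm (outer_prod x x) \<le> c"
      using compact_imp_bounded bounded_iff by (metis (no_types, lifting) imageI)
    have "(\<lambda>x. outer_prod (N x) (N x)) \<in> borel_measurable M"
      by (rule measurable_compose[OF Nm borel_measurable_continuous_onI[OF op]])
    then show ?thesis
      by (rule integrable_bounded[where c=c]) (use c Nb in simp)
  qed
  then have "u \<bullet> (A *v v) = (\<integral>x. u \<bullet> (outer_prod (N x) (N x) *v v) \<partial>M)"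
    unfolding A_def N_def[symmetric] by (rule integral_bounded_linear[OF bl, symmetric])
  also have "\<dots> = (\<integral>x. (u \<bullet> N x) * (v \<bullet> N x) \<partial>M)"
  proof -
    have "outer_prod y y *v v = (v \<bullet> y) *\<^sub>R y" for y :: "real^'d"
      by (simp add: vec_eq_iff outer_prod_def matrix_vector_mult_def inner_vec_def sum_distrib_left sum_distrib_right mult_ac)
    then show ?thesis by (simp add: mult.commute)
  qed
  also have "\<dots> = (\<integral>x. (u \<bullet> birkhoff_sum T f n x) * (v \<bullet> birkhoff_sum T f n x) / real n \<partial>M)"
    by (simp add: N_def normalized_sum_def)
  finally show ?thesis by (simp add: sum_cov_def)
qed

text \<open>
  This also shows that the limit defining \<open>asymp_cov\<close> exists: its entries are the values of \<open>corr_sum\<close> on the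
  standard basis.
\<close>

lemma asymp_cov_form: "u \<bullet> (asymp_cov M T f *v v) = corr_sum u v"
proof -
  define A where "A n = (LINT x|M. outer_prod (normalized_sum T f n x) (normalized_sum T f n x))" for n
  have emp: "u \<bullet> (A n *v v) = sum_cov n u v / real n" for n u v
    unfolding A_def by (rule empirical_cov)
  define D0 :: "real^'d^'d" where "D0 = (\<chi> i j. corr_sum (axis i 1) (axis j 1))"
  have "A \<longlonglongrightarrow> D0"
  proof (rule vec_tendstoI, rule vec_tendstoI)
    fix i j
    have "A n $ i $ j = sum_cov n (axis i 1) (axis j 1) / real n" for n
      using emp[of "axis i 1" n "axis j 1"]
      by (simp add: inner_axis' matrix_vector_mult_basis column_def)
    then show "(\<lambda>n. A n $ i $ j) \<longlonglongrightarrow> D0 $ i $ j"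
      using sum_cov_limit[of "axis i 1" "axis j 1"] by (simp add: D0_def)
  qed
  then have lim: "A \<longlonglongrightarrow> asymp_cov M T f"
    unfolding asymp_cov_def A_def[symmetric] using limI by blast
  have "(\<lambda>n. u \<bullet> (A n *v v)) \<longlonglongrightarrow> u \<bullet> (asymp_cov M T f *v v)"
    unfolding matrix_vector_mult_def by (intro tendsto_intros lim)
  then show ?thesis using sum_cov_limit[of u v] LIMSEQ_unique unfolding emp by blast
qed

lemma asymp_cov_sym: "u \<bullet> (asymp_cov M T f *v v) = v \<bullet> (asymp_cov M T f *v u)"
proof -
  have "sum_cov n u v = sum_cov n v u" for n by (simp add: sum_cov_def mult.commute)
  then show ?thesis
    unfolding asymp_cov_form using sum_cov_limit[of u v] sum_cov_limit[of v u] LIMSEQ_unique by simp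
qed

lemma asymp_cov_nonneg: "0 \<le> u \<bullet> (asymp_cov M T f *v u)"
proof -
  have "0 \<le> sum_cov n u u / real n" for n
    unfolding sum_cov_def by (intro divide_nonneg_nonneg Bochner_Integration.integral_nonneg) auto
  then show ?thesis unfolding asymp_cov_form using LIMSEQ_le_const[OF sum_cov_limit[of u u]] by blast
qed

text \<open>
  A positive semidefinite symmetric form can vanish at \<open>u\<close> only if \<open>u\<close> is in its kernel.
\<close>

lemma asymp_cov_pos:
  assumes inv: "invertible (asymp_cov M T f)" and u: "u \<noteq> 0"
  shows "0 < u \<bullet> (asymp_cov M T f *v u)"
proof (rule ccontr)
  let ?D = "asymp_cov M T f"
  assume "\<not> ?thesis"
  then have uu: "u \<bullet> (?D *v u) = 0" using asymp_cov_nonneg[of u] by linarith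
  define v where "v = ?D *v u"
  define q where "q = v \<bullet> (?D *v v)"
  have pos: "0 \<le> 2 * t * (norm v)\<^sup>2 + t\<^sup>2 * q" for t
  proof -
    have "0 \<le> (u + t *\<^sub>R v) \<bullet> (?D *v (u + t *\<^sub>R v))" by (rule asymp_cov_nonneg)
    also have "\<dots> = 2 * t * (v \<bullet> (?D *v u)) + t\<^sup>2 * q"
      using uu asymp_cov_sym[of u v]
      by (simp add: q_def matrix_vector_right_distrib matrix_vector_mult_scaleR inner_add_left inner_add_right power2_eq_square algebra_simps)
    finally show ?thesis by (simp add: v_def power2_norm_eq_inner)
  qed
  have q0: "0 \<le> q" unfolding q_def by (rule asymp_cov_nonneg)
  have "(norm v)\<^sup>2 \<le> 0"
  proof -
    show ?thesis
    proof (rule ccontr)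
      assume n: "\<not> (norm v)\<^sup>2 \<le> 0"
      \<comment> \<open>For small \<open>t > 0\<close> the linear term makes the polynomial in \<open>pos\<close> negative at \<open>- t\<close>.\<close>
      define t where "t = (norm v)\<^sup>2 / (q + 1)"
      have t: "0 < t" using n q0 by (simp add: t_def)
      have "0 \<le> t * (t * q - 2 * (norm v)\<^sup>2)" using pos[of "- t"] by (simp add: algebra_simps power2_eq_square)
      then have "2 * (norm v)\<^sup>2 \<le> t * q" using t by (simp add: zero_le_mult_iff)
      also have "t * q \<le> t * (q + 1)" using t by simp
      also have "t * (q + 1) = (norm v)\<^sup>2" using q0 by (simp add: t_def)
      finally show False using n by simp
    qed
  qed
  then have "?D *v u = 0" by (simp add: v_def)
  moreover obtain A where "A ** ?D = mat 1" using inv by (auto simp: invertible_def)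
  ultimately have "u = 0" by (metis matrix_vector_mul_assoc matrix_vector_mul_lid matrix_vector_mult_0_right)
  then show False using u by simp
qed

end

context decorrelated_observable
begin

section \<open>Uniform estimate of the characteristic function\<close>

lemma sigma2_upper: "sigma2 u \<le> corr_const * (1 + 2 / (1 - \<delta>)) * (norm u)\<^sup>2"
proof -
  have "\<bar>bicorr u u 0\<bar> \<le> corr_const * (norm u)\<^sup>2"
    using bicorr_bound[of u u 0] by (simp add: power2_eq_square mult_ac)
  moreover have "\<bar>\<Sum>k. bicorr u u (Suc k)\<bar> \<le> corr_const * (1 / (1 - \<delta>)) * (norm u)\<^sup>2"
  proof -
    have "\<bar>\<Sum>k. bicorr u u (Suc k)\<bar> \<le> norm u * norm u * corr_const * \<delta> ^ 1 / (1 - \<delta>)"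
      using bicorr_tail[of u u 1] by simp
    also have "\<dots> \<le> norm u * norm u * corr_const * 1 / (1 - \<delta>)"
      using \<delta> corr_const_nonneg by (intro divide_right_mono mult_left_mono) auto
    finally show ?thesis by (simp add: power2_eq_square mult_ac)
  qed
  ultimately show ?thesis unfolding sigma2_def by (simp add: algebra_simps abs_le_iff)
qed

text \<open>
  Compactness of the unit sphere and homogeneity.
\<close>

lemma sigma2_lower:
  assumes "invertible (asymp_cov M T f)"
  obtains c where "0 < c" "\<And>u. c * (norm u)\<^sup>2 \<le> sigma2 u"
proof -
  let ?q = "\<lambda>u::real^'d. u \<bullet> (asymp_cov M T f *v u)"
  have ne: "sphere (0::real^'d) 1 \<noteq> {}"
    using vector_choose_size[of 1, where 'a="real^'d"] by auto
  have "continuous_on (sphere 0 1) ?q" by (intro continuous_intros)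
  from continuous_attains_inf[OF compact_sphere ne this]
  obtain v where v: "v \<in> sphere 0 1" "\<And>u. u \<in> sphere 0 1 \<Longrightarrow> ?q v \<le> ?q u" by blast
  show ?thesis
  proof (rule that)
    show "0 < ?q v" using v(1) by (intro asymp_cov_pos assms) auto
    fix u :: "real^'d"
    show "?q v * (norm u)\<^sup>2 \<le> sigma2 u"
    proof (cases "u = 0")
      case True
      then show ?thesis using asymp_cov_form[of u u] by (simp add: sigma2_eq_corr_sum)
    next
      case False
      define w where "w = (1 / norm u) *\<^sub>R u"
      have "?q v \<le> ?q w" by (rule v) (use False in \<open>simp add: w_def\<close>)
      also have "?q w = ?q u / (norm u)\<^sup>2"
        by (simp add: w_def matrix_vector_mult_scaleR power2_eq_square)
      finally show ?thesis
        using False asymp_cov_form[of u u] by (simp add: sigma2_eq_corr_sum field_simps)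
    qed
  qed
qed

lemma total_err_nonneg: "0 \<le> total_err K N Q L u"
  unfolding total_err_def using err_nonneg trunc_err_nonneg corr_const_nonneg \<delta>
  by (intro add_nonneg_nonneg mult_nonneg_nonneg divide_nonneg_nonneg) auto

text \<open>
  Here \<open>z\<close> stands for \<open>n^\<beta>\<close>. With a window of order \<open>z\<close> and \<open>norm u \<le> 1 / z^3\<close>, the hypotheses of \<open>perturbed_decay\<close>
  hold as soon as \<open>z\<close> exceeds constants that depend on \<open>K\<close>: the perturbation \<open>\<kappa>\<close> is of order \<open>z\<^sup>2 norm u ^ 3\<close>, hence
  of order at most \<open>norm u ^ 2 / z\<close>, while \<open>sigma2 u\<close> is at least \<open>c norm u ^ 2\<close>.
\<close>

lemma hchar_estimate_at:
  fixes z c :: real and K Q n :: nat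
  assumes K: "3 \<le> K" and z: "1 \<le> z" and Q: "z \<le> real Q" "real Q \<le> 2 * z"
    and c: "0 < c" "\<And>u. c * (norm u)\<^sup>2 \<le> sigma2 u"
    and u: "norm u \<le> 1 / z ^ 3"
  defines "r \<equiv> 2 * real (R + 1) ^ K" and "s \<equiv> corr_const * (1 + 2 / (1 - \<delta>))"
  assumes z0: "2 * B * r \<le> z" "s \<le> z" "2 * r * s \<le> z" "96 * r\<^sup>2 * B ^ 3 \<le> c * z"
  shows "cmod (hchar u n - exp (- (real n * sigma2 u / 2))) \<le>
     (8 * r\<^sup>2 * B\<^sup>2 + 4 * r * s + 24 * r\<^sup>2 * B ^ 3 + s\<^sup>2) * z\<^sup>2 * exp (- (c / 4 * real n * (norm u)\<^sup>2)) * ((norm u)\<^sup>2 + real n * norm u ^ 3)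
     + 2 * (real n + 1)\<^sup>2 * total_err K n Q ((R + 1) ^ K * Q) u"
proof -
  define L where "L k = (R + 1) ^ k * Q" for k
  define l where "l = real (L K)"
  define x where "x = sigma2 u"
  define v where "v = norm u"
  have v0: "0 \<le> v" by (simp add: v_def)
  have r1: "1 \<le> r"
  proof -
    have "1 \<le> real (R + 1) ^ K" by (rule one_le_power) simp
    then show ?thesis unfolding r_def by linarith
  qed
  have s0: "0 \<le> s" using corr_const_nonneg \<delta> by (simp add: s_def)
  have lz: "l \<le> r * z"
  proof -
    have "l = real (R + 1) ^ K * real Q" by (simp add: l_def L_def)
    also have "\<dots> \<le> real (R + 1) ^ K * (2 * z)" by (rule mult_left_mono[OF Q(2)]) simp
    finally show ?thesis by (simp add: r_def mult_ac)
  qed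
  have l0: "0 \<le> l" by (simp add: l_def)
  have vz: "v * z ^ 3 \<le> 1" using u z by (simp add: v_def field_simps)
  have v1: "v \<le> 1"
  proof -
    have "v * 1 \<le> v * z ^ 3" using z v0 by (intro mult_left_mono one_le_power)
    then show ?thesis using vz by simp
  qed
  have Q1: "1 \<le> Q" using z Q by linarith
  have zz: "z * z * v \<le> 1 / z" using vz z by (simp add: field_simps power3_eq_cube)
  have iz: "1 / z \<le> 1" using z by simp
  have zv: "z * v \<le> 1 / z"
  proof -
    have "1 * (z * v) \<le> z * (z * v)" using z v0 by (intro mult_right_mono) auto
    then show ?thesis using zz by (simp add: mult_ac)
  qed
  have small: "B * norm u * L K \<le> 1 / 2"
  proof -
    have "B * v * l \<le> B * v * (r * z)" using lz B_pos v0 by (intro mult_left_mono) auto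
    also have "\<dots> = (B * r) * (z * v)" by simp
    also have "\<dots> \<le> (B * r) * (1 / z)" using zv B_pos r1 by (intro mult_left_mono) auto
    also have "\<dots> \<le> (z / 2) * (1 / z)" using z0(1) z by (intro mult_right_mono) auto
    also have "\<dots> = 1 / 2" using z by simp
    finally show ?thesis by (simp add: v_def l_def)
  qed
  have xs: "x \<le> s * v\<^sup>2" using sigma2_upper[of u] by (simp add: x_def s_def v_def)
  have xc: "c * v\<^sup>2 \<le> x" using c(2)[of u] by (simp add: x_def v_def)
  have x0: "0 \<le> x" by (rule order_trans[OF _ xc]) (use c in simp)
  have vv: "v\<^sup>2 \<le> v" using v0 v1 by (simp add: power2_eq_square mult_left_le)
  have Wx: "2 * l * x \<le> 1"
  proof -
    have "2 * l * x \<le> 2 * (r * z) * (s * v)"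
    proof (intro mult_mono)
      show "x \<le> s * v" using xs mult_left_mono[OF vv s0] by linarith
    qed (use lz l0 x0 r1 z in auto)
    also have "\<dots> = (2 * r * s) * (z * v)" by simp
    also have "\<dots> \<le> z * (1 / z)"
      using zv z0(3) z v0 by (intro mult_mono) auto
    also have "\<dots> = 1" using z by simp
    finally show ?thesis .
  qed
  have l1: "1 \<le> l"
  proof -
    have "1 * 1 \<le> (R + 1) ^ K * Q" using Q1 by (intro mult_le_mono) auto
    then have "1 \<le> L K" by (simp add: L_def)
    then show ?thesis unfolding l_def by linarith
  qed
  have x1: "x \<le> 1"
  proof -
    have "1 * x \<le> (2 * l) * x" using l1 x0 by (intro mult_right_mono) auto
    then show ?thesis using Wx by simp
  qed
  define \<kappa> where "\<kappa> = 6 * l\<^sup>2 * (B * v) ^ 3"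
  have \<kappa>b: "\<kappa> \<le> 6 * r\<^sup>2 * B ^ 3 * z\<^sup>2 * v ^ 3"
  proof -
    have "\<kappa> \<le> 6 * (r * z)\<^sup>2 * (B * v) ^ 3"
      unfolding \<kappa>_def using lz l0 B_pos v0 by (intro mult_right_mono mult_left_mono power_mono) auto
    then show ?thesis by (simp add: power_mult_distrib mult_ac)
  qed
  have \<kappa>0: "0 \<le> \<kappa>" unfolding \<kappa>_def using B_pos v0 by simp
  have \<kappa>x: "\<kappa> \<le> x / 16"
  proof -
    have "6 * r\<^sup>2 * B ^ 3 * z\<^sup>2 * v ^ 3 = (6 * r\<^sup>2 * B ^ 3) * (z * z * v) * v\<^sup>2"
      by (simp add: power2_eq_square power3_eq_cube)
    also have "\<dots> \<le> (c * z / 16) * (1 / z) * v\<^sup>2"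
      using zz z0(4) z v0 c(1) by (intro mult_mono) auto
    also have "\<dots> = c * v\<^sup>2 / 16" using z by simp
    finally show ?thesis using \<kappa>b xc by linarith
  qed
  define \<epsilon> where "\<epsilon> = total_err K n Q (L K) u"
  have \<epsilon>0: "0 \<le> \<epsilon>" unfolding \<epsilon>_def by (rule total_err_nonneg)
  define \<Delta> where "\<Delta> = (2 * l * (B * v))\<^sup>2"
  have "cmod (hchar u n - exp (- (real n * x / 2))) \<le>
     exp (- (real n * x / 4)) * (2 * \<Delta> + 2 * real (2 * L K) * x + real n * (4 * \<kappa> + x\<^sup>2)) + 2 * (real n + 1)\<^sup>2 * \<epsilon>"
  proof (rule perturbed_decay[of "hchar u" x "2 * L K" \<kappa> \<epsilon> \<Delta> n, OF norm_hchar_le x0 x1 _ \<kappa>0 \<kappa>x \<epsilon>0])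
    show "real (2 * L K) * x \<le> 1" using Wx by (simp add: l_def)
    show "cmod (hchar u m - 1) \<le> \<Delta>" if "m \<le> 2 * L K" for m
    proof -
      have "real m \<le> 2 * l" using that by (simp add: l_def)
      then have "(real m * (B * v))\<^sup>2 \<le> \<Delta>"
        unfolding \<Delta>_def using B_pos v0 by (intro power_mono mult_right_mono) auto
      then show ?thesis using hchar_near_1[of u m] by (simp add: v_def)
    qed
    show "cmod (hchar u m - (1 - x / 2) * hchar u (m - 1)) \<le> \<kappa> * b + \<epsilon>"
      if "2 * L K < m" "m \<le> n" "\<And>i. i \<in> {1..2 * L K} \<Longrightarrow> cmod (hchar u (m - i)) \<le> b" for m b
      using hchar_recurrence[of u Q K L m n b, OF _ Q1 K L_def that(1,2,3) small] v1
      by (simp add: x_def \<kappa>_def \<epsilon>_def l_def v_def)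
  qed
  also have "\<dots> \<le> exp (- (c / 4 * real n * v\<^sup>2)) * ((8 * r\<^sup>2 * B\<^sup>2 + 4 * r * s + 24 * r\<^sup>2 * B ^ 3 + s\<^sup>2) * z\<^sup>2 * (v\<^sup>2 + real n * v ^ 3)) + 2 * (real n + 1)\<^sup>2 * \<epsilon>"
  proof (rule add_mono[OF mult_mono order_refl])
    have "real n * (c * v\<^sup>2) \<le> real n * x" using xc by (rule mult_left_mono) simp
    then show "exp (- (real n * x / 4)) \<le> exp (- (c / 4 * real n * v\<^sup>2))" by (simp add: mult_ac)
    have z2: "1 \<le> z\<^sup>2" "z \<le> z\<^sup>2" using z by (simp_all add: self_le_power)
    have a1: "2 * \<Delta> \<le> 8 * r\<^sup>2 * B\<^sup>2 * z\<^sup>2 * v\<^sup>2"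
    proof -
      have "\<Delta> \<le> (2 * (r * z) * (B * v))\<^sup>2"
        unfolding \<Delta>_def using lz l0 B_pos v0 by (intro power_mono mult_right_mono) auto
      then show ?thesis by (simp add: power_mult_distrib mult_ac)
    qed
    have a2: "2 * real (2 * L K) * x \<le> 4 * r * s * z\<^sup>2 * v\<^sup>2"
    proof -
      have "2 * real (2 * L K) * x = 4 * l * x" by (simp add: l_def)
      also have "\<dots> \<le> 4 * (r * z) * (s * v\<^sup>2)"
        using lz l0 xs x0 r1 z by (intro mult_mono) auto
      also have "\<dots> = (4 * r * s * v\<^sup>2) * z" by simp
      also have "\<dots> \<le> (4 * r * s * v\<^sup>2) * z\<^sup>2" using z2 r1 s0 by (intro mult_left_mono) auto
      finally show ?thesis by (simp add: mult_ac)
    qed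
    have a3: "4 * \<kappa> \<le> 24 * r\<^sup>2 * B ^ 3 * z\<^sup>2 * v ^ 3" using \<kappa>b by linarith
    have a4: "x\<^sup>2 \<le> s\<^sup>2 * z\<^sup>2 * v ^ 3"
    proof -
      have "x\<^sup>2 \<le> (s * v\<^sup>2)\<^sup>2" using xs x0 by (intro power_mono) auto
      also have "\<dots> = s\<^sup>2 * (v ^ 3 * v)" by (simp add: power2_eq_square power3_eq_cube)
      also have "\<dots> \<le> s\<^sup>2 * (v ^ 3 * z\<^sup>2)" using v1 z2 v0 by (intro mult_left_mono) auto
      finally show ?thesis by (simp add: mult_ac)
    qed
    have "2 * \<Delta> + 2 * real (2 * L K) * x + real n * (4 * \<kappa> + x\<^sup>2) \<le>
      8 * r\<^sup>2 * B\<^sup>2 * z\<^sup>2 * v\<^sup>2 + 4 * r * s * z\<^sup>2 * v\<^sup>2 + real n * (24 * r\<^sup>2 * B ^ 3 * z\<^sup>2 * v ^ 3 + s\<^sup>2 * z\<^sup>2 * v ^ 3)"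
      using a1 a2 a3 a4 by (intro add_mono mult_left_mono) auto
    also have "\<dots> \<le> 8 * r\<^sup>2 * B\<^sup>2 * z\<^sup>2 * v\<^sup>2 + 4 * r * s * z\<^sup>2 * v\<^sup>2 + real n * (24 * r\<^sup>2 * B ^ 3 * z\<^sup>2 * v ^ 3 + s\<^sup>2 * z\<^sup>2 * v ^ 3)
      + ((24 * r\<^sup>2 * B ^ 3 + s\<^sup>2) * z\<^sup>2 * v\<^sup>2 + (8 * r\<^sup>2 * B\<^sup>2 + 4 * r * s) * z\<^sup>2 * (real n * v ^ 3))"
      using r1 s0 B_pos v0 by simp
    also have "\<dots> = (8 * r\<^sup>2 * B\<^sup>2 + 4 * r * s + 24 * r\<^sup>2 * B ^ 3 + s\<^sup>2) * z\<^sup>2 * (v\<^sup>2 + real n * v ^ 3)"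
      by (simp add: algebra_simps)
    finally show "2 * \<Delta> + 2 * real (2 * L K) * x + real n * (4 * \<kappa> + x\<^sup>2) \<le>
      (8 * r\<^sup>2 * B\<^sup>2 + 4 * r * s + 24 * r\<^sup>2 * B ^ 3 + s\<^sup>2) * z\<^sup>2 * (v\<^sup>2 + real n * v ^ 3)" .
    show "0 \<le> 2 * \<Delta> + 2 * real (2 * L K) * x + real n * (4 * \<kappa> + x\<^sup>2)"
      using x0 \<kappa>0 by (simp add: \<Delta>_def)
  qed simp
  finally show ?thesis by (simp add: x_def v_def \<epsilon>_def L_def mult_ac)
qed

text \<open>
  The first term comes from decorrelation and is exponentially small in \<open>z\<close>; the second comes from stopping after
  \<open>K\<close> levels, each of which gains a factor \<open>B norm u L \<le> const / z\<^sup>2\<close>.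
\<close>

lemma total_err_bound:
  fixes z :: real and K Q n :: nat
  assumes n: "1 \<le> n" and z: "1 \<le> z" and Q: "z \<le> real Q" "real Q \<le> 2 * z"
    and u: "norm u \<le> 1 / z ^ 3"
  defines "r \<equiv> 2 * real (R + 1) ^ K"
    and "C \<equiv> 2 ^ K * (1 + (real K + 1) * H) * poly P 1"
  shows "total_err K n Q ((R + 1) ^ K * Q) u \<le>
    ((r + 2 * real K * r ^ (K + 2)) * C + corr_const / (1 - \<delta>)) * (real n ^ (degree P + 1) * z ^ (K + 2) * \<delta> powr z)
    + 2 * r\<^sup>2 * (B * r) ^ K * (z\<^sup>2 / z ^ (2 * K))"
proof -
  define l where "l = real ((R + 1) ^ K * Q)"
  define E where "E = C * (real n ^ (degree P + 1) * \<delta> powr z)"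
  have r1: "1 \<le> r"
  proof -
    have "1 \<le> real (R + 1) ^ K" by (rule one_le_power) simp
    then show ?thesis unfolding r_def by linarith
  qed
  have l0: "0 \<le> l" by (simp add: l_def)
  have lz: "l \<le> r * z"
  proof -
    have "l = real (R + 1) ^ K * real Q" by (simp add: l_def)
    also have "\<dots> \<le> real (R + 1) ^ K * (2 * z)" by (rule mult_left_mono[OF Q(2)]) simp
    finally show ?thesis by (simp add: r_def mult_ac)
  qed
  have n1: "1 \<le> real n" using n by simp
  have C0: "0 \<le> C" unfolding C_def using H_nonneg poly_mono_nonneg(2)[OF P_nonneg, of 1 1] by simp
  have E0: "0 \<le> E" unfolding E_def using C0 by simp
  have \<delta>Q: "\<delta> ^ Q \<le> \<delta> powr z"
  proof -
    have "\<delta> powr real Q \<le> \<delta> powr z" using Q \<delta> by (intro powr_mono') auto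
    then show ?thesis using \<delta> by (simp add: powr_realpow)
  qed
  have errE: "err K n Q \<le> E"
  proof -
    have p: "poly P (real n) \<le> poly P 1 * real n ^ degree P"
    proof -
      have "poly P (real n) \<le> (\<Sum>i\<le>degree P. coeff P i * real n ^ degree P)"
        unfolding poly_altdef using n1 P_nonneg by (intro sum_mono mult_left_mono power_increasing) auto
      then show ?thesis by (simp add: poly_altdef sum_distrib_right)
    qed
    have "1 + (real K + real n) * H \<le> (1 + (real K + 1) * H) * real n"
    proof -
      have "real K * H * 1 \<le> real K * H * real n" using n1 H_nonneg by (intro mult_left_mono) auto
      then show ?thesis using n1 by (simp add: algebra_simps)
    qed
    then have "err K n Q \<le> 2 ^ K * ((1 + (real K + 1) * H) * real n) * (poly P 1 * real n ^ degree P) * \<delta> powr z"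
      unfolding err_def using p \<delta>Q H_nonneg poly_mono_nonneg(2)[OF P_nonneg, of "real n" "real n"] \<delta> n1
        poly_mono_nonneg(2)[OF P_nonneg, of 1 1]
      by (intro mult_mono) auto
    then show ?thesis by (simp add: E_def C_def mult_ac)
  qed
  have tr: "trunc_err K n Q ((R + 1) ^ K * Q) u \<le> real K * r ^ K * z ^ K * E + (B * r) ^ K / z ^ (2 * K)"
    unfolding trunc_err_def l_def[symmetric]
  proof (rule add_mono)
    have "real K * l ^ K * err K n Q \<le> real K * (r * z) ^ K * E"
      using lz l0 errE err_nonneg r1 z by (intro mult_mono power_mono) auto
    then show "real K * l ^ K * err K n Q \<le> real K * r ^ K * z ^ K * E" by (simp add: power_mult_distrib mult_ac)
    have "B * norm u * l \<le> B * (1 / z ^ 3) * (r * z)"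
      using lz l0 u B_pos r1 z by (intro mult_mono) auto
    also have "\<dots> = B * r / z ^ 2" using z by (simp add: field_simps power2_eq_square power3_eq_cube)
    finally have "(B * norm u * l) ^ K \<le> (B * r / z ^ 2) ^ K"
      using B_pos l0 by (intro power_mono) auto
    then show "(B * norm u * l) ^ K \<le> (B * r) ^ K / z ^ (2 * K)"
      by (simp add: power_divide power_mult)
  qed
  have "total_err K n Q ((R + 1) ^ K * Q) u \<le> (r * z) * E + 2 * (r * z)\<^sup>2 * (real K * r ^ K * z ^ K * E + (B * r) ^ K / z ^ (2 * K)) + corr_const * \<delta> powr z / (1 - \<delta>)"
    unfolding total_err_def l_def[symmetric]
  proof (intro add_mono)
    show "l * err K n Q \<le> (r * z) * E" using lz errE err_nonneg r1 z by (intro mult_mono) auto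
    show "2 * l\<^sup>2 * trunc_err K n Q ((R + 1) ^ K * Q) u \<le> 2 * (r * z)\<^sup>2 * (real K * r ^ K * z ^ K * E + (B * r) ^ K / z ^ (2 * K))"
      using lz l0 tr trunc_err_nonneg by (intro mult_mono power_mono) auto
    show "corr_const * \<delta> ^ Q / (1 - \<delta>) \<le> corr_const * \<delta> powr z / (1 - \<delta>)"
      using \<delta>Q \<delta> corr_const_nonneg by (intro divide_right_mono mult_left_mono) auto
  qed
  also have "\<dots> = r * (z * E) + 2 * real K * r ^ (K + 2) * (z ^ (K + 2) * E) + 2 * r\<^sup>2 * (B * r) ^ K * (z\<^sup>2 / z ^ (2 * K)) + corr_const / (1 - \<delta>) * (\<delta> powr z)"
    by (simp add: algebra_simps power_add power_mult_distrib power2_eq_square)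
  also have "\<dots> \<le> r * (z ^ (K + 2) * E) + 2 * real K * r ^ (K + 2) * (z ^ (K + 2) * E) + 2 * r\<^sup>2 * (B * r) ^ K * (z\<^sup>2 / z ^ (2 * K))
     + corr_const / (1 - \<delta>) * (real n ^ (degree P + 1) * z ^ (K + 2) * \<delta> powr z)"
  proof (intro add_mono order_refl)
    show "r * (z * E) \<le> r * (z ^ (K + 2) * E)"
      using z r1 E0 by (intro mult_left_mono mult_right_mono self_le_power) auto
    have "1 * 1 \<le> real n ^ (degree P + 1) * z ^ (K + 2)"
      by (intro mult_mono one_le_power) (use n1 z in auto)
    then have "1 * \<delta> powr z \<le> (real n ^ (degree P + 1) * z ^ (K + 2)) * \<delta> powr z"
      by (intro mult_right_mono) auto
    then show "corr_const / (1 - \<delta>) * (\<delta> powr z) \<le> corr_const / (1 - \<delta>) * (real n ^ (degree P + 1) * z ^ (K + 2) * \<delta> powr z)"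
      using corr_const_nonneg \<delta> by (intro mult_left_mono) auto
  qed
  also have "\<dots> = ((r + 2 * real K * r ^ (K + 2)) * C + corr_const / (1 - \<delta>)) * (real n ^ (degree P + 1) * z ^ (K + 2) * \<delta> powr z)
    + 2 * r\<^sup>2 * (B * r) ^ K * (z\<^sup>2 / z ^ (2 * K))"
    by (simp add: E_def algebra_simps)
  finally show ?thesis .
qed

lemma superpolynomially_small:
  fixes \<beta> A Ca Cb \<delta>' :: real and K p :: nat
  assumes \<beta>: "0 < \<beta>" and \<delta>': "0 < \<delta>'" "\<delta>' < 1" and K: "A + 2 < \<beta> * (2 * real K - 2)"
  shows "eventually (\<lambda>n. 2 * (real n + 1)\<^sup>2 * (Ca * (real n ^ p * (real n powr \<beta>) ^ (K + 2) * \<delta>' powr (real n powr \<beta>))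
    + Cb * ((real n powr \<beta>)\<^sup>2 / (real n powr \<beta>) ^ (2 * K))) \<le> real n powr (- A)) sequentially"
proof -
  define \<theta> where "\<theta> = - ln \<delta>'"
  have \<theta>: "0 < \<theta>" using \<delta>' by (simp add: \<theta>_def)
  define s where "s = A + 2 + real p + \<beta> * real (K + 2)"
  define t where "t = A + 2 + \<beta> * (2 - 2 * real K)"
  have t: "t < 0" using K by (simp add: t_def algebra_simps)
  have 1: "(\<lambda>n. real n powr s * exp (- \<theta> * real n powr \<beta>)) \<longlonglongrightarrow> 0" using \<beta> \<theta> by real_asymp
  have 2: "(\<lambda>n. real n powr t) \<longlonglongrightarrow> 0" using t by real_asymp
  have "(\<lambda>n. 8 * \<bar>Ca\<bar> * (real n powr s * exp (- \<theta> * real n powr \<beta>)) + 8 * \<bar>Cb\<bar> * real n powr t) \<longlonglongrightarrow> 8 * \<bar>Ca\<bar> * 0 + 8 * \<bar>Cb\<bar> * 0"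
    by (intro tendsto_intros 1 2)
  then have "eventually (\<lambda>n. 8 * \<bar>Ca\<bar> * (real n powr s * exp (- \<theta> * real n powr \<beta>)) + 8 * \<bar>Cb\<bar> * real n powr t < 1) sequentially"
    by (intro order_tendstoD(2)) auto
  then show ?thesis
    using eventually_gt_at_top[of 0]
  proof eventually_elim
    case (elim n)
    have n: "1 \<le> real n" using elim by simp
    define z where "z = real n powr \<beta>"
    have z0: "0 < z" using n by (simp add: z_def)
    define X where "X = real n ^ p * z ^ (K + 2) * \<delta>' powr z"
    define Y where "Y = z\<^sup>2 / z ^ (2 * K)"
    have X0: "0 \<le> X" "0 \<le> Y" using z0 by (simp_all add: X_def Y_def)
    have pn2: "(real n)\<^sup>2 = real n powr 2" using n by simp
    have pn: "real n ^ p = real n powr real p" using n by (simp add: powr_realpow)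
    have pz: "z ^ k = real n powr (\<beta> * real k)" for k
      using z0 n by (simp add: z_def powr_powr[symmetric] powr_realpow)
    have X: "(real n)\<^sup>2 * X = real n powr (- A) * (real n powr s * exp (- \<theta> * z))"
    proof -
      have "(real n)\<^sup>2 * real n ^ p * z ^ (K + 2) = real n powr (2 + real p + \<beta> * real (K + 2))"
        by (simp only: pn pn2 pz powr_add)
      also have "\<dots> = real n powr (- A) * real n powr s"
        unfolding s_def powr_add[symmetric] by (simp add: algebra_simps)
      finally have "(real n)\<^sup>2 * X = real n powr (- A) * real n powr s * \<delta>' powr z"
        unfolding X_def by (simp only: mult.assoc[symmetric])
      moreover have "\<delta>' powr z = exp (- \<theta> * z)" using \<delta>' by (simp add: powr_def \<theta>_def mult.commute)
      ultimately show ?thesis by (simp only: mult.assoc)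
    qed
    have Y: "(real n)\<^sup>2 * Y = real n powr (- A) * real n powr t"
    proof -
      have "(real n)\<^sup>2 * Y = real n powr (2 + (\<beta> * real 2 - \<beta> * real (2 * K)))"
        unfolding Y_def by (simp only: pn2 pz powr_add powr_diff)
      also have "\<dots> = real n powr (- A) * real n powr t"
        unfolding t_def powr_add[symmetric] by (simp add: algebra_simps)
      finally show ?thesis .
    qed
    have "(real n + 1)\<^sup>2 \<le> (2 * real n)\<^sup>2" using n by (intro power_mono) auto
    then have sq: "2 * (real n + 1)\<^sup>2 \<le> 8 * (real n)\<^sup>2" by (simp add: power_mult_distrib)
    have "2 * (real n + 1)\<^sup>2 * (Ca * X + Cb * Y) \<le> 2 * (real n + 1)\<^sup>2 * (\<bar>Ca\<bar> * X + \<bar>Cb\<bar> * Y)"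
      using X0 by (intro mult_left_mono add_mono mult_right_mono) auto
    also have "\<dots> \<le> 8 * (real n)\<^sup>2 * (\<bar>Ca\<bar> * X + \<bar>Cb\<bar> * Y)"
      using X0 by (intro mult_right_mono sq) auto
    also have "\<dots> = 8 * \<bar>Ca\<bar> * ((real n)\<^sup>2 * X) + 8 * \<bar>Cb\<bar> * ((real n)\<^sup>2 * Y)" by (simp add: algebra_simps)
    also have "\<dots> = real n powr (- A) * (8 * \<bar>Ca\<bar> * (real n powr s * exp (- \<theta> * z)) + 8 * \<bar>Cb\<bar> * real n powr t)"
      unfolding X Y by (simp add: algebra_simps)
    also have "\<dots> \<le> real n powr (- A) * 1"
      using elim by (intro mult_left_mono) (auto simp: z_def)
    finally show ?case unfolding X_def Y_def z_def by simp
  qed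
qed

text \<open>
  The number of levels \<open>K\<close> is chosen so large that \<open>n^2 z^(2 - 2K)\<close> is below \<open>n^(-A)\<close>.
\<close>

proposition hchar_estimate:
  assumes inv: "invertible (asymp_cov M T f)" and \<beta>: "0 < \<beta>"
  shows "\<exists>C\<ge>0. \<exists>c>0. eventually (\<lambda>n. \<forall>u. norm u \<le> 1 / (real n powr \<beta>) ^ 3 \<longrightarrow>
    cmod (hchar u n - exp (- (real n * sigma2 u / 2))) \<le>
      C * (real n powr \<beta>)\<^sup>2 * exp (- (c * real n * (norm u)\<^sup>2)) * ((norm u)\<^sup>2 + real n * norm u ^ 3) + real n powr (- A)) sequentially"
proof -
  obtain c where c: "0 < c" "\<And>u. c * (norm u)\<^sup>2 \<le> sigma2 u" using sigma2_lower[OF inv] by blast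
  obtain K0 :: nat where K0: "(\<bar>A\<bar> + 2) / \<beta> < real K0" using reals_Archimedean2 by blast
  \<comment> \<open>At least three levels are needed for the second-order expansion.\<close>
  define K where "K = K0 + 3"
  have K3: "3 \<le> K" by (simp add: K_def)
  have "\<bar>A\<bar> + 2 < \<beta> * real K0" using K0 \<beta> by (simp add: field_simps)
  also have "\<dots> \<le> \<beta> * (2 * real K - 2)" using \<beta> by (intro mult_left_mono) (auto simp: K_def)
  finally have KA: "A + 2 < \<beta> * (2 * real K - 2)" by linarith
  define r where "r = 2 * real (R + 1) ^ K"
  define s where "s = corr_const * (1 + 2 / (1 - \<delta>))"
  define C where "C = 8 * r\<^sup>2 * B\<^sup>2 + 4 * r * s + 24 * r\<^sup>2 * B ^ 3 + s\<^sup>2"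
  define C' where "C' = 2 ^ K * (1 + (real K + 1) * H) * poly P 1"
  have s0: "0 \<le> s" using corr_const_nonneg \<delta> by (simp add: s_def)
  have r0: "0 \<le> r" by (simp add: r_def)
  have C0: "0 \<le> C" unfolding C_def using r0 s0 B_pos by simp
  have zinf: "filterlim (\<lambda>n::nat. real n powr \<beta>) at_top sequentially" using \<beta> by real_asymp
  define z0 where "z0 = Max {1, 2 * B * r, s, 2 * r * s, 96 * r\<^sup>2 * B ^ 3 / c}"
  have "eventually (\<lambda>n. z0 \<le> real n powr \<beta>) sequentially"
    using zinf by (simp add: filterlim_at_top)
  moreover note superpolynomially_small[OF \<beta> \<delta> KA, of "(r + 2 * real K * r ^ (K + 2)) * C' + corr_const / (1 - \<delta>)" "degree P + 1" "2 * r\<^sup>2 * (B * r) ^ K"]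
  ultimately have "eventually (\<lambda>n. \<forall>u. norm u \<le> 1 / (real n powr \<beta>) ^ 3 \<longrightarrow>
    cmod (hchar u n - exp (- (real n * sigma2 u / 2))) \<le>
      C * (real n powr \<beta>)\<^sup>2 * exp (- (c / 4 * real n * (norm u)\<^sup>2)) * ((norm u)\<^sup>2 + real n * norm u ^ 3) + real n powr (- A)) sequentially"
    using eventually_gt_at_top[of 0]
  proof eventually_elim
    case (elim n)
    define z where "z = real n powr \<beta>"
    define Q where "Q = nat \<lceil>z\<rceil>"
    have z0: "1 \<le> z" "2 * B * r \<le> z" "s \<le> z" "2 * r * s \<le> z" "96 * r\<^sup>2 * B ^ 3 / c \<le> z"
      using elim(1) by (simp_all add: z0_def z_def)
    have z5: "96 * r\<^sup>2 * B ^ 3 \<le> c * z" using z0(5) c(1) by (simp add: field_simps)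
    have Q: "z \<le> real Q" "real Q \<le> 2 * z" using z0(1) unfolding Q_def by linarith+
    have n1: "1 \<le> n" using elim by simp
    show ?case
      unfolding z_def[symmetric]
    proof (intro allI impI)
      fix u :: "real^'d" assume u: "norm u \<le> 1 / z ^ 3"
      have "cmod (hchar u n - exp (- (real n * sigma2 u / 2))) \<le>
        C * z\<^sup>2 * exp (- (c / 4 * real n * (norm u)\<^sup>2)) * ((norm u)\<^sup>2 + real n * norm u ^ 3)
        + 2 * (real n + 1)\<^sup>2 * total_err K n Q ((R + 1) ^ K * Q) u"
        unfolding C_def
        by (rule hchar_estimate_at[OF K3 z0(1) Q c u, folded r_def s_def, OF z0(2,3,4) z5])
      also have "2 * (real n + 1)\<^sup>2 * total_err K n Q ((R + 1) ^ K * Q) u \<le> real n powr (- A)"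
      proof -
        have "2 * (real n + 1)\<^sup>2 * total_err K n Q ((R + 1) ^ K * Q) u \<le>
          2 * (real n + 1)\<^sup>2 * (((r + 2 * real K * r ^ (K + 2)) * C' + corr_const / (1 - \<delta>)) * (real n ^ (degree P + 1) * z ^ (K + 2) * \<delta> powr z)
            + 2 * r\<^sup>2 * (B * r) ^ K * (z\<^sup>2 / z ^ (2 * K)))"
          unfolding C'_def r_def by (intro mult_left_mono total_err_bound[OF n1 z0(1) Q u]) simp
        also have "\<dots> \<le> real n powr (- A)" using elim(2) unfolding z_def .
        finally show ?thesis .
      qed
      finally show "cmod (hchar u n - exp (- (real n * sigma2 u / 2))) \<le>
        C * z\<^sup>2 * exp (- (c / 4 * real n * (norm u)\<^sup>2)) * ((norm u)\<^sup>2 + real n * norm u ^ 3) + real n powr (- A)"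
        by simp
    qed
  qed
  then show ?thesis using C0 c(1) by (intro exI[of _ C] conjI exI[of _ "c / 4"]) auto
qed

end

section \<open>Central limit theorem with rate\<close>

lemma exp_power_bound:
  assumes c: "0 < c" and t: "0 \<le> (t::real)"
  shows "exp (- (c * t\<^sup>2)) * (t\<^sup>2 + t ^ 3) \<le> (4 / c + 8 / c\<^sup>2) * exp (- (c / 2 * t\<^sup>2))"
proof -
  define y where "y = c / 2 * t\<^sup>2"
  have y0: "0 \<le> y" using c by (simp add: y_def)
  have y1: "y \<le> exp y" using exp_ge_add_one_self[of y] by linarith
  have y2: "y\<^sup>2 / 2 \<le> exp y" using exp_lower_Taylor_quadratic[OF y0] y0 by simp
  have t2: "t\<^sup>2 = 2 / c * y" using c by (simp add: y_def)
  have t4: "t ^ 4 = 8 / c\<^sup>2 * (y\<^sup>2 / 2)"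
  proof -
    have "t ^ 4 = (t\<^sup>2)\<^sup>2" by simp
    then show ?thesis unfolding t2 by (simp add: power_mult_distrib power_divide)
  qed
  have t3: "t ^ 3 \<le> t\<^sup>2 + t ^ 4"
  proof -
    have "0 \<le> (t - t\<^sup>2)\<^sup>2" by simp
    then have "2 * t ^ 3 \<le> t\<^sup>2 + t ^ 4" by (simp add: power2_eq_square power3_eq_cube power4_eq_xxxx algebra_simps)
    moreover have "0 \<le> t ^ 3" using t by simp
    ultimately show ?thesis by linarith
  qed
  have "t\<^sup>2 + t ^ 3 \<le> 2 * t\<^sup>2 + t ^ 4" using t3 by simp
  also have "\<dots> = 4 / c * y + 8 / c\<^sup>2 * (y\<^sup>2 / 2)" unfolding t4 by (subst t2) simp
  also have "\<dots> \<le> 4 / c * exp y + 8 / c\<^sup>2 * exp y"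
    using c by (intro add_mono mult_left_mono y1 y2) auto
  finally have le: "t\<^sup>2 + t ^ 3 \<le> (4 / c + 8 / c\<^sup>2) * exp y" by (simp add: algebra_simps)
  have "exp (- (c * t\<^sup>2)) * (t\<^sup>2 + t ^ 3) \<le> exp (- (c * t\<^sup>2)) * ((4 / c + 8 / c\<^sup>2) * exp y)"
    by (rule mult_left_mono[OF le]) simp
  also have "\<dots> = (4 / c + 8 / c\<^sup>2) * exp (- (c / 2 * t\<^sup>2))"
    by (simp add: y_def flip: exp_add)
  finally show ?thesis .
qed

context decorrelated_observable
begin

lemma normalized_meas [measurable]: "normalized_sum T f n \<in> borel_measurable M"
  unfolding normalized_sum_def[abs_def] by measurable

lemma osc_eq_birkhoff: "osc u 0 n x = cis (u \<bullet> birkhoff_sum T f n x)"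
  unfolding osc_def inner_birkhoff by (simp add: cis_sum atLeast0LessThan)

lemma char_fun_normalized:
  "char_fun (distr M borel (normalized_sum T f n)) s = hchar ((1 / sqrt (real n)) *\<^sub>R s) n"
proof -
  have "char_fun (distr M borel (normalized_sum T f n)) s = (\<integral>x. cis (s \<bullet> normalized_sum T f n x) \<partial>M)"
    unfolding char_fun_def by (rule integral_distr) measurable
  then show ?thesis by (simp add: hchar_def osc_eq_birkhoff normalized_sum_def)
qed

lemma char_fun_limit:
  assumes "invertible (asymp_cov M T f)"
  shows "char_fun (normal_distr 0 (asymp_cov M T f)) s = of_real (exp (- (sigma2 s / 2)))"
  unfolding char_fun_def
  using normal_distr_properties(3)[OF asymp_cov_sym asymp_cov_pos[OF assms], of s]
  by (simp add: sigma2_eq_corr_sum asymp_cov_form)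

lemma sigma2_scale: "sigma2 (t *\<^sub>R u) = t\<^sup>2 * sigma2 u"
  using asymp_cov_form[of "t *\<^sub>R u" "t *\<^sub>R u"] asymp_cov_form[of u u]
  by (simp add: sigma2_eq_corr_sum matrix_vector_mult_scaleR power2_eq_square mult_ac)

text \<open>
  Let \<open>z = n^\<beta>\<close>. For \<open>norm s \<le> sqrt n / z^3\<close>, \<open>hchar_estimate\<close> applies to \<open>u = s / sqrt n\<close>. Beyond, \<open>\<epsilon> norm s \<ge> z\<close>, so the
  Gaussian factor is at most \<open>exp (- z\<^sup>2 / 4) exp (- (\<epsilon> norm s)\<^sup>2 / 4)\<close>. The error \<open>n^(-A)\<close> and this remainder are
  integrated against \<open>exp (- (\<epsilon> norm s)\<^sup>2 / 4)\<close>, whose integral is at most a constant times \<open>n^(d/2)\<close>.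
\<close>

proposition char_fun_distance:
  assumes inv: "invertible (asymp_cov M T f)" and \<beta>: "0 < \<beta>" "\<beta> \<le> 1 / 10"
  defines "\<epsilon> \<equiv> \<lambda>n::nat. (real n powr \<beta>) ^ 4 / sqrt (real n)"
  shows "\<exists>C\<ge>0. eventually (\<lambda>n. (\<integral>s. cmod (char_fun (distr M borel (normalized_sum T f n)) s
      - char_fun (normal_distr 0 (asymp_cov M T f)) s) * exp (- ((\<epsilon> n)\<^sup>2 * (norm s)\<^sup>2) / 2) \<partial>lborel)
    \<le> C * ((real n powr \<beta>)\<^sup>2 / sqrt (real n))) sequentially"
proof -
  define d where "d = real CARD('d)"
  define A where "A = d / 2 + 1 / 2"
  obtain C c where C: "0 \<le> C" and c: "0 < c" and ev: "eventually (\<lambda>n. \<forall>u. norm u \<le> 1 / (real n powr \<beta>) ^ 3 \<longrightarrow>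
    cmod (hchar u n - exp (- (real n * sigma2 u / 2))) \<le>
      C * (real n powr \<beta>)\<^sup>2 * exp (- (c * real n * (norm u)\<^sup>2)) * ((norm u)\<^sup>2 + real n * norm u ^ 3) + real n powr (- A)) sequentially"
    using hchar_estimate[OF inv \<beta>(1), of A] by blast
  define C1 where "C1 = C * (4 / c + 8 / c\<^sup>2)"
  have C1: "0 \<le> C1" using C c by (simp add: C1_def)
  define C2 where "C2 = C1 * sqrt (pi / (c / 2)) ^ CARD('d) + 3 * sqrt (4 * pi) ^ CARD('d)"
  have C2: "0 \<le> C2" using C1 c by (simp add: C2_def)
  have "(\<lambda>n. real n powr A * exp (- (1 / 4 * (real n powr \<beta>)\<^sup>2))) \<longlonglongrightarrow> 0"
    using \<beta>(1) by real_asymp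
  then have "eventually (\<lambda>n. real n powr A * exp (- (1 / 4 * (real n powr \<beta>)\<^sup>2)) < 1) sequentially"
    by (rule order_tendstoD(2)) simp
  then have "eventually (\<lambda>n. (\<integral>s. cmod (char_fun (distr M borel (normalized_sum T f n)) s
      - char_fun (normal_distr 0 (asymp_cov M T f)) s) * exp (- ((\<epsilon> n)\<^sup>2 * (norm s)\<^sup>2) / 2) \<partial>lborel)
    \<le> C2 * ((real n powr \<beta>)\<^sup>2 / sqrt (real n))) sequentially"
    using ev eventually_gt_at_top[of 0]
  proof eventually_elim
    case (elim n)
    have n1: "1 \<le> real n" using elim(3) by simp
    define z where "z = real n powr \<beta>"
    have z1: "1 \<le> z" using n1 \<beta> by (simp add: z_def ge_one_powr_ge_zero)
    define rn where "rn = sqrt (real n)"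
    have rn: "1 \<le> rn" "rn\<^sup>2 = real n" using n1 by (simp_all add: rn_def)
    define e where "e = z ^ 4 / rn"
    have e: "\<epsilon> n = e" by (simp add: \<epsilon>_def e_def z_def rn_def)
    have e0: "0 < e" using z1 rn by (simp add: e_def)
    define P where "P = distr M borel (normalized_sum T f n)"
    define G where "G = normal_distr 0 (asymp_cov M T f)"
    define b where "b = C1 * z\<^sup>2 / rn"
    have b0: "0 \<le> b" using C1 rn by (simp add: b_def)
    have exA: "exp (- (z\<^sup>2 / 4)) \<le> real n powr (- A)"
    proof -
      have "real n powr A * exp (- (z\<^sup>2 / 4)) \<le> 1" using elim(1) by (simp add: z_def)
      then show ?thesis using n1 by (simp add: powr_minus field_simps)
    qed
    define k where "k s = b * exp (- (c / 2 * (norm s)\<^sup>2)) + 3 * real n powr (- A) * exp (- (e\<^sup>2 / 4 * (norm s)\<^sup>2))" for s :: "real^'d"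
    have pw: "cmod (char_fun P s - char_fun G s) * exp (- (e\<^sup>2 * (norm s)\<^sup>2) / 2) \<le> k s" for s
    proof (cases "norm s \<le> rn / z ^ 3")
      case True
      define u where "u = (1 / rn) *\<^sub>R s"
      have nu: "norm u = norm s / rn" using rn by (simp add: u_def)
      have "norm u \<le> 1 / z ^ 3" using True rn z1 by (simp add: nu field_simps)
      then have "cmod (hchar u n - exp (- (real n * sigma2 u / 2))) \<le>
        C * z\<^sup>2 * exp (- (c * real n * (norm u)\<^sup>2)) * ((norm u)\<^sup>2 + real n * norm u ^ 3) + real n powr (- A)"
        using elim(2) unfolding z_def by blast
      also have "c * real n * (norm u)\<^sup>2 = c * (norm s)\<^sup>2"
        using rn elim(3) by (simp add: nu power_divide)
      also have "hchar u n = char_fun P s" unfolding P_def char_fun_normalized u_def rn_def ..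
      also have "real n * sigma2 u / 2 = sigma2 s / 2"
        using rn elim(3) by (simp add: u_def sigma2_scale power_divide)
      also have "complex_of_real (exp (- (sigma2 s / 2))) = char_fun G s"
        unfolding G_def char_fun_limit[OF inv] ..
      also have "C * z\<^sup>2 * exp (- (c * (norm s)\<^sup>2)) * ((norm u)\<^sup>2 + real n * norm u ^ 3) \<le> b * exp (- (c / 2 * (norm s)\<^sup>2))"
      proof -
        have "(norm u)\<^sup>2 \<le> (norm s)\<^sup>2 / rn"
        proof -
          have "rn * 1 \<le> rn * rn" using rn by (intro mult_left_mono) auto
          then have "(norm s)\<^sup>2 / (rn * rn) \<le> (norm s)\<^sup>2 / rn" using rn by (intro divide_left_mono) auto
          moreover have "(norm u)\<^sup>2 = (norm s)\<^sup>2 / (rn * rn)" by (simp add: nu power2_eq_square)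
          ultimately show ?thesis by simp
        qed
        moreover have "real n * norm u ^ 3 = norm s ^ 3 / rn"
          unfolding nu rn(2)[symmetric] using rn(1) by (simp add: power2_eq_square power3_eq_cube)
        ultimately have "(norm u)\<^sup>2 + real n * norm u ^ 3 \<le> ((norm s)\<^sup>2 + norm s ^ 3) / rn"
          by (simp add: add_divide_distrib)
        then have "C * z\<^sup>2 * exp (- (c * (norm s)\<^sup>2)) * ((norm u)\<^sup>2 + real n * norm u ^ 3) \<le>
          C * z\<^sup>2 * exp (- (c * (norm s)\<^sup>2)) * (((norm s)\<^sup>2 + norm s ^ 3) / rn)"
          using C by (intro mult_left_mono) auto
        also have "\<dots> = C * z\<^sup>2 / rn * (exp (- (c * (norm s)\<^sup>2)) * ((norm s)\<^sup>2 + norm s ^ 3))" by simp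
        also have "\<dots> \<le> C * z\<^sup>2 / rn * ((4 / c + 8 / c\<^sup>2) * exp (- (c / 2 * (norm s)\<^sup>2)))"
          by (rule mult_left_mono[OF exp_power_bound[OF c norm_ge_zero]]) (use C rn in auto)
        also have "\<dots> = b * exp (- (c / 2 * (norm s)\<^sup>2))" by (simp add: b_def C1_def mult_ac)
        finally show ?thesis .
      qed
      finally have main: "cmod (char_fun P s - char_fun G s) \<le> b * exp (- (c / 2 * (norm s)\<^sup>2)) + real n powr (- A)" by simp
      have "cmod (char_fun P s - char_fun G s) * exp (- (e\<^sup>2 * (norm s)\<^sup>2) / 2) \<le>
        (b * exp (- (c / 2 * (norm s)\<^sup>2)) + real n powr (- A)) * exp (- (e\<^sup>2 * (norm s)\<^sup>2) / 2)"
        by (rule mult_right_mono[OF main]) simp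
      also have "\<dots> = b * exp (- (c / 2 * (norm s)\<^sup>2)) * exp (- (e\<^sup>2 * (norm s)\<^sup>2) / 2) + real n powr (- A) * exp (- (e\<^sup>2 * (norm s)\<^sup>2) / 2)"
        by (simp add: algebra_simps)
      also have "\<dots> \<le> b * exp (- (c / 2 * (norm s)\<^sup>2)) * 1 + 3 * real n powr (- A) * exp (- (e\<^sup>2 / 4 * (norm s)\<^sup>2))"
      proof (intro add_mono mult_mono)
        have "0 \<le> e\<^sup>2 * (norm s)\<^sup>2" by simp
        then have "- (e\<^sup>2 * (norm s)\<^sup>2) / 2 \<le> - (e\<^sup>2 / 4 * (norm s)\<^sup>2)" by simp
        then show "exp (- (e\<^sup>2 * (norm s)\<^sup>2) / 2) \<le> exp (- (e\<^sup>2 / 4 * (norm s)\<^sup>2))" by (simp only: exp_le_cancel_iff)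
      qed (use b0 in auto)
      finally show ?thesis by (simp add: k_def)
    next
      case False
      have "z \<le> e * norm s"
      proof -
        have "rn / z ^ 3 \<le> norm s" using False by simp
        then have "e * (rn / z ^ 3) \<le> e * norm s" using e0 by (intro mult_left_mono) auto
        moreover have "e * (rn / z ^ 3) = z" using rn z1 by (simp add: e_def field_simps power3_eq_cube power4_eq_xxxx)
        ultimately show ?thesis by simp
      qed
      then have "z\<^sup>2 \<le> (e * norm s)\<^sup>2" using z1 by (intro power_mono) auto
      then have "- (e\<^sup>2 * (norm s)\<^sup>2) / 2 \<le> - (z\<^sup>2 / 4) + - (e\<^sup>2 / 4 * (norm s)\<^sup>2)"
        by (simp add: power_mult_distrib)
      then have ex: "exp (- (e\<^sup>2 * (norm s)\<^sup>2) / 2) \<le> exp (- (z\<^sup>2 / 4)) * exp (- (e\<^sup>2 / 4 * (norm s)\<^sup>2))"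
        by (simp only: exp_le_cancel_iff flip: exp_add)
      have "cmod (char_fun P s - char_fun G s) \<le> 1 + 1"
      proof (rule order_trans[OF norm_triangle_ineq4 add_mono])
        show "cmod (char_fun P s) \<le> 1" unfolding P_def char_fun_normalized by (rule norm_hchar_le)
        have "0 \<le> sigma2 s" using asymp_cov_nonneg[of s] by (simp add: asymp_cov_form sigma2_eq_corr_sum)
        then show "cmod (char_fun G s) \<le> 1" unfolding G_def char_fun_limit[OF inv] by simp
      qed
      then have "cmod (char_fun P s - char_fun G s) * exp (- (e\<^sup>2 * (norm s)\<^sup>2) / 2) \<le> 3 * (real n powr (- A) * exp (- (e\<^sup>2 / 4 * (norm s)\<^sup>2)))"
        by (intro mult_mono order_trans[OF ex] mult_right_mono exA) auto
      then show ?thesis using b0 by (simp add: k_def add_increasing)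
    qed
    have e4: "0 < e\<^sup>2 / 4" using e0 by simp
    have c2: "0 < c / 2" using c by simp
    have ik1: "integrable lborel (\<lambda>s::real^'d. b * exp (- (c / 2 * (norm s)\<^sup>2)))"
      by (intro integrable_mult_right gaussian_integral(1) c2)
    have ik2: "integrable lborel (\<lambda>s::real^'d. 3 * real n powr (- A) * exp (- (e\<^sup>2 / 4 * (norm s)\<^sup>2)))"
      by (intro integrable_mult_right gaussian_integral(1) e4)
    have ik: "integrable lborel k" unfolding k_def by (rule Bochner_Integration.integrable_add[OF ik1 ik2])
    have "(\<integral>s. cmod (char_fun P s - char_fun G s) * exp (- (e\<^sup>2 * (norm s)\<^sup>2) / 2) \<partial>lborel) \<le> (\<integral>s. k s \<partial>lborel)"
      by (rule integral_mono'[OF ik pw]) (use b0 in \<open>simp add: k_def\<close>)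
    also have "\<dots> = b * sqrt (pi / (c / 2)) ^ CARD('d) + 3 * real n powr (- A) * sqrt (pi / (e\<^sup>2 / 4)) ^ CARD('d)"
      unfolding k_def Bochner_Integration.integral_add[OF ik1 ik2] integral_mult_right_zero
      by (simp only: gaussian_integral(2)[OF c2, where 'b="real^'d"] gaussian_integral(2)[OF e4, where 'b="real^'d"]) simp
    also have "3 * real n powr (- A) * sqrt (pi / (e\<^sup>2 / 4)) ^ CARD('d) \<le> 3 * sqrt (4 * pi) ^ CARD('d) * (z\<^sup>2 / rn)"
    proof -
      have "sqrt (pi / (e\<^sup>2 / 4)) = sqrt (4 * pi) / e"
        using e0 by (simp add: real_sqrt_divide mult.commute)
      also have "\<dots> \<le> sqrt (4 * pi) * rn"
      proof -
        have "1 \<le> z ^ 4" using z1 by (rule one_le_power)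
        then have "1 / e \<le> rn" using rn z1 by (simp add: e_def field_simps)
        then have "sqrt (4 * pi) * (1 / e) \<le> sqrt (4 * pi) * rn" by (rule mult_left_mono) simp
        then show ?thesis by simp
      qed
      finally have "sqrt (pi / (e\<^sup>2 / 4)) ^ CARD('d) \<le> (sqrt (4 * pi) * rn) ^ CARD('d)"
        by (rule power_mono) simp
      then have "3 * real n powr (- A) * sqrt (pi / (e\<^sup>2 / 4)) ^ CARD('d) \<le> 3 * real n powr (- A) * (sqrt (4 * pi) * rn) ^ CARD('d)"
        by (rule mult_left_mono) simp
      also have "\<dots> = 3 * sqrt (4 * pi) ^ CARD('d) * (real n powr (- A) * rn ^ CARD('d))" by (simp add: power_mult_distrib)
      also have "real n powr (- A) * rn ^ CARD('d) = 1 / rn"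
      proof -
        have "rn ^ CARD('d) = real n powr (d / 2)"
          using n1 by (simp add: rn_def d_def powr_half_sqrt[symmetric] powr_realpow[symmetric] powr_powr)
        then have "real n powr (- A) * rn ^ CARD('d) = real n powr (- (1 / 2))"
          by (simp add: A_def flip: powr_add)
        also have "\<dots> = 1 / rn" using n1 by (simp add: rn_def powr_minus powr_half_sqrt field_simps)
        finally show ?thesis .
      qed
      also have "3 * sqrt (4 * pi) ^ CARD('d) * (1 / rn) \<le> 3 * sqrt (4 * pi) ^ CARD('d) * (z\<^sup>2 / rn)"
        using z1 rn by (intro mult_left_mono divide_right_mono) (auto simp: one_le_power)
      finally show ?thesis .
    qed
    also have "b * sqrt (pi / (c / 2)) ^ CARD('d) + 3 * sqrt (4 * pi) ^ CARD('d) * (z\<^sup>2 / rn) = C2 * (z\<^sup>2 / rn)"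
      by (simp add: b_def C2_def algebra_simps)
    finally show ?case unfolding e P_def G_def z_def rn_def by simp
  qed
  then show ?thesis using C2 by blast
qed

text \<open>
  \<open>smoothing_inequality\<close> with \<open>z = n^\<beta>\<close>, Gaussian scale \<open>e = z^4 / sqrt n\<close>, neighborhood radius \<open>a = e z\<close> and ball
  radius \<open>R = z\<close>. The Gaussian tails are smaller than any power of \<open>n\<close>; the radius costs \<open>z^5 / sqrt n\<close> and the
  density term \<open>z^(d+2) / sqrt n\<close>. Both are at most \<open>n^(-1/2 + \<alpha>)\<close> if \<open>(d + 5) \<beta> \<le> \<alpha>\<close>.
\<close>

proposition nbhd_estimate:
  assumes inv: "invertible (asymp_cov M T f)" and \<alpha>: "0 < \<alpha>"
  shows "\<exists>C>0. eventually (\<lambda>n. \<forall>S\<in>sets borel. measure (distr M borel (normalized_sum T f n)) S \<le>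
    measure (normal_distr 0 (asymp_cov M T f)) (open_nbhd (C * real n powr (- 1 / 2 + \<alpha>)) S) + C * real n powr (- 1 / 2 + \<alpha>)) sequentially"
proof -
  define G where "G = normal_distr 0 (asymp_cov M T f)"
  note nd = normal_distr_properties[OF asymp_cov_sym asymp_cov_pos[OF inv], folded G_def]
  define d where "d = CARD('d)"
  \<comment> \<open>The bound \<open>1 / 10\<close> keeps the Gaussian scale at most \<open>1\<close>.\<close>
  define \<beta> where "\<beta> = min (\<alpha> / (real d + 5)) (1 / 10)"
  have \<beta>: "0 < \<beta>" "\<beta> \<le> 1 / 10" by (unfold \<beta>_def, use \<alpha> in simp, rule min.cobounded2)
  have \<beta>\<alpha>: "\<beta> * (real d + 5) \<le> \<alpha>"
  proof -
    have "\<beta> \<le> \<alpha> / (real d + 5)" by (simp add: \<beta>_def)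
    then show ?thesis by (simp add: field_simps add_pos_nonneg)
  qed
  obtain C where C: "0 \<le> C" and ev: "eventually (\<lambda>n. (\<integral>s. cmod (char_fun (distr M borel (normalized_sum T f n)) s
      - char_fun G s) * exp (- (((real n powr \<beta>) ^ 4 / sqrt (real n))\<^sup>2 * (norm s)\<^sup>2) / 2) \<partial>lborel)
    \<le> C * ((real n powr \<beta>)\<^sup>2 / sqrt (real n))) sequentially"
    using char_fun_distance[OF inv \<beta>] unfolding G_def by blast
  obtain c where c: "0 < c" "\<And>r. 0 \<le> r \<Longrightarrow> measure G {x. r \<le> norm x} \<le> sqrt 2 ^ d * exp (- (c * r\<^sup>2))"
    using nd(4) unfolding d_def by blast
  define V where "V = unit_ball_vol (real CARD('d))"
  have V0: "0 \<le> V" by (simp add: V_def)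
  define C3 where "C3 = 2 + 4 * sqrt 2 ^ d + 2 * (C / (2 * pi) ^ d) * (2 ^ d * V)"
  have C3: "2 \<le> C3" unfolding C3_def using C V0 by simp
  have "(\<lambda>n. real n powr (1 / 2) * exp (- (1 / 4 * (real n powr \<beta>)\<^sup>2))) \<longlonglongrightarrow> 0"
    using \<beta>(1) by real_asymp
  then have ev1: "eventually (\<lambda>n. real n powr (1 / 2) * exp (- (1 / 4 * (real n powr \<beta>)\<^sup>2)) < 1) sequentially"
    by (rule order_tendstoD(2)) simp
  have "(\<lambda>n. real n powr (1 / 2) * exp (- (c * (real n powr \<beta>)\<^sup>2))) \<longlonglongrightarrow> 0"
    using \<beta>(1) c(1) by real_asymp
  then have ev2: "eventually (\<lambda>n. real n powr (1 / 2) * exp (- (c * (real n powr \<beta>)\<^sup>2)) < 1) sequentially"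
    by (rule order_tendstoD(2)) simp
  have "eventually (\<lambda>n. \<forall>S\<in>sets borel. measure (distr M borel (normalized_sum T f n)) S \<le>
    measure G (open_nbhd (C3 * real n powr (- 1 / 2 + \<alpha>)) S) + C3 * real n powr (- 1 / 2 + \<alpha>)) sequentially"
    using ev ev1 ev2 eventually_gt_at_top[of 0]
  proof eventually_elim
    case (elim n)
    have n1: "1 \<le> real n" using elim(4) by simp
    define z where "z = real n powr \<beta>"
    have z1: "1 \<le> z" using n1 \<beta> by (simp add: z_def ge_one_powr_ge_zero)
    define rn where "rn = sqrt (real n)"
    have rn: "1 \<le> rn" "rn\<^sup>2 = real n" using n1 by (simp_all add: rn_def)
    have rnp: "real n powr (1 / 2) = rn" by (simp add: rn_def powr_half_sqrt)
    define e where "e = z ^ 4 / rn"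
    have e0: "0 < e" using z1 rn by (simp add: e_def)
    have e1: "e \<le> 1"
    proof -
      have "z ^ 4 = real n powr (\<beta> * 4)" using n1 by (simp add: z_def powr_realpow[symmetric] powr_powr)
      also have "\<dots> \<le> real n powr (1 / 2)" using n1 \<beta> by (intro powr_mono) auto
      finally show ?thesis using rn rnp by (simp add: e_def)
    qed
    define P where "P = distr M borel (normalized_sum T f n)"
    have P: "prob_space P" "sets P = sets borel" unfolding P_def by (auto intro: prob_space_distr)
    define \<tau> where "\<tau> = z ^ (d + 5) / rn"
    have t1: "1 / rn \<le> \<tau>" unfolding \<tau>_def using z1 rn by (intro divide_right_mono one_le_power) auto
    have \<tau>0: "0 < \<tau>" using z1 rn by (simp add: \<tau>_def)
    have \<tau>: "\<tau> \<le> real n powr (- 1 / 2 + \<alpha>)"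
    proof -
      have "z ^ (d + 5) = real n powr (\<beta> * real (d + 5))" using n1 by (simp add: z_def powr_realpow[symmetric] powr_powr)
      also have "\<dots> \<le> real n powr \<alpha>" using n1 \<beta>\<alpha> by (intro powr_mono) auto
      finally have "\<tau> \<le> real n powr \<alpha> / rn" unfolding \<tau>_def using rn by (intro divide_right_mono) auto
      also have "\<dots> = real n powr (\<alpha> - 1 / 2)" by (simp only: rnp[symmetric] powr_diff)
      also have "\<alpha> - 1 / 2 = - 1 / 2 + \<alpha>" by simp
      finally show ?thesis .
    qed
    have x1: "exp (- (z\<^sup>2 / 4)) \<le> \<tau>"
    proof -
      have "rn * exp (- (z\<^sup>2 / 4)) \<le> 1" using elim(2) unfolding rnp z_def[symmetric] by simp
      then have "exp (- (z\<^sup>2 / 4)) \<le> 1 / rn" using rn by (simp add: field_simps)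
      then show ?thesis using t1 by linarith
    qed
    have x2: "exp (- (c * z\<^sup>2)) \<le> \<tau>"
    proof -
      have "rn * exp (- (c * z\<^sup>2)) \<le> 1" using elim(3) unfolding rnp z_def[symmetric] by simp
      then have "exp (- (c * z\<^sup>2)) \<le> 1 / rn" using rn by (simp add: field_simps)
      then show ?thesis using t1 by linarith
    qed
    show ?case
      unfolding P_def[symmetric]
    proof
      fix S :: "(real^'d) set" assume S: "S \<in> sets borel"
      interpret G: prob_space G by (rule nd)
      define a where "a = e * z"
      have a0: "0 < a" using e0 z1 by (simp add: a_def)
      define I where "I = (\<integral>s. cmod (char_fun P s - char_fun G s) * exp (- (e\<^sup>2 * (norm s)\<^sup>2) / 2) \<partial>lborel)"
      have "measure P S \<le> measure G (open_nbhd (2 * a) S) + 2 * (sqrt 2 ^ CARD('d) * exp (- (a / e)\<^sup>2 / 4)) + sqrt 2 ^ CARD('d) * exp (- (z / e)\<^sup>2 / 4)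
        + measure G {x. z \<le> norm x} + 2 * (I / (2 * pi) ^ CARD('d)) * measure lborel (cball (0::real^'d) (2 * z))"
        unfolding I_def using z1 by (intro smoothing_inequality P nd e0 a0 S) auto
      also have "\<dots> \<le> measure G (open_nbhd (C3 * real n powr (- 1 / 2 + \<alpha>)) S) + 2 * (sqrt 2 ^ d * \<tau>) + sqrt 2 ^ d * \<tau> + sqrt 2 ^ d * \<tau> + 2 * (C / (2 * pi) ^ d) * (2 ^ d * V) * \<tau>"
      proof (intro add_mono)
        have "2 * a = 2 * (z ^ 5 / rn)" by (simp add: a_def e_def power_numeral_reduce)
        also have "\<dots> \<le> 2 * \<tau>" unfolding \<tau>_def using z1 rn by (intro mult_left_mono divide_right_mono power_increasing) auto
        also have "\<dots> \<le> C3 * real n powr (- 1 / 2 + \<alpha>)" using C3 \<tau> \<tau>0 by (intro mult_mono) auto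
        finally have "open_nbhd (2 * a) S \<subseteq> open_nbhd (C3 * real n powr (- 1 / 2 + \<alpha>)) S" by (rule open_nbhd_mono)
        then show "measure G (open_nbhd (2 * a) S) \<le> measure G (open_nbhd (C3 * real n powr (- 1 / 2 + \<alpha>)) S)"
          by (rule G.finite_measure_mono) (auto simp: nd(2) intro!: borel_open open_open_nbhd)
        have "a / e = z" using e0 by (simp add: a_def)
        then show "2 * (sqrt 2 ^ CARD('d) * exp (- (a / e)\<^sup>2 / 4)) \<le> 2 * (sqrt 2 ^ d * \<tau>)"
          using x1 by (simp add: d_def)
        have "z \<le> z / e" using e0 e1 z1 by (simp add: field_simps mult_left_le)
        then have "z\<^sup>2 \<le> (z / e)\<^sup>2" using z1 by (intro power_mono) auto
        then have "exp (- (z / e)\<^sup>2 / 4) \<le> exp (- (z\<^sup>2 / 4))" by simp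
        then have "exp (- (z / e)\<^sup>2 / 4) \<le> \<tau>" using x1 by linarith
        then show "sqrt 2 ^ CARD('d) * exp (- (z / e)\<^sup>2 / 4) \<le> sqrt 2 ^ d * \<tau>"
          unfolding d_def by (rule mult_left_mono) simp
        have "measure G {x. z \<le> norm x} \<le> sqrt 2 ^ d * exp (- (c * z\<^sup>2))" using c(2)[of z] z1 by simp
        also have "\<dots> \<le> sqrt 2 ^ d * \<tau>" by (rule mult_left_mono[OF x2]) simp
        finally show "measure G {x. z \<le> norm x} \<le> sqrt 2 ^ d * \<tau>" .
        have I: "I \<le> C * (z\<^sup>2 / rn)"
          using elim(1) unfolding z_def[symmetric] rn_def[symmetric] e_def[symmetric] P_def[symmetric] I_def .
        have vol: "measure lborel (cball (0::real^'d) (2 * z)) = (2 * z) ^ d * V"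
          using z1 content_cball[of "2 * z" "0::real^'d"] by (simp add: V_def d_def mult_ac)
        have "2 * (I / (2 * pi) ^ CARD('d)) * measure lborel (cball (0::real^'d) (2 * z)) \<le> 2 * (C * (z\<^sup>2 / rn) / (2 * pi) ^ d) * ((2 * z) ^ d * V)"
          unfolding vol d_def using I z1 V0 by (intro mult_right_mono mult_left_mono divide_right_mono) auto
        also have "\<dots> = 2 * (C / (2 * pi) ^ d) * (2 ^ d * V) * (z ^ (d + 2) / rn)"
          by (simp add: power_mult_distrib power_add power2_eq_square mult_ac)
        also have "\<dots> \<le> 2 * (C / (2 * pi) ^ d) * (2 ^ d * V) * \<tau>"
          unfolding \<tau>_def using C V0 z1 rn by (intro mult_left_mono divide_right_mono power_increasing) auto
        finally show "2 * (I / (2 * pi) ^ CARD('d)) * measure lborel (cball (0::real^'d) (2 * z)) \<le> 2 * (C / (2 * pi) ^ d) * (2 ^ d * V) * \<tau>" .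
      qed
      also have "\<dots> = measure G (open_nbhd (C3 * real n powr (- 1 / 2 + \<alpha>)) S) + (C3 - 2) * \<tau>"
        by (simp add: C3_def algebra_simps)
      also have "(C3 - 2) * \<tau> \<le> C3 * real n powr (- 1 / 2 + \<alpha>)"
        using C3 \<tau> \<tau>0 by (intro mult_mono) auto
      finally show "measure P S \<le> measure G (open_nbhd (C3 * real n powr (- 1 / 2 + \<alpha>)) S) + C3 * real n powr (- 1 / 2 + \<alpha>)"
        by simp
    qed
  qed
  then show ?thesis unfolding G_def using C3 by (intro exI[of _ C3] conjI) auto
qed

theorem clt_and_rate:
  assumes inv: "invertible (asymp_cov M T f)"
  shows "weakly_converges (\<lambda>n. distr M borel (normalized_sum T f n)) (normal_distr 0 (asymp_cov M T f))"
    and "0 < \<alpha> \<Longrightarrow> (\<lambda>n. prokhorov (distr M borel (normalized_sum T f n)) (normal_distr 0 (asymp_cov M T f)))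
                   \<in> O(\<lambda>n. real n powr (- 1 / 2 + \<alpha>))"
proof -
  let ?G = "normal_distr 0 (asymp_cov M T f)"
  note nd = normal_distr_properties(1,2)[OF asymp_cov_sym asymp_cov_pos[OF inv]]
  have P: "prob_space (distr M borel (normalized_sum T f n))" "sets (distr M borel (normalized_sum T f n)) = sets borel" for n
    by (auto intro: prob_space_distr)
  obtain C where C: "0 < C" "eventually (\<lambda>n. \<forall>S\<in>sets borel. measure (distr M borel (normalized_sum T f n)) S \<le>
    measure ?G (open_nbhd (C * real n powr (- 1 / 2 + 1 / 4)) S) + C * real n powr (- 1 / 2 + 1 / 4)) sequentially"
    using nbhd_estimate[OF inv, of "1 / 4"] by auto
  have "(\<lambda>n. C * real n powr (- 1 / 2 + 1 / 4)) \<longlonglongrightarrow> 0" by real_asymp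
  then show "weakly_converges (\<lambda>n. distr M borel (normalized_sum T f n)) ?G"
    using weakly_converges_if_nbhd[where e="\<lambda>n. C * real n powr (- 1 / 2 + 1 / 4)"
        and P="\<lambda>n. distr M borel (normalized_sum T f n)" and Q="?G"] P nd C(2) by blast
  assume \<alpha>: "0 < \<alpha>"
  obtain C where C: "0 < C" "eventually (\<lambda>n. \<forall>S\<in>sets borel. measure (distr M borel (normalized_sum T f n)) S \<le>
    measure ?G (open_nbhd (C * real n powr (- 1 / 2 + \<alpha>)) S) + C * real n powr (- 1 / 2 + \<alpha>)) sequentially"
    using nbhd_estimate[OF inv \<alpha>] by blast
  show "(\<lambda>n. prokhorov (distr M borel (normalized_sum T f n)) ?G) \<in> O(\<lambda>n. real n powr (- 1 / 2 + \<alpha>))"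
  proof (rule bigoI)
    show "eventually (\<lambda>n. norm (prokhorov (distr M borel (normalized_sum T f n)) ?G) \<le> C * norm (real n powr (- 1 / 2 + \<alpha>))) sequentially"
      using C(2) eventually_gt_at_top[of 0]
    proof eventually_elim
      case (elim n)
      have "0 < C * real n powr (- 1 / 2 + \<alpha>)" using C(1) elim(2) by simp
      from prokhorov_bounds[OF P(1) nd this] elim(1) show ?case by simp
    qed
  qed
qed

end

theorem theorem2p2:
  fixes M :: "'a::metric_space measure"
    and T :: "'a \<Rightarrow> 'a"
    and \<eta> :: real
    and f :: "'a \<Rightarrow> real ^ 'd"
  assumes "prob_space M"
    and "sets M = sets borel"
    and "T \<in> measurable M M"
    and "distr M M T = M"
    and "0 < \<eta>" and "\<eta> \<le> 1"
    and "\<exists>r\<ge>1. property_P M T \<eta> r"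
    and "bounded_holder \<eta> f"
    and "(LINT x|M. f x) = 0"
    and "invertible (asymp_cov M T f)"
  shows "weakly_converges (\<lambda>n. distr M borel (normalized_sum T f n)) (normal_distr 0 (asymp_cov M T f)) \<and>
         (\<forall>\<alpha>>0. (\<lambda>n. prokhorov (distr M borel (normalized_sum T f n)) (normal_distr 0 (asymp_cov M T f)))
                   \<in> O(\<lambda>n. real n powr (- 1 / 2 + \<alpha>)))"
proof -
  obtain r P \<delta> where r: "1 \<le> r" and P: "\<forall>i. 0 \<le> coeff P i" and \<delta>: "0 < \<delta>" "\<delta> < 1"
    and dec: "\<And>(m::nat) (m'::nat) (f :: nat \<Rightarrow> 'a \<Rightarrow> complex) (k :: nat \<Rightarrow> nat) (l :: nat \<Rightarrow> nat) (n::nat).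
          1 \<le> m \<Longrightarrow> 1 \<le> m' \<Longrightarrow>
          (\<forall>i\<in>{1..m+m'}. bounded_holder \<eta> (f i)) \<Longrightarrow>
          strict_mono_on {1..m} k \<Longrightarrow> strict_mono_on {1..m'} l \<Longrightarrow>
          norm (cov M (\<lambda>x. \<Prod>i=1..m. f i ((T ^^ k i) x))
                      (\<lambda>x. \<Prod>j=1..m'. f (m + j) ((T ^^ (n + l j)) x)))
          \<le> ((\<Prod>i=1..m+m'. sup_norm (f i))
              + (\<Sum>i=1..m+m'. holder_const \<eta> (f i) * (\<Prod>j\<in>{1..m+m'} - {i}. sup_norm (f j))))
             * poly P (real (l m')) * \<delta> powr (real n - r * real (k m))"
    using assms(7) unfolding property_P_def by blast
  define R where "R = nat \<lceil>r\<rceil>"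
  have R: "1 \<le> R" "r \<le> real R" using r unfolding R_def by linarith+
  obtain B where B: "0 < B" "\<And>x. norm (f x) \<le> B"
    using assms(8) unfolding bounded_holder_def bounded_pos by auto
  obtain H0 where H0: "\<And>x y. dist (f x) (f y) \<le> H0 * dist x y powr \<eta>"
    using assms(8) unfolding bounded_holder_def by blast
  define H where "H = max H0 0"
  have H: "norm (f x - f y) \<le> H * dist x y powr \<eta>" for x y
  proof -
    have "H0 * dist x y powr \<eta> \<le> H * dist x y powr \<eta>" by (intro mult_right_mono) (auto simp: H_def)
    then show ?thesis using H0[of x y] by (simp add: dist_norm)
  qed
  interpret prob_space M by fact
  interpret decorrelated_observable M T \<eta> f P \<delta> R B H
  proof
    fix m m' :: nat and g :: "nat \<Rightarrow> 'a \<Rightarrow> complex" and k l :: "nat \<Rightarrow> nat" and n :: nat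
    assume m: "1 \<le> m" "1 \<le> m'" and g: "\<forall>i\<in>{1..m+m'}. bounded_holder \<eta> (g i)"
      and k: "strict_mono_on {1..m} k" and l: "strict_mono_on {1..m'} l"
    let ?S = "(\<Prod>i=1..m+m'. sup_norm (g i)) + (\<Sum>i=1..m+m'. holder_const \<eta> (g i) * (\<Prod>j\<in>{1..m+m'} - {i}. sup_norm (g j)))"
    let ?c = "norm (cov M (\<lambda>x. \<Prod>i=1..m. g i ((T ^^ k i) x)) (\<lambda>x. \<Prod>j=1..m'. g (m + j) ((T ^^ (n + l j)) x)))"
    have le: "?c \<le> ?S * poly P (real (l m')) * \<delta> powr (real n - r * real (k m))"
      by (rule dec[OF m g k l])
    \<comment> \<open>The bound is nonnegative because it dominates a norm; so the power of \<open>\<delta>\<close> may be enlarged.\<close>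
    have pos: "0 < \<delta> powr (real n - r * real (k m))" using \<delta> by simp
    have "0 \<le> ?S * poly P (real (l m')) * \<delta> powr (real n - r * real (k m))"
      using le norm_ge_zero order_trans by blast
    then have S0: "0 \<le> ?S * poly P (real (l m'))" using pos by (simp only: zero_le_mult_iff) linarith
    have "\<delta> powr (real n - r * real (k m)) \<le> \<delta> powr (real n - real R * real (k m))"
      using \<delta> R by (intro powr_mono') (auto intro: mult_right_mono)
    from mult_left_mono[OF this S0] le
    show "?c \<le> ?S * poly P (real (l m')) * \<delta> powr (real n - real R * real (k m))" by linarith
  qed (use assms P \<delta> R B H in \<open>auto simp: H_def\<close>)
  show ?thesis using clt_and_rate[OF assms(10)] by blast
qed

end
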